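(* For all integers $\ell,k\ge 2$, $$f(\ell,k)\ \ge\ \bigl(5\lfloor \ell/2\rfloor+(\ell \bmod 2)-1\bigr)(k-1)+1,$$ and $$f_s(\ell,k)\ \ge\ \max\{4,\,2(\ell-1)\}\,(k-1)+1 .$$
   Context: A polytope is a convex polytope; a $d$-polytope is a polytope of dimension $d$. A $d$-polytope is simple if every vertex lies in exactly $d$ facets. A polytope counts as a face of itself. A simplex $\ell$-face is an $\ell$-dimensional face that is an $\ell$-simplex; a cube $k$-face is a $k$-dimensional face combinatorially isomorphic to the $k$-cube $C^k=[0,1]^k$. For integers $\ell,k\ge1$, $f(\ell,k)$ is the smallest integer such that every $d$-polytope with $d\ge f(\ell,k)$ contains a simplex $\ell$-face or a cube $k$-face, with $f(\ell,k)=\infty$ if no such integer exists; $f_s(\ell,k)$ is the corresponding threshold when only simple $d$-polytopes are considered (again $\infty$ if no such integer exists). Here $\ell \bmod 2\in\{0,1\}$ denotes the remainder of $\ell$ on division by $2$. *)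

theory Defs
  imports "HOL-Analysis.Analysis" "HOL-Analysis.Finite_Function_Topology"
begin

text \<open>
  The thresholds quantify over polytopes of all dimensions at once, so all polytopes are placed in the
  space \<^typ>\<open>nat \<Rightarrow>\<^sub>0 real\<close> of finitely supported real sequences, i.e. the union of the
  spaces \<open>\<real>\<^sup>n\<close> for all \<open>n\<close>; every polytope spans a finite-dimensional affine subspace of it.
  The library constants \<^const>\<open>polytope\<close>, \<^const>\<open>face_of\<close> and \<^const>\<open>extreme_point_of\<close> are
  available for every real vector space, but \<^const>\<open>aff_dim\<close>, \<^const>\<open>facet_of\<close> and
  \<^const>\<open>simplex\<close> only for Euclidean spaces; the next three definitions restate the latter,
  for nonnegative dimension, without that restriction.
\<close>

definition has_dim :: "'a::real_vector set \<Rightarrow> nat \<Rightarrow> bool" where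
  "has_dim S d \<longleftrightarrow>
     (\<exists>B. affine hull B = affine hull S \<and> \<not> affine_dependent B \<and> card B = d + 1)"

definition is_facet :: "'a::real_vector set \<Rightarrow> 'a set \<Rightarrow> bool" where
  "is_facet F P \<longleftrightarrow> F face_of P \<and> (\<exists>n. has_dim F n \<and> has_dim P (n + 1))"

definition is_simplex :: "nat \<Rightarrow> 'a::real_vector set \<Rightarrow> bool" where
  "is_simplex n S \<longleftrightarrow>
     (\<exists>C. \<not> affine_dependent C \<and> card C = n + 1 \<and> S = convex hull C)"

lemma has_dim_iff_aff_dim:
  fixes S :: "'a::euclidean_space set"
  shows "has_dim S d \<longleftrightarrow> aff_dim S = int d"
proof
  assume "has_dim S d"
  then obtain B where B: "affine hull B = affine hull S" "\<not> affine_dependent B" "card B = d + 1"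
    unfolding has_dim_def by blast
  then show "aff_dim S = int d"
    using aff_dim_unique[of B S] by simp
next
  assume d: "aff_dim S = int d"
  obtain B where "affine hull B = affine hull S" "\<not> affine_dependent B" "int (card B) = aff_dim S + 1"
    using aff_dim_basis_exists by metis
  with d show "has_dim S d"
    unfolding has_dim_def by (intro exI[of _ B]) auto
qed

lemma has_dim_nonempty: "has_dim S d \<Longrightarrow> S \<noteq> {}"
  unfolding has_dim_def by (metis affine_hull_eq_empty card.empty Suc_eq_plus1 nat.distinct(1))

lemma is_facet_iff_facet_of:
  fixes F P :: "'a::euclidean_space set"
  shows "is_facet F P \<longleftrightarrow> F facet_of P"
proof
  assume "is_facet F P"
  then show "F facet_of P"
    using has_dim_nonempty unfolding is_facet_def facet_of_def by (fastforce simp: has_dim_iff_aff_dim)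
next
  assume *: "F facet_of P"
  then have "F \<noteq> {}"
    by (simp add: facet_of_def)
  then have "aff_dim F \<ge> 0"
    using aff_dim_geq[of F] aff_dim_empty[of F] by linarith
  then obtain n where "aff_dim F = int n"
    using nonneg_int_cases by blast
  moreover from this * have "aff_dim P = int (n + 1)"
    by (simp add: facet_of_def)
  ultimately show "is_facet F P"
    using * unfolding is_facet_def facet_of_def has_dim_iff_aff_dim by blast
qed

lemma is_simplex_iff_simplex:
  fixes S :: "'a::euclidean_space set"
  shows "is_simplex n S \<longleftrightarrow> int n simplex S"
proof -
  have "card C = n + 1 \<longleftrightarrow> int (card C) = int n + 1" for C :: "'a set"
    by linarith
  then show ?thesis
    by (simp add: is_simplex_def simplex_def)
qed

definition is_polytope :: "nat \<Rightarrow> 'a::real_vector set \<Rightarrow> bool" where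
  "is_polytope d P \<longleftrightarrow> polytope P \<and> has_dim P d"

definition is_simple_polytope :: "nat \<Rightarrow> 'a::real_vector set \<Rightarrow> bool" where
  "is_simple_polytope d P \<longleftrightarrow>
     is_polytope d P \<and> (\<forall>v. v extreme_point_of P \<longrightarrow> card {F. is_facet F P \<and> v \<in> F} = d)"

text \<open>
  Isomorphism of face lattices. Both \<open>{}\<close> and the set itself count as faces for
  \<^const>\<open>face_of\<close>.
\<close>
definition comb_iso :: "'a::real_vector set \<Rightarrow> 'b::real_vector set \<Rightarrow> bool" where
  "comb_iso P Q \<longleftrightarrow>
     (\<exists>\<phi>. bij_betw \<phi> {F. F face_of P} {G. G face_of Q} \<and>
          (\<forall>F G. F face_of P \<longrightarrow> G face_of P \<longrightarrow> (F \<subseteq> G \<longleftrightarrow> \<phi> F \<subseteq> \<phi> G)))"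

definition std_cube :: "nat \<Rightarrow> (nat \<Rightarrow>\<^sub>0 real) set" where
  "std_cube k = {x. (\<forall>i<k. Poly_Mapping.lookup x i \<in> {0..1}) \<and> (\<forall>i\<ge>k. Poly_Mapping.lookup x i = 0)}"

definition has_simplex_face :: "nat \<Rightarrow> 'a::real_vector set \<Rightarrow> bool" where
  "has_simplex_face l P \<longleftrightarrow> (\<exists>F. F face_of P \<and> is_simplex l F)"

definition has_cube_face :: "nat \<Rightarrow> 'a::real_vector set \<Rightarrow> bool" where
  "has_cube_face k P \<longleftrightarrow> (\<exists>F. F face_of P \<and> has_dim F k \<and> comb_iso F (std_cube k))"

text \<open>In \<^typ>\<open>enat\<close> the infimum of the empty set is \<open>\<infinity>\<close>.\<close>

definition f_threshold :: "nat \<Rightarrow> nat \<Rightarrow> enat" where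
  "f_threshold l k =
     Inf {enat n | n. \<forall>d\<ge>n. \<forall>P :: (nat \<Rightarrow>\<^sub>0 real) set.
            is_polytope d P \<longrightarrow> has_simplex_face l P \<or> has_cube_face k P}"

definition fs_threshold :: "nat \<Rightarrow> nat \<Rightarrow> enat" where
  "fs_threshold l k =
     Inf {enat n | n. \<forall>d\<ge>n. \<forall>P :: (nat \<Rightarrow>\<^sub>0 real) set.
            is_simple_polytope d P \<longrightarrow> has_simplex_face l P \<or> has_cube_face k P}"

end

theory Submission
  imports Defs
begin

text \<open>
  Let \<open>Q\<close> be a polytope without quadrilateral 2-faces and without simplex \<open>l\<close>-faces. Faces of a product
  are products of faces, so the \<open>(k - 1)\<close>-fold power of \<open>Q\<close> has no simplex \<open>l\<close>-face either, and it has no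
  cube \<open>k\<close>-face: two of the \<open>k\<close> edges of such a cube at a vertex would lie in the same factor, and they
  would span a quadrilateral of \<open>Q\<close>. So \<open>Q\<close> should have large dimension.

  In general one takes the join of \<open>l div 2\<close> copies of the 120-cell, together with one further point if
  \<open>l\<close> is odd. The 120-cell is simple of dimension 4, and all its 2-faces are pentagons.

  For simple polytopes and \<open>l \<ge> 3\<close> one takes the section of the cube \<open>[0, 1] ^ (2 * l - 1)\<close> in which
  the coordinate sum is \<open>l - 1 / 2\<close>, and for \<open>l = 2\<close> the 120-cell.

  In both building blocks, two edges at a common vertex form an obtuse angle or lie in a triangle.
  There are no quadrilaterals because a quadrilateral cannot have four obtuse angles.
\<close>

section \<open>Faces and their vertex sets\<close>

text \<open>Two quantities compete: the dimension of a building block and the number of vertices of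
  its largest simplex face. A simplex face of a join is a join of simplex faces; each 120-cell,
  whose simplex faces are at most edges, therefore adds 2 vertices and 4 + 1 dimensions. Products
  add dimensions without enlarging simplex faces. Joins of 120-cells are not simple, so the simple
  case needs another block: the middle section has dimension \<open>2 * n\<close> and simplex faces
  with at most \<open>n + 1\<close> vertices, used for \<open>n = l - 1\<close>. For
  \<open>l = 2\<close> it would be a hexagon, hence the 120-cell and the 4 in the maximum. The
  blocks live in different spaces, and the thresholds in an infinite-dimensional one. So faces are
  represented by the points of a finite set that they contain, in any real vector space, and being a
  face becomes a statement about finite conic combinations (\<open>facial_iff\<close>). This form
  splits along joins, and facehood is invariant under injective linear maps.\<close>

definition facial :: "'a::real_vector set \<Rightarrow> 'a set \<Rightarrow> bool" where
  "facial V A \<longleftrightarrow> (\<exists>F. F face_of convex hull V \<and> A = V \<inter> F)"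

lemma facial_subset: "facial V A \<Longrightarrow> A \<subseteq> V"
  by (auto simp: facial_def)

lemma facial_empty [simp]: "facial V {}"
  unfolding facial_def by (rule exI[of _ "{}"]) simp

text \<open>If \<open>v\<close> has weight strictly between 0 and 1, the point lies strictly between
  \<open>v\<close> and the renormalised combination \<open>y\<close> of the others, and a face that
  contains an inner point of a segment contains its ends.\<close>

lemma face_contains_support:
  fixes u :: "'a::real_vector \<Rightarrow> real"
  assumes F: "F face_of S" and S: "convex S" and V: "finite V" "V \<subseteq> S"
    and u: "\<And>x. x \<in> V \<Longrightarrow> 0 \<le> u x" "sum u V = 1" and mem: "(\<Sum>x\<in>V. u x *\<^sub>R x) \<in> F"
    and v: "v \<in> V" "u v \<noteq> 0"
  shows "v \<in> F"
proof -
  define s where "s = sum u (V - {v})"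
  have s: "u v + s = 1" "s \<ge> 0"
    using u V(1) v(1) by (auto simp: s_def sum.remove[of V v] intro: sum_nonneg)
  have split: "(\<Sum>x\<in>V. u x *\<^sub>R x) = u v *\<^sub>R v + (\<Sum>x\<in>V - {v}. u x *\<^sub>R x)"
    using V(1) v(1) by (simp add: sum.remove)
  show ?thesis
  proof (cases "s = 0")
    case True
    then have "u x = 0" if "x \<in> V - {v}" for x
      using that u(1) V(1) unfolding s_def by (subst (asm) sum_nonneg_eq_0_iff) auto
    with split s True have "(\<Sum>x\<in>V. u x *\<^sub>R x) = v" by simp
    with mem show ?thesis by simp
  next
    case False
    define y where "y = (\<Sum>x\<in>V - {v}. (u x / s) *\<^sub>R x)"
    have "y \<in> S"
      unfolding y_def
    proof (rule convex_sum)
      show "sum (\<lambda>x. u x / s) (V - {v}) = 1"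
        using False by (simp add: sum_divide_distrib[symmetric] s_def)
    qed (use V S u s in auto)
    have eq: "(\<Sum>x\<in>V. u x *\<^sub>R x) = (1 - s) *\<^sub>R v + s *\<^sub>R y"
    proof -
      have "s *\<^sub>R y = (\<Sum>x\<in>V - {v}. u x *\<^sub>R x)"
        using False by (simp add: y_def scaleR_sum_right)
      moreover have "u v = 1 - s" using s by simp
      ultimately show ?thesis by (simp add: split)
    qed
    show ?thesis
    proof (cases "y = v")
      case True
      then have "(\<Sum>x\<in>V. u x *\<^sub>R x) = v"
        unfolding eq by (simp flip: scaleR_left_distrib)
      with mem show ?thesis by simp
    next
      case False
      have "s < 1" "s > 0" using s \<open>s \<noteq> 0\<close> u(1)[OF v(1)] v(2) by auto
      then have "(\<Sum>x\<in>V. u x *\<^sub>R x) \<in> open_segment v y"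
        using False eq by (auto simp: in_segment)
      then show ?thesis
        using face_ofD[OF F _ _ \<open>y \<in> S\<close> mem] V(2) v(1) by blast
    qed
  qed
qed

text \<open>A convex combination that lies in \<open>F\<close> gives weight 0 to all points of
  \<open>V\<close> outside \<open>F\<close>.\<close>

lemma face_eq_convex_hull:
  fixes V :: "'a::real_vector set"
  assumes "finite V" and F: "F face_of convex hull V"
  shows "F = convex hull (V \<inter> F)"
proof
  show "F \<subseteq> convex hull (V \<inter> F)"
  proof
    fix x assume x: "x \<in> F"
    then obtain u where u: "\<And>y. y \<in> V \<Longrightarrow> 0 \<le> u y" "sum u V = 1" "(\<Sum>y\<in>V. u y *\<^sub>R y) = x"
      using face_of_imp_subset[OF F] convex_hull_finite[OF assms(1)] by auto
    have "u y = 0" if "y \<in> V - F" for y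
      using face_contains_support[OF F convex_convex_hull assms(1) hull_subset u(1,2)] u(3) x that
      by auto
    then have "sum u (V \<inter> F) = 1" "(\<Sum>y\<in>V \<inter> F. u y *\<^sub>R y) = x"
      unfolding u(2,3)[symmetric] using assms(1) by (intro sum.mono_neutral_left; force)+
    then show "x \<in> convex hull (V \<inter> F)"
      using assms(1) u(1) by (subst convex_hull_finite) auto
  qed
  show "convex hull (V \<inter> F) \<subseteq> F"
    using F by (intro hull_minimal) (auto simp: face_of_def)
qed

lemma facial_convex_hull_face:
  assumes "finite V" "facial V A"
  shows "convex hull A face_of convex hull V" "V \<inter> convex hull A = A"
  using assms face_eq_convex_hull unfolding facial_def by metis+

text \<open>Stated for cones rather than for convex combinations: no normalisation of the weights.\<close>

lemma facial_iff:
  fixes V :: "'a::real_vector set"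
  assumes fin: "finite V"
  shows "facial V A \<longleftrightarrow> A \<subseteq> V \<and>
    (\<forall>u w. (\<forall>x\<in>V. 0 \<le> u x) \<longrightarrow> (\<forall>x\<in>A. 0 \<le> w x) \<longrightarrow> sum u V = sum w A \<longrightarrow>
       (\<Sum>x\<in>V. u x *\<^sub>R x) = (\<Sum>x\<in>A. w x *\<^sub>R x) \<longrightarrow> (\<forall>x\<in>V - A. u x = (0::real)))"
    (is "_ \<longleftrightarrow> _ \<and> ?R")
proof
  assume fac: "facial V A"
  have fA: "finite A" using fac fin facial_subset finite_subset by blast
  have ?R
  proof (intro allI impI ballI)
    fix u w x
    assume u: "\<forall>x\<in>V. 0 \<le> u x" and w: "\<forall>x\<in>A. 0 \<le> w x" and s: "sum u V = sum w A"
      and eq: "(\<Sum>x\<in>V. u x *\<^sub>R x) = (\<Sum>x\<in>A. w x *\<^sub>R x)" and x: "x \<in> V - A"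
    show "u x = 0"
    proof (cases "sum u V = 0")
      case True
      with u fin x show ?thesis by (simp add: sum_nonneg_eq_0_iff)
    next
      case False
      let ?s = "sum u V"
      have pos: "?s > 0" using False u by (simp add: sum_nonneg order_less_le)
      have mem: "(\<Sum>y\<in>V. (u y / ?s) *\<^sub>R y) \<in> convex hull A"
      proof -
        have "(\<Sum>y\<in>V. (u y / ?s) *\<^sub>R y) = (1 / ?s) *\<^sub>R (\<Sum>y\<in>V. u y *\<^sub>R y)"
          by (simp add: scaleR_sum_right)
        also have "\<dots> = (\<Sum>y\<in>A. (w y / ?s) *\<^sub>R y)"
          by (simp add: eq scaleR_sum_right)
        finally show ?thesis
          using fA w pos s False
          by (subst convex_hull_finite) (auto intro!: exI[of _ "\<lambda>y. w y / ?s"] simp: sum_divide_distrib[symmetric])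
      qed
      have "u x / ?s = 0"
      proof (rule ccontr)
        assume "u x / ?s \<noteq> 0"
        then have "x \<in> convex hull A"
          using face_contains_support[OF facial_convex_hull_face(1)[OF fin fac] convex_convex_hull fin
              hull_subset _ _ mem] u pos x
          by (auto simp: sum_divide_distrib[symmetric])
        with x facial_convex_hull_face(2)[OF fin fac] show False by auto
      qed
      with False show ?thesis by simp
    qed
  qed
  then show "A \<subseteq> V \<and> ?R" using facial_subset[OF fac] by blast
next
  assume *: "A \<subseteq> V \<and> ?R"
  then have fA: "finite A" using fin finite_subset by blast
  have sub: "convex hull A \<subseteq> convex hull V" using * by (simp add: hull_mono)
  \<comment> \<open>An inner point of a segment inherits mixed weights from both ends. Outside
    \<open>A\<close> these vanish, and as sums of nonnegative terms they vanish for \<open>a\<close>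
    too.\<close>
  have key: "a \<in> convex hull A" 
    if ab: "a \<in> convex hull V" "b \<in> convex hull V" and z: "z \<in> convex hull A" "z \<in> open_segment a b" for a b z
  proof -
    obtain ua where ua: "\<forall>y\<in>V. 0 \<le> ua y" "sum ua V = 1" "(\<Sum>y\<in>V. ua y *\<^sub>R y) = a"
      using ab(1) convex_hull_finite[OF fin] by auto
    obtain ub where ub: "\<forall>y\<in>V. 0 \<le> ub y" "sum ub V = 1" "(\<Sum>y\<in>V. ub y *\<^sub>R y) = b"
      using ab(2) convex_hull_finite[OF fin] by auto
    obtain w where w: "\<forall>y\<in>A. 0 \<le> w y" "sum w A = 1" "(\<Sum>y\<in>A. w y *\<^sub>R y) = z"
      using z(1) convex_hull_finite[OF fA] by auto
    obtain t where t: "0 < t" "t < 1" "z = (1 - t) *\<^sub>R a + t *\<^sub>R b"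
      using z(2) by (auto simp: in_segment)
    define u where "u y = (1 - t) * ua y + t * ub y" for y
    have "sum u V = 1"
      using ua ub by (simp add: u_def sum.distrib sum_distrib_left[symmetric])
    moreover have "(\<Sum>y\<in>V. u y *\<^sub>R y) = z"
      unfolding t(3) ua(3)[symmetric] ub(3)[symmetric]
      by (simp add: u_def sum.distrib scaleR_sum_right scaleR_left_distrib)
    moreover have "\<forall>y\<in>V. 0 \<le> u y" using ua ub t by (simp add: u_def)
    ultimately have "\<forall>y\<in>V - A. u y = 0" using * w by auto
    moreover have "0 \<le> ua y" "0 \<le> ub y" if "y \<in> V" for y using ua ub that by auto
    ultimately have "\<forall>y\<in>V - A. ua y = 0"
      using t unfolding u_def by (metis DiffD1 add_nonneg_eq_0_iff diff_gt_0_iff_gt less_eq_real_def mult_eq_0_iff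
        mult_nonneg_nonneg order_less_irrefl)
    then have "sum ua A = sum ua V" "(\<Sum>y\<in>A. ua y *\<^sub>R y) = (\<Sum>y\<in>V. ua y *\<^sub>R y)"
      using * fin by (auto intro!: sum.mono_neutral_left)
    with ua * fA show "a \<in> convex hull A" by (subst convex_hull_finite) auto
  qed
  have "convex hull A face_of convex hull V"
    unfolding face_of_def using sub key open_segment_commute by (metis convex_convex_hull)
  moreover have "A = V \<inter> convex hull A"
  proof -
    have "x \<in> A" if x: "x \<in> V" "x \<in> convex hull A" for x
    proof (rule ccontr)
      assume "x \<notin> A"
      obtain w where w: "\<forall>y\<in>A. 0 \<le> w y" "sum w A = 1" "(\<Sum>y\<in>A. w y *\<^sub>R y) = x"
        using x(2) convex_hull_finite[OF fA] by auto
      \<comment> \<open>The combination of \<open>x\<close> from \<open>A\<close> is compared with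
        weight 1 on \<open>x\<close> itself; for \<open>x\<close> outside \<open>A\<close> the
        criterion would make this weight 0.\<close>
      define u where "u y = (if y = x then 1 else 0 :: real)" for y
      have "\<forall>y\<in>V. 0 \<le> u y" "sum u V = sum w A" "(\<Sum>y\<in>V. u y *\<^sub>R y) = (\<Sum>y\<in>A. w y *\<^sub>R y)"
        using w x fin by (simp_all add: u_def if_distrib[of "\<lambda>c. c *\<^sub>R _"] cong: if_cong)
      with *[THEN conjunct2, rule_format, of u w x] w x \<open>x \<notin> A\<close> have "u x = 0" by blast
      then show False by (simp add: u_def)
    qed
    then show ?thesis using * hull_subset[of A convex] by blast
  qed
  ultimately show "facial V A" unfolding facial_def by blast
qed

text \<open>Applying \<open>g\<close> to both sides of the conic criterion gives a vanishing sum of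
  nonnegative terms \<open>u x * (g x - c)\<close>.\<close>

lemma facial_supporting:
  fixes g :: "'a::real_vector \<Rightarrow> real"
  assumes fin: "finite V" and g: "linear g" and ge: "\<And>x. x \<in> V \<Longrightarrow> c \<le> g x"
  shows "facial V {x \<in> V. g x = c}"
  unfolding facial_iff[OF fin]
proof (intro conjI allI impI ballI)
  let ?A = "{x \<in> V. g x = c}"
  fix u w :: "'a \<Rightarrow> real" and x
  assume u: "\<forall>x\<in>V. 0 \<le> u x" and s: "sum u V = sum w ?A"
      and eq: "(\<Sum>x\<in>V. u x *\<^sub>R x) = (\<Sum>x\<in>?A. w x *\<^sub>R x)" and x: "x \<in> V - ?A"
  have "(\<Sum>x\<in>V. u x * g x) = (\<Sum>x\<in>?A. w x * g x)"
    using arg_cong[OF eq, of g] by (simp add: linear_sum[OF g] linear_scale[OF g])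
  also have "\<dots> = c * sum u V" by (simp add: s sum_distrib_left mult.commute)
  finally have "(\<Sum>x\<in>V. u x * (g x - c)) = 0"
    by (simp add: right_diff_distrib sum_subtractf sum_distrib_left mult.commute)
  then have "\<forall>x\<in>V. u x * (g x - c) = 0"
    using u ge fin by (subst (asm) sum_nonneg_eq_0_iff) auto
  with x show "u x = 0" by auto
qed auto

lemma facial_linear_image:
  fixes f :: "'a::real_vector \<Rightarrow> 'b::real_vector"
  assumes "linear f" "inj f"
  shows "facial (f ` V) (f ` A) \<longleftrightarrow> facial V A"
proof -
  have hull: "convex hull (f ` V) = f ` (convex hull V)"
    using assms(1) by (simp add: convex_hull_linear_image)
  show ?thesis
  proof
    assume "facial (f ` V) (f ` A)"
    then obtain F where F: "F face_of f ` (convex hull V)" "f ` A = f ` V \<inter> F"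
      unfolding facial_def hull by blast
    then obtain G where G: "G face_of convex hull V" "F = f ` G"
      using faces_of_linear_image[OF assms] by blast
    then have "f ` A = f ` (V \<inter> G)" using F assms(2) by (simp add: image_Int)
    then have "A = V \<inter> G" using assms(2) by (simp add: inj_image_eq_iff)
    with G show "facial V A" unfolding facial_def by blast
  next
    assume "facial V A"
    then obtain F where "F face_of convex hull V" "A = V \<inter> F" unfolding facial_def by blast
    then show "facial (f ` V) (f ` A)"
      unfolding facial_def hull
      by (intro exI[of _ "f ` F"]) (simp add: face_of_linear_image assms image_Int)
  qed
qed

lemma facial_singleton_extreme:
  assumes "finite V"
  shows "facial V {v} \<longleftrightarrow> v extreme_point_of (convex hull V)"
proof
  assume "facial V {v}"
  then show "v extreme_point_of (convex hull V)"
    using facial_convex_hull_face(1)[OF assms, of "{v}"] by (simp flip: face_of_singleton)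
next
  assume v: "v extreme_point_of (convex hull V)"
  then have "V \<inter> {v} = {v}" using extreme_point_of_convex_hull by fastforce
  with v show "facial V {v}" unfolding facial_def face_of_singleton[symmetric] by metis
qed

section \<open>Combinatorial simplices and cubes\<close>

lemma facial_trans:
  assumes "finite V" "facial V A" "facial A B"
  shows "facial V B"
proof -
  have fA: "finite A" using assms facial_subset finite_subset by blast
  have "convex hull B face_of convex hull V"
    using facial_convex_hull_face(1) assms fA face_of_trans by metis
  moreover have "V \<inter> convex hull B = B"
    using facial_convex_hull_face(2)[OF assms(1,2)] facial_convex_hull_face(2)[OF fA assms(3)]
      facial_subset[OF assms(3)] hull_mono[of B A convex] by blast
  ultimately show ?thesis unfolding facial_def by metis
qed

text \<open>Simplex faces are seen only through the face lattice: every subset of their vertices is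
  facial. The bound counts vertices, so \<open>simplicial_bound V l\<close> excludes simplex
  \<open>l\<close>-faces, which have \<open>l + 1\<close> of them.\<close>

definition simplicial_bound :: "'a::real_vector set \<Rightarrow> nat \<Rightarrow> bool" where
  "simplicial_bound V s \<longleftrightarrow> (\<forall>A. facial V A \<and> (\<forall>B\<subseteq>A. facial V B) \<longrightarrow> card A \<le> s)"

text \<open>The difference of the two weight functions is an affine dependence of \<open>C\<close>,
  hence zero, and off \<open>B\<close> it equals \<open>u\<close>.\<close>

lemma facial_affine_independent:
  fixes C :: "'a::real_vector set"
  assumes ind: "\<not> affine_dependent C" and fin: "finite C" and "B \<subseteq> C"
  shows "facial C B"
  unfolding facial_iff[OF fin]
proof (intro conjI allI impI ballI)
  fix u w :: "'a \<Rightarrow> real" and x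
  assume s: "sum u C = sum w B" and eq: "(\<Sum>x\<in>C. u x *\<^sub>R x) = (\<Sum>x\<in>B. w x *\<^sub>R x)"
    and x: "x \<in> C - B"
  define z where "z y = u y - (if y \<in> B then w y else 0)" for y
  have "C \<inter> {y. y \<in> B} = B" using \<open>B \<subseteq> C\<close> by auto
  then have "sum z C = 0" "(\<Sum>y\<in>C. z y *\<^sub>R y) = 0"
    using s eq fin by (simp_all add: z_def sum_subtractf scaleR_left_diff_distrib
        if_distrib[of "\<lambda>c. c *\<^sub>R _"] sum.If_cases cong: if_cong)
  then have "z x = 0"
    using ind x unfolding affine_dependent_explicit_finite[OF fin] by blast
  with x show "u x = 0" by (simp add: z_def)
qed (rule assms)

text \<open>A simplex face brings its own vertex set \<open>C\<close>. It coincides with the points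
  of \<open>V\<close> in the face, because both consist of the extreme points of that face.\<close>

lemma no_simplex_face:
  assumes fin: "finite V" and ext: "\<And>v. v \<in> V \<Longrightarrow> facial V {v}" and bound: "simplicial_bound V l"
  shows "\<not> has_simplex_face l (convex hull V)"
proof
  assume "has_simplex_face l (convex hull V)"
  then obtain C where C: "convex hull C face_of convex hull V" "\<not> affine_dependent C" "card C = l + 1"
    unfolding has_simplex_face_def is_simplex_def by blast
  have finC: "finite C" using C(3) by (intro card_ge_0_finite) simp
  let ?A = "V \<inter> convex hull C"
  have A: "facial V ?A" using C(1) unfolding facial_def by blast
  have hull: "convex hull C = convex hull ?A"
    using face_eq_convex_hull[OF fin C(1)] .
  have "facial C {c}" if "c \<in> C" for c
    using facial_affine_independent[OF C(2) finC] that by blast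
  then have "c extreme_point_of convex hull ?A" if "c \<in> C" for c
    using that facial_singleton_extreme[OF finC] hull by auto
  then have "C \<subseteq> ?A" using extreme_point_of_convex_hull by blast
  moreover have "a \<in> C" if "a \<in> ?A" for a
  proof -
    have "a extreme_point_of convex hull V"
      using that ext facial_singleton_extreme[OF fin] by auto
    then have "a extreme_point_of convex hull C"
      using that face_of_imp_subset[OF C(1)] by (auto simp: extreme_point_of_def)
    then show ?thesis using extreme_point_of_convex_hull by blast
  qed
  ultimately have "?A = C" by blast
  with A have "facial V C" by simp
  then have "facial V B" if "B \<subseteq> C" for B
    using facial_trans[OF fin] facial_affine_independent[OF C(2) finC that] by blast
  with \<open>facial V C\<close> bound C(3) show False
    unfolding simplicial_bound_def by fastforce
qed

text \<open>A quadrilateral 2-face with its vertices in cyclic order, in terms of the face lattice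
  alone. The condition on the diagonals excludes the tetrahedron.\<close>

definition square :: "'a::real_vector set \<Rightarrow> 'a \<Rightarrow> 'a \<Rightarrow> 'a \<Rightarrow> 'a \<Rightarrow> bool" where
  "square V a b c d \<longleftrightarrow> distinct [a, b, c, d] \<and> facial V {a, b, c, d} \<and>
     facial V {a, b} \<and> facial V {b, c} \<and> facial V {c, d} \<and> facial V {d, a} \<and>
     \<not> facial V {a, c} \<and> \<not> facial V {b, d}"

definition no_square :: "'a::real_vector set \<Rightarrow> bool" where
  "no_square V \<longleftrightarrow> (\<forall>a b c d. \<not> square V a b c d)"

text \<open>The vertices of a combinatorial cube are indexed by the subsets of \<open>I\<close>; only its
  2-dimensional faces are recorded.\<close>

definition cubical :: "'a::real_vector set \<Rightarrow> nat set \<Rightarrow> (nat set \<Rightarrow> 'a) \<Rightarrow> bool" where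
  "cubical V I q \<longleftrightarrow> (\<forall>S i j. S \<subseteq> I \<longrightarrow> i \<in> I - S \<longrightarrow> j \<in> I - S \<longrightarrow> i \<noteq> j \<longrightarrow>
     square V (q S) (q (insert i S)) (q (insert i (insert j S))) (q (insert j S)))"

text \<open>The index set is arbitrary rather than \<open>{..<k}\<close>, because the induction over
  products passes to a subset of the directions.\<close>

definition cube_free :: "'a::real_vector set \<Rightarrow> nat \<Rightarrow> bool" where
  "cube_free V k \<longleftrightarrow> (\<forall>I q. finite I \<and> card I = k \<longrightarrow> \<not> cubical V I q)"

lemma no_square_cube_free:
  assumes "no_square V" "k \<ge> 2"
  shows "cube_free V k"
  unfolding cube_free_def
proof (intro allI impI notI)
  fix I :: "nat set" and q
  assume I: "finite I \<and> card I = k" and q: "cubical V I q"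
  then obtain i j where "i \<in> I" "j \<in> I" "i \<noteq> j"
    using assms(2) card_le_Suc0_iff_eq[of I] by fastforce
  then have "square V (q {}) (q {i}) (q {i, j}) (q {j})"
    using q[unfolded cubical_def, rule_format, of "{}" i j] by simp
  with assms(1) show False unfolding no_square_def by blast
qed

section \<open>Faces of the standard cube, and cube faces of a polytope\<close>

lemma lookup_scaleR [simp]:
  "Poly_Mapping.lookup (r *\<^sub>R x) i = r *\<^sub>R Poly_Mapping.lookup (x :: 'a \<Rightarrow>\<^sub>0 'b::real_vector) i"
proof -
  have "finite {i. r *\<^sub>R Poly_Mapping.lookup x i \<noteq> 0}"
    by (rule finite_subset[OF _ finite_lookup[of x]]) auto
  then show ?thesis
    by (simp add: scaleR_poly_mapping_def)
qed

definition cube_vertex :: "nat set \<Rightarrow> (nat \<Rightarrow>\<^sub>0 real)" where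
  "cube_vertex S = (\<Sum>i\<in>S. Poly_Mapping.single i 1)"

lemma lookup_cube_vertex: "finite S \<Longrightarrow> Poly_Mapping.lookup (cube_vertex S) i = (if i \<in> S then 1 else 0)"
  unfolding cube_vertex_def by (simp add: lookup_sum lookup_single when_def)

lemma cube_vertex_in_std_cube: "S \<subseteq> {..<k} \<Longrightarrow> cube_vertex S \<in> std_cube k"
  using finite_subset[of S "{..<k}"] by (auto simp: std_cube_def lookup_cube_vertex)

text \<open>A coordinate that is 0 or 1 at an inner point of a segment in the cube has this value at
  both ends. The vertices of the face are the sets between \<open>S\<close> and
  \<open>T\<close>.\<close>

lemma subcube_face:
  "{x \<in> std_cube k. (\<forall>i\<in>S. Poly_Mapping.lookup x i = 1) \<and> (\<forall>i\<in>{..<k} - T. Poly_Mapping.lookup x i = 0)}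
     face_of std_cube k" (is "?F face_of _") if "S \<subseteq> {..<k}"
proof -
  have "convex ?F"
    by (rule convexI) (auto simp: std_cube_def lookup_add convex_bound_le)
  moreover have "a \<in> ?F" if ab: "a \<in> std_cube k" "b \<in> std_cube k" "x \<in> ?F" "x \<in> open_segment a b" for a b x
  proof -
    obtain t where t: "0 < t" "t < 1" "x = (1 - t) *\<^sub>R a + t *\<^sub>R b"
      using ab(4) by (auto simp: in_segment)
    have "Poly_Mapping.lookup a i = 1" if "i \<in> S" for i
    proof -
      have i: "i < k" using that \<open>S \<subseteq> {..<k}\<close> by auto
      have "(1 - t) * (1 - Poly_Mapping.lookup a i) + t * (1 - Poly_Mapping.lookup b i) = 0"
      proof -
        have "(1 - t) * Poly_Mapping.lookup a i + t * Poly_Mapping.lookup b i = 1"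
          using ab(3) that by (simp add: t(3) lookup_add)
        then show ?thesis by (simp add: algebra_simps)
      qed
      moreover have "0 \<le> 1 - Poly_Mapping.lookup a i" "0 \<le> 1 - Poly_Mapping.lookup b i"
        using ab(1,2) i by (auto simp: std_cube_def)
      ultimately have "(1 - t) * (1 - Poly_Mapping.lookup a i) = 0"
        using t by (subst (asm) add_nonneg_eq_0_iff) auto
      with t show ?thesis by simp
    qed
    moreover have "Poly_Mapping.lookup a i = 0" if "i \<in> {..<k} - T" for i
    proof -
      have "(1 - t) * Poly_Mapping.lookup a i + t * Poly_Mapping.lookup b i = 0"
        using ab(3) that by (simp add: t(3) lookup_add)
      moreover have "0 \<le> Poly_Mapping.lookup a i" "0 \<le> Poly_Mapping.lookup b i"
        using ab(1,2) that by (auto simp: std_cube_def)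
      ultimately have "(1 - t) * Poly_Mapping.lookup a i = 0"
        using t by (subst (asm) add_nonneg_eq_0_iff) auto
      with t show ?thesis by simp
    qed
    ultimately show ?thesis using ab(1) by auto
  qed
  ultimately show ?thesis
    unfolding face_of_def using open_segment_commute by blast
qed

text \<open>At a point of \<open>G\<close> with the fewest coordinates different from 0 and 1, any
  such coordinate could still be moved to 0 without leaving \<open>G\<close>.\<close>

lemma std_cube_face_has_vertex:
  assumes G: "G face_of std_cube k" and "G \<noteq> {}"
  obtains S where "S \<subseteq> {..<k}" "cube_vertex S \<in> G"
proof -
  define fr where "fr x = {i. i < k \<and> Poly_Mapping.lookup x i \<noteq> 0 \<and> Poly_Mapping.lookup x i \<noteq> 1}"
    for x :: "nat \<Rightarrow>\<^sub>0 real"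
  obtain x where x: "x \<in> G" and min: "\<And>y. y \<in> G \<Longrightarrow> card (fr x) \<le> card (fr y)"
    using ex_has_least_nat[of "\<lambda>x. x \<in> G" _ "\<lambda>x. card (fr x)"] \<open>G \<noteq> {}\<close> by blast
  have xc: "x \<in> std_cube k" using x face_of_imp_subset[OF G] by blast
  have "fr x = {}"
  proof (rule ccontr)
    assume "fr x \<noteq> {}"
    then obtain i where i: "i \<in> fr x" by blast
    define c where "c = Poly_Mapping.lookup x i"
    have c: "0 < c" "c < 1" using xc i by (auto simp: std_cube_def fr_def c_def order_less_le)
    \<comment> \<open>Coordinate \<open>i\<close> becomes 0 in \<open>a\<close> and 1 in
      \<open>b\<close>, so \<open>x\<close> is an inner point of the segment and the face
      \<open>G\<close> contains \<open>a\<close>.\<close>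
    define a where "a = x - Poly_Mapping.single i c"
    define b where "b = x + Poly_Mapping.single i (1 - c)"
    have ab: "a \<in> std_cube k" "b \<in> std_cube k"
      using xc i c by (auto simp: std_cube_def a_def b_def fr_def lookup_minus lookup_add lookup_single
          when_def c_def)
    have "x = (1 - c) *\<^sub>R a + c *\<^sub>R b"
      by (rule poly_mapping_eqI)
        (simp add: a_def b_def lookup_add lookup_minus lookup_single when_def algebra_simps)
    moreover have "a \<noteq> b"
    proof
      assume "a = b"
      then have "Poly_Mapping.lookup a i = Poly_Mapping.lookup b i" by simp
      then show False by (simp add: a_def b_def lookup_add lookup_minus)
    qed
    ultimately have "x \<in> open_segment a b" using c by (auto simp: in_segment)
    then have "a \<in> G" using face_ofD[OF G _ ab x] by blast
    moreover have "fr a \<subset> fr x"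
      using i by (auto simp: fr_def a_def c_def lookup_minus lookup_single when_def)
    then have "card (fr a) < card (fr x)"
      by (intro psubset_card_mono) (auto simp: fr_def)
    ultimately show False using min by fastforce
  qed
  define S where "S = {i. i < k \<and> Poly_Mapping.lookup x i = 1}"
  have "x = cube_vertex S"
  proof (rule poly_mapping_eqI)
    fix i show "Poly_Mapping.lookup x i = Poly_Mapping.lookup (cube_vertex S) i"
      using \<open>fr x = {}\<close> xc by (cases "i < k") (auto simp: lookup_cube_vertex S_def fr_def std_cube_def)
  qed
  then show ?thesis using that[of S] x by (auto simp: S_def)
qed

text \<open>The lattice isomorphism matches the cube vertices with minimal nonempty faces, that is,
  with points of \<open>V\<close>, and subcubes with faces. That diagonals are no edges comes from
  the geometry of the standard cube, where both diagonals of a square have the same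
  midpoint.\<close>

lemma cubical_of_cube_face:
  fixes V :: "'a::real_vector set"
  assumes fin: "finite V" and ext: "\<And>v. v \<in> V \<Longrightarrow> facial V {v}"
    and F: "F face_of convex hull V" and iso: "comb_iso F (std_cube k)"
  shows "\<exists>q. cubical V {..<k} q"
proof -
  obtain \<phi> where \<phi>: "bij_betw \<phi> {G. G face_of F} {C. C face_of std_cube k}"
    "\<And>G H. G face_of F \<Longrightarrow> H face_of F \<Longrightarrow> (G \<subseteq> H \<longleftrightarrow> \<phi> G \<subseteq> \<phi> H)"
    using iso unfolding comb_iso_def by blast
  define \<psi> where "\<psi> = inv_into {G. G face_of F} \<phi>"
  have face: "\<psi> C face_of F" "\<phi> (\<psi> C) = C" if "C face_of std_cube k" for C
    using that bij_betw_inv_into_right[OF \<phi>(1), of C] bij_betw_inv_into[OF \<phi>(1)]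
    by (auto simp: \<psi>_def bij_betw_def)
  have mono: "\<psi> C \<subseteq> \<psi> D \<longleftrightarrow> C \<subseteq> D" if "C face_of std_cube k" "D face_of std_cube k" for C D
    using face that \<phi>(2) by metis
  have surj: "\<exists>C. C face_of std_cube k \<and> \<psi> C = G" if "G face_of F" for G
    using that \<phi>(1) bij_betw_inv_into_left[OF \<phi>(1)] unfolding \<psi>_def bij_betw_def by blast
  have empty: "\<psi> {} = {}" using surj[of "{}"] mono[of "{}"] by auto
  have nonempty: "\<psi> C \<noteq> {}" if "C face_of std_cube k" "C \<noteq> {}" for C
    using mono[OF that(1), of "{}"] that(2) empty by auto
  have faceV: "\<psi> C face_of convex hull V" if "C face_of std_cube k" for C
    using face(1)[OF that] F by (rule face_of_trans)
  have facV: "facial V (V \<inter> \<psi> C)" if "C face_of std_cube k" for C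
    using faceV[OF that] unfolding facial_def by blast
  have vtx: "{cube_vertex S} face_of std_cube k" if "S \<subseteq> {..<k}" for S
  proof -
    have "finite S" using that finite_subset by blast
    have "x = cube_vertex S"
      if x: "x \<in> std_cube k" "\<forall>i\<in>S. Poly_Mapping.lookup x i = 1" "\<forall>i\<in>{..<k} - S. Poly_Mapping.lookup x i = 0" for x
    proof (rule poly_mapping_eqI)
      fix i show "Poly_Mapping.lookup x i = Poly_Mapping.lookup (cube_vertex S) i"
        using x \<open>finite S\<close> by (cases "i < k") (auto simp: lookup_cube_vertex std_cube_def)
    qed
    moreover have "cube_vertex S \<in> std_cube k" "\<forall>i\<in>S. Poly_Mapping.lookup (cube_vertex S) i = 1"
      "\<forall>i\<in>{..<k} - S. Poly_Mapping.lookup (cube_vertex S) i = 0"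
      using cube_vertex_in_std_cube[OF that] \<open>finite S\<close> by (simp_all add: lookup_cube_vertex)
    ultimately have "{x \<in> std_cube k. (\<forall>i\<in>S. Poly_Mapping.lookup x i = 1) \<and>
        (\<forall>i\<in>{..<k} - S. Poly_Mapping.lookup x i = 0)} = {cube_vertex S}"
      by blast
    with subcube_face[OF that, of S] show ?thesis by simp
  qed
  \<comment> \<open>Points of \<open>V\<close> in \<open>F\<close> are images of nonempty cube
    faces. If such a point lies in the image of a cube vertex, its cube face must be that
    vertex.\<close>
  have below: "\<exists>C. C face_of std_cube k \<and> \<psi> C = {v} \<and> C \<noteq> {}" if "v \<in> V" "v \<in> F" for v
  proof -
    have "{v} face_of convex hull V"
      using ext[OF that(1)] facial_singleton_extreme[OF fin] by (simp add: face_of_singleton)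
    then have "{v} face_of F" using face_of_face[OF F] that(2) by blast
    then show ?thesis using surj empty by (metis insert_not_empty)
  qed
  have "\<exists>v\<in>V. \<psi> {cube_vertex S} = {v}" if S: "S \<subseteq> {..<k}" for S
  proof -
    have "\<psi> {cube_vertex S} \<noteq> {}" using nonempty vtx[OF S] by blast
    then obtain v where v: "v \<in> V" "v \<in> \<psi> {cube_vertex S}"
      using face_eq_convex_hull[OF fin faceV[OF vtx[OF S]]] by (metis Int_iff convex_hull_empty equals0I)
    then obtain C where C: "C face_of std_cube k" "\<psi> C = {v}" "C \<noteq> {}"
      using below face_of_imp_subset[OF face(1)[OF vtx[OF S]]] by blast
    then have "C \<subseteq> {cube_vertex S}" using mono[OF C(1) vtx[OF S]] v by simp
    with C v show ?thesis by (metis subset_singletonD)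
  qed
  then obtain q where q: "\<And>S. S \<subseteq> {..<k} \<Longrightarrow> q S \<in> V" "\<And>S. S \<subseteq> {..<k} \<Longrightarrow> \<psi> {cube_vertex S} = {q S}"
    by metis
  have mem: "q S \<in> \<psi> C \<longleftrightarrow> cube_vertex S \<in> C" if "S \<subseteq> {..<k}" "C face_of std_cube k" for S C
    using mono[OF vtx[OF that(1)] that(2)] q(2)[OF that(1)] by simp
  have inj: "S = T" if "S \<subseteq> {..<k}" "T \<subseteq> {..<k}" "q S = q T" for S T
  proof -
    have "cube_vertex S = cube_vertex T"
      using mono[OF vtx vtx, OF that(1,2)] q(2) that by auto
    moreover have "finite S" "finite T" using that finite_subset by blast+
    ultimately show ?thesis using lookup_cube_vertex by (metis set_eqI zero_neq_one)
  qed
  \<comment> \<open>No further points of \<open>V\<close> lie in the image of the subcube, since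
    each comes from a nonempty cube face, which has a vertex. Edges and 2-faces are the cases
    used.\<close>
  have interval: "facial V (q ` {U. S \<subseteq> U \<and> U \<subseteq> T})" if S: "S \<subseteq> {..<k}" and T: "T \<subseteq> {..<k}" for S T
  proof -
    let ?C = "{x \<in> std_cube k. (\<forall>i\<in>S. Poly_Mapping.lookup x i = 1) \<and>
        (\<forall>i\<in>{..<k} - T. Poly_Mapping.lookup x i = 0)}"
    have C: "?C face_of std_cube k" by (rule subcube_face[OF S])
    have memC: "cube_vertex U \<in> ?C \<longleftrightarrow> S \<subseteq> U \<and> U \<subseteq> T" if U: "U \<subseteq> {..<k}" for U
      using cube_vertex_in_std_cube[OF U] U finite_subset[OF U] by (auto simp: lookup_cube_vertex)
    have "V \<inter> \<psi> ?C = q ` {U. S \<subseteq> U \<and> U \<subseteq> T}"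
    proof (intro equalityI subsetI)
      fix v assume v: "v \<in> V \<inter> \<psi> ?C"
      then obtain D where D: "D face_of std_cube k" "\<psi> D = {v}" "D \<noteq> {}"
        using below face_of_imp_subset[OF face(1)[OF C]] by blast
      then have "D \<subseteq> ?C" using mono[OF D(1) C] v by simp
      obtain U where U: "U \<subseteq> {..<k}" "cube_vertex U \<in> D"
        using std_cube_face_has_vertex D by metis
      then have "q U \<in> {v}" using mem[OF U(1) D(1)] D(2) by simp
      then show "v \<in> q ` {U. S \<subseteq> U \<and> U \<subseteq> T}"
        using memC[OF U(1)] \<open>D \<subseteq> ?C\<close> U(2) by blast
    next
      fix v assume "v \<in> q ` {U. S \<subseteq> U \<and> U \<subseteq> T}"
      then obtain U where U: "v = q U" "S \<subseteq> U" "U \<subseteq> T" by blast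
      then have "U \<subseteq> {..<k}" using T by blast
      then have "q U \<in> V" "q U \<in> \<psi> ?C" using mem[OF _ C] memC q(1) U by simp_all
      with U show "v \<in> V \<inter> \<psi> ?C" by simp
    qed
    then show ?thesis using facV[OF C] by simp
  qed
  \<comment> \<open>A face containing \<open>q A\<close> and \<open>q B\<close> corresponds to a
    cube face \<open>E\<close> that contains the midpoint of the two cube vertices. This is also the
    midpoint of the other diagonal, so the vertex of \<open>C\<close> lies in
    \<open>E\<close>.\<close>
  have diag: "\<not> facial V {q A, q B}"
    if sub: "A \<subseteq> {..<k}" "B \<subseteq> {..<k}" "C \<subseteq> {..<k}" "D \<subseteq> {..<k}"
      and eq: "cube_vertex A + cube_vertex B = cube_vertex C + cube_vertex D"
      and ne: "C \<noteq> D" "C \<noteq> A" "C \<noteq> B" for A B C D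
  proof
    assume "facial V {q A, q B}"
    then obtain G where G: "G face_of convex hull V" "{q A, q B} = V \<inter> G" unfolding facial_def by blast
    have "G \<inter> F face_of F"
      using face_of_Int[OF G(1) F] face_of_face[OF F] by blast
    then obtain E where E: "E face_of std_cube k" "\<psi> E = G \<inter> F" using surj by blast
    have "q U \<in> F" if "U \<subseteq> {..<k}" for U
      using face_of_imp_subset[OF face(1)[OF vtx[OF that]]] q(2)[OF that] by simp
    then have "q A \<in> \<psi> E" "q B \<in> \<psi> E" using G(2) E(2) sub by auto
    then have AB: "cube_vertex A \<in> E" "cube_vertex B \<in> E"
      using mem[OF sub(1) E(1)] mem[OF sub(2) E(1)] by simp_all
    have "(1/2) *\<^sub>R cube_vertex A + (1/2) *\<^sub>R cube_vertex B \<in> E"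
      using E(1) AB by (intro convexD) (auto simp: face_of_def)
    moreover have "(1/2) *\<^sub>R cube_vertex A + (1/2) *\<^sub>R cube_vertex B =
        (1/2) *\<^sub>R cube_vertex C + (1/2) *\<^sub>R cube_vertex D"
      using eq by (simp flip: scaleR_right_distrib)
    moreover have "cube_vertex C \<noteq> cube_vertex D"
      using ne(1) inj[OF sub(3,4)] q(2)[OF sub(3)] q(2)[OF sub(4)] by force
    then have "(1/2) *\<^sub>R cube_vertex C + (1/2) *\<^sub>R cube_vertex D \<in> open_segment (cube_vertex C) (cube_vertex D)"
      by (auto simp: in_segment intro!: exI[of _ "1/2"])
    ultimately have "cube_vertex C \<in> E"
      using face_ofD[OF E(1) _ cube_vertex_in_std_cube[OF sub(3)] cube_vertex_in_std_cube[OF sub(4)]] by simp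
    then have "q C \<in> V \<inter> G" using mem[OF sub(3) E(1)] E(2) q(1)[OF sub(3)] by simp
    then have "q C = q A \<or> q C = q B" using G(2) by blast
    then show False using inj[OF sub(3,1)] inj[OF sub(3,2)] ne by blast
  qed
  have "cubical V {..<k} q"
    unfolding cubical_def
  proof (intro allI impI)
    fix S i j assume S: "S \<subseteq> {..<k}" and i: "i \<in> {..<k} - S" and j: "j \<in> {..<k} - S" and ij: "i \<noteq> j"
    let ?a = S and ?b = "insert i S" and ?c = "insert i (insert j S)" and ?d = "insert j S"
    have sub: "?a \<subseteq> {..<k}" "?b \<subseteq> {..<k}" "?c \<subseteq> {..<k}" "?d \<subseteq> {..<k}" using S i j by auto
    have fS: "finite S" using S finite_subset by blast
    have ne: "?a \<noteq> ?b" "?a \<noteq> ?c" "?a \<noteq> ?d" "?b \<noteq> ?c" "?b \<noteq> ?d" "?c \<noteq> ?d" using i j ij by auto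
    have dist: "distinct [q ?a, q ?b, q ?c, q ?d]"
      using ne inj[OF sub(1,2)] inj[OF sub(1,3)] inj[OF sub(1,4)] inj[OF sub(2,3)] inj[OF sub(2,4)]
        inj[OF sub(3,4)] by auto
    have edge: "{U. T \<subseteq> U \<and> U \<subseteq> insert x T} = {T, insert x T}" for T and x :: nat by blast
    have "{U. ?a \<subseteq> U \<and> U \<subseteq> ?c} = {?a, ?b, ?c, ?d}" by blast
    then have "facial V {q ?a, q ?b, q ?c, q ?d}" using interval[OF sub(1,3)] by simp
    moreover have "facial V {q ?a, q ?b}" using interval[OF sub(1,2)] by (simp add: edge)
    moreover have "facial V {q ?a, q ?d}" using interval[OF sub(1,4)] by (simp add: edge)
    moreover have "facial V {q ?b, q ?c}"
      using interval[OF sub(2,3)] edge[of ?b j] by (simp add: insert_commute)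
    moreover have "facial V {q ?d, q ?c}" using interval[OF sub(4,3)] edge[of ?d i] by simp
    moreover have eq: "cube_vertex ?a + cube_vertex ?c = cube_vertex ?b + cube_vertex ?d"
      using fS i j ij by (intro poly_mapping_eqI) (auto simp: lookup_add lookup_cube_vertex)
    have "\<not> facial V {q ?a, q ?c}" using diag[OF sub(1,3,2,4) eq] ne by metis
    moreover have "\<not> facial V {q ?b, q ?d}" using diag[OF sub(2,4,1,3) eq[symmetric]] ne by metis
    ultimately show "square V (q ?a) (q ?b) (q ?c) (q ?d)"
      using dist unfolding square_def by (simp add: insert_commute)
  qed
  then show ?thesis by blast
qed

lemma no_cube_face:
  assumes "finite V" "\<And>v. v \<in> V \<Longrightarrow> facial V {v}" "cube_free V k"
  shows "\<not> has_cube_face k (convex hull V)"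
proof
  assume "has_cube_face k (convex hull V)"
  then obtain q where "cubical V {..<k} q"
    using cubical_of_cube_face[OF assms(1,2)] unfolding has_cube_face_def by blast
  then show False
    using assms(3)[unfolded cube_free_def, rule_format, of "{..<k}"] by simp
qed

section \<open>Products and joins\<close>

lemma face_of_Times_section:
  assumes H: "H face_of S \<times> T" and b: "b \<in> T"
  shows "{x. (x, b) \<in> H} face_of S"
  unfolding face_of_def
proof (intro conjI ballI impI)
  show "{x. (x, b) \<in> H} \<subseteq> S" using face_of_imp_subset[OF H] by blast
  have "convex H" using H by (simp add: face_of_def)
  then show "convex {x. (x, b) \<in> H}"
  proof (intro convexI CollectI)
    fix x y and u v :: real
    assume "x \<in> {x. (x, b) \<in> H}" "y \<in> {x. (x, b) \<in> H}" "0 \<le> u" "0 \<le> v" "u + v = 1"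
    then show "(u *\<^sub>R x + v *\<^sub>R y, b) \<in> H"
      using convexD[OF \<open>convex H\<close>, of "(x, b)" "(y, b)" u v] by (simp flip: scaleR_left_distrib)
  qed
next
  fix x y z assume xy: "x \<in> S" "y \<in> S" and z: "z \<in> {x. (x, b) \<in> H}" "z \<in> open_segment x y"
  then have "(z, b) \<in> open_segment (x, b) (y, b)"
    by (auto simp: in_segment simp flip: scaleR_left_distrib)
  then show "x \<in> {x. (x, b) \<in> H}" "y \<in> {x. (x, b) \<in> H}"
    using face_ofD[OF H] xy z b by blast+
qed

text \<open>The two given points and the two points with exchanged second coordinates have the same
  midpoint.\<close>

lemma face_of_Times_exchange:
  assumes H: "H face_of S \<times> T" and ab: "(a, b) \<in> H" "(a', b') \<in> H"
  shows "(a, b') \<in> H"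
proof (cases "(a, b') = (a', b)")
  case False
  have sub: "(a, b') \<in> S \<times> T" "(a', b) \<in> S \<times> T" using face_of_imp_subset[OF H] ab by auto
  have "(1/2) *\<^sub>R (a, b) + (1/2) *\<^sub>R (a', b') \<in> H"
    using H ab by (intro convexD) (auto simp: face_of_def)
  moreover have "(1/2) *\<^sub>R (a, b) + (1/2) *\<^sub>R (a', b') \<in> open_segment (a, b') (a', b)"
    using False by (auto simp: in_segment intro!: exI[of _ "1/2"])
  ultimately show ?thesis using face_ofD[OF H _ sub] by blast
qed (use ab in simp)

text \<open>By the exchange property a face of a product is the product of its two slices through
  any one of its points.\<close>

lemma facial_Times_iff:
  fixes V :: "'a::real_vector set" and W :: "'b::real_vector set"
  shows "facial (V \<times> W) C \<longleftrightarrow> (\<exists>A B. facial V A \<and> facial W B \<and> C = A \<times> B)"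
proof
  assume "facial (V \<times> W) C"
  then obtain H where H: "H face_of (convex hull V) \<times> (convex hull W)" "C = (V \<times> W) \<inter> H"
    unfolding facial_def convex_hull_Times by blast
  show "\<exists>A B. facial V A \<and> facial W B \<and> C = A \<times> B"
  proof (cases "C = {}")
    case True
    then show ?thesis by (intro exI[of _ "{}"]) (simp add: facial_empty)
  next
    case False
    then obtain a b where ab: "(a, b) \<in> C" by auto
    then have hull: "a \<in> convex hull V" "b \<in> convex hull W" using H(2) hull_inc by auto
    have swapH: "prod.swap ` H face_of (convex hull W) \<times> (convex hull V)"
    proof -
      have "linear (prod.swap :: 'a \<times> 'b \<Rightarrow> _)" by (rule linearI) auto
      from face_of_linear_image[OF this inj_swap] H(1) show ?thesis
        by (metis product_swap)
    qed
    define A B where "A = V \<inter> {x. (x, b) \<in> H}" and "B = W \<inter> {y. (y, a) \<in> prod.swap ` H}"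
    have "facial V A" "facial W B"
      unfolding facial_def A_def B_def
      using face_of_Times_section[OF H(1) hull(2)] face_of_Times_section[OF swapH hull(1)] by blast+
    moreover have "C = A \<times> B"
    proof -
      have ab': "(a, b) \<in> H" using ab H(2) by blast
      have H_iff: "(x, y) \<in> H \<longleftrightarrow> (x, b) \<in> H \<and> (a, y) \<in> H" for x y
        using face_of_Times_exchange[OF H(1) _ ab', of x y] face_of_Times_exchange[OF H(1) ab', of x y]
          face_of_Times_exchange[OF H(1), of x b a y] by blast
      have "y \<in> B \<longleftrightarrow> y \<in> W \<and> (a, y) \<in> H" for y by (force simp: B_def)
      then have "(x, y) \<in> C \<longleftrightarrow> (x, y) \<in> A \<times> B" for x y
        unfolding H(2) A_def using H_iff[of x y] by auto
      then show ?thesis by (intro set_eqI) (simp add: split_paired_all)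
    qed
    ultimately show ?thesis by (intro exI[of _ A] exI[of _ B]) simp
  qed
next
  assume "\<exists>A B. facial V A \<and> facial W B \<and> C = A \<times> B"
  then obtain A B where AB: "facial V A" "facial W B" "C = A \<times> B" by blast
  then obtain F where F: "F face_of convex hull V" "A = V \<inter> F" unfolding facial_def by blast
  from AB obtain G where G: "G face_of convex hull W" "B = W \<inter> G" unfolding facial_def by blast
  have "F \<times> G face_of (convex hull V) \<times> (convex hull W)" using F G by (intro face_of_Times)
  then show "facial (V \<times> W) C"
    unfolding facial_def convex_hull_Times
    using AB F G by (intro exI[of _ "F \<times> G"]) (simp add: Times_Int_Times)
qed

lemma facial_Times_singleton_iff:
  assumes "facial W {b}"
  shows "facial (V \<times> W) (A \<times> {b}) \<longleftrightarrow> facial V A"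
proof
  assume "facial (V \<times> W) (A \<times> {b})"
  then obtain A' B' where "facial V A'" "A \<times> {b} = A' \<times> B'" unfolding facial_Times_iff by blast
  then show "facial V A" by (cases "A = {}") (auto simp: facial_empty times_eq_iff)
qed (use assms facial_Times_iff in blast)

lemma facial_Times_swap:
  fixes V :: "'a::real_vector set" and W :: "'b::real_vector set"
  shows "facial (V \<times> W) C \<longleftrightarrow> facial (W \<times> V) (prod.swap ` C)"
proof -
  have "linear (prod.swap :: 'a \<times> 'b \<Rightarrow> _)" by (rule linearI) auto
  from facial_linear_image[OF this inj_swap, of "V \<times> W" C] show ?thesis by (simp add: product_swap)
qed

lemma square_Times_swap:
  fixes V :: "'a::real_vector set" and W :: "'b::real_vector set"
  shows "square (V \<times> W) p q r s \<longleftrightarrow> square (W \<times> V) (prod.swap p) (prod.swap q) (prod.swap r) (prod.swap s)"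
  by (simp add: square_def facial_Times_swap[of V W] inj_eq)

text \<open>Two points that differ in both coordinates do not form a product set, so they are not
  facial. A set with all subsets facial therefore lies in one fibre.\<close>

lemma simplicial_bound_Times:
  assumes "simplicial_bound V s" "simplicial_bound W s" "s \<ge> 1"
    "\<And>v. v \<in> V \<Longrightarrow> facial V {v}" "\<And>w. w \<in> W \<Longrightarrow> facial W {w}"
  shows "simplicial_bound (V \<times> W) s"
  unfolding simplicial_bound_def
proof (intro allI impI)
  fix C assume C: "facial (V \<times> W) C \<and> (\<forall>D\<subseteq>C. facial (V \<times> W) D)"
  then obtain A B where AB: "facial V A" "facial W B" "C = A \<times> B" unfolding facial_Times_iff by blast
  have "\<not> (\<exists>a a' b b'. {a, a'} \<subseteq> A \<and> {b, b'} \<subseteq> B \<and> a \<noteq> a' \<and> b \<noteq> b')"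
  proof
    assume "\<exists>a a' b b'. {a, a'} \<subseteq> A \<and> {b, b'} \<subseteq> B \<and> a \<noteq> a' \<and> b \<noteq> b'"
    then obtain a a' b b' where *: "{a, a'} \<subseteq> A" "{b, b'} \<subseteq> B" "a \<noteq> a'" "b \<noteq> b'" by blast
    then have "facial (V \<times> W) {(a, b), (a', b')}" using C AB(3) by auto
    then obtain A' B' where "{(a, b), (a', b')} = A' \<times> B'" unfolding facial_Times_iff by blast
    then show False using *(3,4) by (metis SigmaD1 SigmaD2 SigmaI insertCI insertE prod.inject singletonD)
  qed
  then consider "C = {}" | b where "B = {b}" | a where "A = {a}"
    unfolding AB(3) by blast
  then show "card C \<le> s"
  proof cases
    case 2
    then have "b \<in> W" using facial_subset[OF AB(2)] by blast
    then have "\<forall>D\<subseteq>A. facial V D"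
      using C AB(3) 2 facial_Times_singleton_iff[OF assms(5)] by (metis Sigma_mono order_refl)
    then have "card A \<le> s" using assms(1) AB(1) unfolding simplicial_bound_def by blast
    then show ?thesis using AB(3) 2 by (simp add: card_cartesian_product)
  next
    case 3
    then have a: "a \<in> V" using facial_subset[OF AB(1)] by blast
    have "facial W D" if "D \<subseteq> B" for D
    proof -
      have "{a} \<times> D \<subseteq> C" using AB(3) 3 that by auto
      then have "facial (V \<times> W) ({a} \<times> D)" using C by blast
      then have "facial (W \<times> V) (D \<times> {a})" unfolding facial_Times_swap[of V W] product_swap .
      then show ?thesis using facial_Times_singleton_iff[OF assms(4)[OF a]] by blast
    qed
    then have "card B \<le> s" using assms(2) AB(2) unfolding simplicial_bound_def by blast
    then show ?thesis using AB(3) 3 by (simp add: card_cartesian_product)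
  qed (use assms(3) in simp)
qed

text \<open>The four vertices form a product set. If \<open>r\<close> left the fibre of
  \<open>p\<close> and \<open>q\<close>, the points above \<open>fst p\<close> and
  \<open>fst q\<close> at the level of \<open>r\<close> would be two further vertices off that
  fibre, but there is room for \<open>r\<close> only.\<close>

lemma square_Times_fst:
  assumes sq: "square (V \<times> W) p q r s" and ext: "\<And>w. w \<in> W \<Longrightarrow> facial W {w}"
    and snd: "snd q = snd p" "snd s = snd p"
  shows "snd r = snd p" "square V (fst p) (fst q) (fst r) (fst s)"
proof -
  have dist: "distinct [p, q, r, s]" using sq by (simp add: square_def)
  have "facial (V \<times> W) {p, q, r, s}" using sq by (simp add: square_def)
  then obtain A B where AB: "{p, q, r, s} = A \<times> B" "facial W B" unfolding facial_Times_iff by blast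
  have fd: "fst p \<noteq> fst q" using dist snd by (auto simp: prod_eq_iff)
  have mem: "p \<in> A \<times> B" "q \<in> A \<times> B" "r \<in> A \<times> B" unfolding AB(1)[symmetric] by simp_all
  show r: "snd r = snd p"
  proof (rule ccontr)
    assume ne: "snd r \<noteq> snd p"
    have "(fst p, snd r) \<in> {p, q, r, s}" "(fst q, snd r) \<in> {p, q, r, s}"
      unfolding AB(1) using mem by (auto simp: mem_Times_iff)
    then have "fst p = fst r" "fst q = fst r" using ne snd by (auto simp: prod_eq_iff)
    then show False using fd by simp
  qed
  have "snd p \<in> W" using mem(1) facial_subset[OF AB(2)] by (auto simp: mem_Times_iff)
  then have W: "facial W {snd p}" by (rule ext)
  have pr: "p = (fst p, snd p)" "q = (fst q, snd p)" "r = (fst r, snd p)" "s = (fst s, snd p)"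
    using snd r by (simp_all add: prod_eq_iff)
  have fac: "facial V (fst ` C) \<longleftrightarrow> facial (V \<times> W) C" if "C \<subseteq> {p, q, r, s}" for C
  proof -
    have "fst ` C \<times> {snd p} = C" using that snd r by (force simp: image_iff)
    then show ?thesis using facial_Times_singleton_iff[OF W] by metis
  qed
  show "square V (fst p) (fst q) (fst r) (fst s)"
    using sq fac[of "{p,q,r,s}"] fac[of "{p,q}"] fac[of "{q,r}"] fac[of "{r,s}"] fac[of "{s,p}"]
      fac[of "{p,r}"] fac[of "{q,s}"] snd r
    unfolding square_def by (auto simp: prod_eq_iff)
qed

text \<open>A product set with two elements has a factor with one element, so edges run along one
  factor.\<close>

lemma square_Times_edge:
  assumes "square (V \<times> W) p q r s"
  shows "fst q = fst p \<or> snd q = snd p"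
proof -
  have "facial (V \<times> W) {p, q}" using assms by (simp add: square_def)
  then obtain A B where AB: "{p, q} = A \<times> B" unfolding facial_Times_iff by blast
  have "(fst p, snd q) \<in> A \<times> B" using AB by (metis insertCI mem_Times_iff fst_conv snd_conv)
  then show ?thesis unfolding AB[symmetric] by (auto simp: prod_eq_iff)
qed

text \<open>At a vertex of a cube in the product, two edges in direction of \<open>W\<close> would span a square of \<open>W\<close>.
  So all but at most one of them run in direction of \<open>V\<close>, and these span a cube of \<open>V\<close>.\<close>

lemma cube_free_Times:
  fixes V :: "'a::real_vector set" and W :: "'b::real_vector set"
  assumes extV: "\<And>v. v \<in> V \<Longrightarrow> facial V {v}" and extW: "\<And>w. w \<in> W \<Longrightarrow> facial W {w}"
    and V: "cube_free V k" and W: "no_square W" and k: "k \<ge> 1"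
  shows "cube_free (V \<times> W) (Suc k)"
  unfolding cube_free_def
proof (intro allI impI notI)
  fix I :: "nat set" and c
  assume I: "finite I \<and> card I = Suc k" and c: "cubical (V \<times> W) I c"
  have sq: "square (V \<times> W) (c S) (c (insert i S)) (c (insert i (insert j S))) (c (insert j S))"
    if "S \<subseteq> I" "i \<in> I - S" "j \<in> I - S" "i \<noteq> j" for S i j
    using c that unfolding cubical_def by blast
  \<comment> \<open>The directions whose edge at the base vertex \<open>c {}\<close> runs along
    \<open>V\<close>.\<close>
  define J where "J = {i \<in> I. snd (c {i}) = snd (c {})}"
  have fst: "fst (c {i}) = fst (c {})" if i: "i \<in> I - J" for i
  proof -
    \<comment> \<open>Edges are recorded only as sides of squares, so a second direction is
      required; \<open>k \<ge> 1\<close> provides it.\<close>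
    have "\<not> I \<subseteq> {i}"
      using I k by (metis card_mono card.empty card.insert finite.emptyI finite_insert empty_iff
          Suc_le_mono le_zero_eq not_one_le_zero)
    then obtain j where "j \<in> I" "j \<noteq> i" by blast
    then show ?thesis using square_Times_edge[OF sq[of "{}" i j]] i by (auto simp: J_def)
  qed
  have "i = j" if ij: "i \<in> I - J" "j \<in> I - J" for i j
  proof (rule ccontr)
    assume "i \<noteq> j"
    then have "square (W \<times> V) (prod.swap (c {})) (prod.swap (c {i})) (prod.swap (c {i, j})) (prod.swap (c {j}))"
      using sq[of "{}" i j] ij by (simp add: square_Times_swap[of V W])
    from square_Times_fst(2)[OF this extV] fst ij W show False
      unfolding no_square_def by simp
  qed
  then have "card (I - J) \<le> 1"
    using card_le_Suc0_iff_eq[of "I - J"] I by simp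
  moreover have "card I = card J + card (I - J)"
    using I by (metis (no_types, lifting) J_def card_Diff_subset card_mono finite_subset le_add_diff_inverse mem_Collect_eq subsetI)
  ultimately have "k \<le> card J" using I by simp
  then obtain I' where I': "I' \<subseteq> J" "card I' = k" "finite I'"
    using obtain_subset_with_card_n by metis
  have JI: "J \<subseteq> I" by (auto simp: J_def)
  \<comment> \<open>By induction on \<open>U\<close>, the fourth corner of a square stays in the
    fibre that contains the other three.\<close>
  have snd: "snd (c U) = snd (c {})" if "U \<subseteq> J" for U
  proof -
    have "finite U" using finite_subset[OF that] finite_subset[OF JI] I by simp
    then show ?thesis using that
    proof (induction U rule: finite_psubset_induct)
      case (psubset U)
      show ?case
      proof (cases "\<exists>i j. i \<in> U \<and> j \<in> U \<and> i \<noteq> j")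
        case True
        then obtain i j where ij: "i \<in> U" "j \<in> U" "i \<noteq> j" by blast
        define S where "S = U - {i, j}"
        have U: "U = insert i (insert j S)" using ij by (auto simp: S_def)
        have lower: "snd (c S) = snd (c {})" "snd (c (insert i S)) = snd (c {})" "snd (c (insert j S)) = snd (c {})"
        proof -
          have "S \<subset> U" "insert i S \<subset> U" "insert j S \<subset> U" using ij by (auto simp: S_def)
          then show "snd (c S) = snd (c {})" "snd (c (insert i S)) = snd (c {})" "snd (c (insert j S)) = snd (c {})"
            using psubset.IH psubset.prems by (meson order_trans psubset_imp_subset)+
        qed
        have "square (V \<times> W) (c S) (c (insert i S)) (c U) (c (insert j S))"
        proof -
          have "S \<subseteq> I" "i \<in> I - S" "j \<in> I - S" using ij psubset.prems JI by (auto simp: S_def)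
          from sq[OF this ij(3)] show ?thesis unfolding U .
        qed
        from square_Times_fst(1)[OF this extW] lower show ?thesis by simp
      next
        case False
        then consider "U = {}" | i where "U = {i}" by blast
        then show ?thesis using psubset.prems by cases (auto simp: J_def)
      qed
    qed
  qed
  have "cubical V I' (fst \<circ> c)"
    unfolding cubical_def comp_def
  proof (intro allI impI)
    fix S i j assume "S \<subseteq> I'" "i \<in> I' - S" "j \<in> I' - S" "i \<noteq> j"
    moreover from this have "S \<subseteq> J" "insert i S \<subseteq> J" "insert j S \<subseteq> J" using I'(1) by auto
    then have "snd (c S) = snd (c {})" "snd (c (insert i S)) = snd (c {})" "snd (c (insert j S)) = snd (c {})"
      using snd[of S] snd[of "insert i S"] snd[of "insert j S"] by blast+
    ultimately show "square V (fst (c S)) (fst (c (insert i S))) (fst (c (insert i (insert j S)))) (fst (c (insert j S)))"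
      using I'(1) JI square_Times_fst(2)[OF sq extW, of S i j] by auto
  qed
  then show False using V I' unfolding cube_free_def by blast
qed

text \<open>The two parts lie in complementary subspaces at heights 0 and 1. The height of a
  weighted sum is the total weight on \<open>W\<close>, so relations between conic combinations
  split into one relation for each part.\<close>

definition join_points :: "'a::real_vector set \<Rightarrow> 'b::real_vector set \<Rightarrow> ('a \<times> 'b \<times> real) set" where
  "join_points V W = (\<lambda>v. (v, 0, 0)) ` V \<union> (\<lambda>w. (0, w, 1)) ` W"

lemma join_points_mono: "A \<subseteq> V \<Longrightarrow> B \<subseteq> W \<Longrightarrow> join_points A B \<subseteq> join_points V W"
  by (auto simp: join_points_def)

lemma subset_join_pointsE:
  assumes "C \<subseteq> join_points V W"
  obtains A B where "A \<subseteq> V" "B \<subseteq> W" "C = join_points A B"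
proof
  show "{v \<in> V. (v, 0, 0) \<in> C} \<subseteq> V" "{w \<in> W. (0, w, 1) \<in> C} \<subseteq> W" by auto
  show "C = join_points {v \<in> V. (v, 0, 0) \<in> C} {w \<in> W. (0, w, 1) \<in> C}"
    using assms by (auto simp: join_points_def)
qed

lemma finite_join_points: "finite V \<Longrightarrow> finite W \<Longrightarrow> finite (join_points V W)"
  by (simp add: join_points_def)

lemma sum_join_points:
  assumes "finite V" "finite W"
  shows "sum g (join_points V W) = (\<Sum>v\<in>V. g (v, 0, 0)) + (\<Sum>w\<in>W. g (0, w, 1))"
proof -
  have "sum g (join_points V W) = sum g ((\<lambda>v. (v, 0, 0)) ` V) + sum g ((\<lambda>w. (0, w, 1)) ` W)"
    unfolding join_points_def using assms by (intro sum.union_disjoint) auto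
  then show ?thesis by (simp add: sum.reindex inj_on_def)
qed

lemma sum_Pair: "(\<Sum>x\<in>A. (f x, g x)) = (sum f A, sum g A)"
  by (induction A rule: infinite_finite_induct) (auto simp: zero_prod_def)

text \<open>The conic criterion of the join is the conjunction of the two criteria: the height
  coordinate equates the weights on \<open>W\<close>, and with the total weight also those on
  \<open>V\<close>.\<close>

lemma facial_join_points_iff:
  fixes V :: "'a::real_vector set" and W :: "'b::real_vector set"
  assumes fin: "finite V" "finite W" and sub: "A \<subseteq> V" "B \<subseteq> W"
  shows "facial (join_points V W) (join_points A B) \<longleftrightarrow> facial V A \<and> facial W B"
proof
  have finAB: "finite A" "finite B" using fin sub finite_subset by blast+
  assume "facial (join_points V W) (join_points A B)"
  then have *: "\<And>u w. (\<forall>x\<in>join_points V W. 0 \<le> u x) \<Longrightarrow> (\<forall>x\<in>join_points A B. 0 \<le> w x) \<Longrightarrow>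
      sum u (join_points V W) = sum w (join_points A B) \<Longrightarrow>
      (\<Sum>x\<in>join_points V W. u x *\<^sub>R x) = (\<Sum>x\<in>join_points A B. w x *\<^sub>R x) \<Longrightarrow>
      (\<forall>x\<in>join_points V W - join_points A B. u x = (0::real))"
    unfolding facial_iff[OF finite_join_points[OF fin]] by blast
  have "facial V A"
    unfolding facial_iff[OF fin(1)]
  proof (intro conjI allI impI ballI)
    fix u w :: "'a \<Rightarrow> real" and x
    assume u: "\<forall>x\<in>V. 0 \<le> u x" "\<forall>x\<in>A. 0 \<le> w x" "sum u V = sum w A" "(\<Sum>x\<in>V. u x *\<^sub>R x) = (\<Sum>x\<in>A. w x *\<^sub>R x)"
      and x: "x \<in> V - A"
    \<comment> \<open>Weights on one part are extended by 0 to the other; the height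
      \<open>t\<close> tells the parts apart.\<close>
    let ?e = "\<lambda>(f :: 'a \<Rightarrow> real) (x, y :: 'b, t :: real). if t = 0 then f x else 0"
    have "\<forall>x\<in>join_points V W - join_points A B. ?e u x = 0"
      by (rule *[of "?e u" "?e w"])
        (use u in \<open>auto simp: sum_join_points fin finAB sum_Pair\<close>, (auto simp: join_points_def))
    then have "?e u (x, 0, 0) = 0" by (rule bspec) (use x in \<open>auto simp: join_points_def\<close>)
    then show "u x = 0" by simp
  qed (rule sub)
  moreover have "facial W B"
    unfolding facial_iff[OF fin(2)]
  proof (intro conjI allI impI ballI)
    fix u w :: "'b \<Rightarrow> real" and x
    assume u: "\<forall>x\<in>W. 0 \<le> u x" "\<forall>x\<in>B. 0 \<le> w x" "sum u W = sum w B" "(\<Sum>x\<in>W. u x *\<^sub>R x) = (\<Sum>x\<in>B. w x *\<^sub>R x)"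
      and x: "x \<in> W - B"
    let ?e = "\<lambda>(f :: 'b \<Rightarrow> real) (x :: 'a, y, t :: real). if t = 1 then f y else 0"
    have "\<forall>x\<in>join_points V W - join_points A B. ?e u x = 0"
      by (rule *[of "?e u" "?e w"])
        (use u in \<open>auto simp: sum_join_points fin finAB sum_Pair\<close>, (auto simp: join_points_def))
    then have "?e u (0, x, 1) = 0" by (rule bspec) (use x in \<open>auto simp: join_points_def\<close>)
    then show "u x = 0" by simp
  qed (rule sub)
  ultimately show "facial V A \<and> facial W B" ..
next
  have finAB: "finite A" "finite B" using fin sub finite_subset by blast+
  assume fac: "facial V A \<and> facial W B"
  show "facial (join_points V W) (join_points A B)"
    unfolding facial_iff[OF finite_join_points[OF fin]]
  proof (intro conjI allI impI ballI)
    fix u w :: "'a \<times> 'b \<times> real \<Rightarrow> real" and x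
    assume u: "\<forall>x\<in>join_points V W. 0 \<le> u x" and w: "\<forall>x\<in>join_points A B. 0 \<le> w x"
      and s: "sum u (join_points V W) = sum w (join_points A B)"
      and eq: "(\<Sum>x\<in>join_points V W. u x *\<^sub>R x) = (\<Sum>x\<in>join_points A B. w x *\<^sub>R x)"
      and x: "x \<in> join_points V W - join_points A B"
    define u1 u2 w1 w2 where "u1 v = u (v, 0, 0)" and "u2 y = u (0, y, 1)"
      and "w1 v = w (v, 0, 0)" and "w2 y = w (0, y, 1)" for v y
    note defs = u1_def u2_def w1_def w2_def
    have e: "(\<Sum>v\<in>V. u1 v *\<^sub>R v) = (\<Sum>v\<in>A. w1 v *\<^sub>R v)" "(\<Sum>y\<in>W. u2 y *\<^sub>R y) = (\<Sum>y\<in>B. w2 y *\<^sub>R y)"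
      "sum u2 W = sum w2 B"
      using eq by (simp_all add: defs sum_join_points fin finAB sum_Pair)
    have s1: "sum u1 V = sum w1 A"
      using s e(3) by (simp add: defs sum_join_points fin finAB)
    have nn: "\<forall>v\<in>V. 0 \<le> u1 v" "\<forall>v\<in>A. 0 \<le> w1 v" "\<forall>y\<in>W. 0 \<le> u2 y" "\<forall>y\<in>B. 0 \<le> w2 y"
      using u w by (auto simp: defs join_points_def)
    have "\<forall>v\<in>V - A. u1 v = 0"
      using fac nn s1 e(1) unfolding facial_iff[OF fin(1)] by blast
    moreover have "\<forall>y\<in>W - B. u2 y = 0"
      using fac nn e(2,3) unfolding facial_iff[OF fin(2)] by blast
    ultimately show "u x = 0" using x by (auto simp: join_points_def defs)
  qed (rule join_points_mono[OF sub])
qed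

lemma facial_join_points_singleton:
  assumes "finite V" "finite W" "\<And>v. v \<in> V \<Longrightarrow> facial V {v}" "\<And>w. w \<in> W \<Longrightarrow> facial W {w}"
    and x: "x \<in> join_points V W"
  shows "facial (join_points V W) {x}"
proof -
  consider v where "v \<in> V" "{x} = join_points {v} {}" | w where "w \<in> W" "{x} = join_points {} {w}"
    using x by (auto simp: join_points_def)
  then show ?thesis
    using assms(3,4) facial_join_points_iff[OF assms(1,2), of "{_}" "{}"]
      facial_join_points_iff[OF assms(1,2), of "{}" "{_}"] by cases simp_all
qed

lemma card_join_points:
  assumes "finite A" "finite B"
  shows "card (join_points A B) = card A + card B"
  using sum_join_points[OF assms, of "\<lambda>_. 1 :: nat"] by simp

lemma simplicial_bound_join_points:
  assumes fin: "finite V" "finite W" and "simplicial_bound V s" "simplicial_bound W t"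
  shows "simplicial_bound (join_points V W) (s + t)"
  unfolding simplicial_bound_def
proof (intro allI impI)
  fix C assume C: "facial (join_points V W) C \<and> (\<forall>D\<subseteq>C. facial (join_points V W) D)"
  then obtain A B where AB: "A \<subseteq> V" "B \<subseteq> W" "C = join_points A B"
    using facial_subset subset_join_pointsE by metis
  have "facial V D" if "D \<subseteq> A" for D
    using C AB join_points_mono[OF that empty_subsetI] facial_join_points_iff[OF fin, of D "{}"] that
    by (metis empty_subsetI join_points_mono order_trans)
  moreover have "facial W D" if "D \<subseteq> B" for D
    using C AB join_points_mono[OF empty_subsetI that] facial_join_points_iff[OF fin, of "{}" D] that
    by (metis empty_subsetI join_points_mono order_trans)
  ultimately have "card A \<le> s" "card B \<le> t"
    using assms(3,4) unfolding simplicial_bound_def by blast+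
  moreover have "finite A" "finite B" using AB fin finite_subset by blast+
  ultimately show "card C \<le> s + t" using AB(3) by (simp add: card_join_points)
qed

text \<open>A diagonal of a square is not an edge, whereas points from the two parts of a join always span one.
  So both diagonals, and then the whole square, lie in one part.\<close>

lemma no_square_join_points:
  assumes fin: "finite V" "finite W"
    and ext: "\<And>v. v \<in> V \<Longrightarrow> facial V {v}" "\<And>w. w \<in> W \<Longrightarrow> facial W {w}"
    and "no_square V" "no_square W"
  shows "no_square (join_points V W)"
  unfolding no_square_def
proof (intro allI notI)
  fix p q r s assume sq: "square (join_points V W) p q r s"
  let ?l = "\<lambda>v. (v, 0, 0) :: 'a \<times> 'b \<times> real" and ?r = "\<lambda>w. (0, w, 1) :: 'a \<times> 'b \<times> real"
  have l: "facial (join_points V W) (?l ` A) \<longleftrightarrow> facial V A" if "A \<subseteq> V" for A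
    using facial_join_points_iff[OF fin that empty_subsetI] by (simp add: join_points_def)
  have r: "facial (join_points V W) (?r ` B) \<longleftrightarrow> facial W B" if "B \<subseteq> W" for B
    using facial_join_points_iff[OF fin empty_subsetI that] by (simp add: join_points_def)
  have sub: "{p, q, r, s} \<subseteq> join_points V W"
    using sq unfolding square_def by (blast dest: facial_subset)
  have same: "(x \<in> ?l ` V \<and> y \<in> ?l ` V) \<or> (x \<in> ?r ` W \<and> y \<in> ?r ` W)"
    if "x \<in> join_points V W" "y \<in> join_points V W" "\<not> facial (join_points V W) {x, y}" for x y
  proof -
    have "facial (join_points V W) {?l v, ?r w}" if "v \<in> V" "w \<in> W" for v w
      using facial_join_points_iff[OF fin, of "{v}" "{w}"] that ext by (simp add: join_points_def insert_commute)
    then show ?thesis using that by (auto simp: join_points_def insert_commute)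
  qed
  \<comment> \<open>With the diagonals in different parts, the part of the square in
    \<open>V\<close> would be a diagonal and facial by the splitting of faces of a join.\<close>
  have mixed: False if xyzu: "{x, y} \<union> {z, u} = {p, q, r, s}" "x \<in> ?l ` V" "y \<in> ?l ` V" "z \<in> ?r ` W" "u \<in> ?r ` W"
    "\<not> facial (join_points V W) {x, y}" for x y z u
  proof -
    obtain a b c d where *: "x = ?l a" "y = ?l b" "z = ?r c" "u = ?r d" "a \<in> V" "b \<in> V" "c \<in> W" "d \<in> W"
      using xyzu(2-5) unfolding image_iff by blast
    have "facial (join_points V W) ({x, y} \<union> {z, u})" using sq xyzu(1) by (simp add: square_def)
    moreover have "{x, y} \<union> {z, u} = join_points {a, b} {c, d}" using * by (simp add: join_points_def)
    ultimately have "facial V {a, b}" using facial_join_points_iff[OF fin] * by simp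
    then show False using l[of "{a, b}"] * xyzu(6) by simp
  qed
  have "(p \<in> ?l ` V \<and> r \<in> ?l ` V) \<or> (p \<in> ?r ` W \<and> r \<in> ?r ` W)"
    "(q \<in> ?l ` V \<and> s \<in> ?l ` V) \<or> (q \<in> ?r ` W \<and> s \<in> ?r ` W)"
    using same sub sq unfolding square_def by blast+
  then consider "{p, q, r, s} \<subseteq> ?l ` V" | "{p, q, r, s} \<subseteq> ?r ` W"
    | "p \<in> ?l ` V" "r \<in> ?l ` V" "q \<in> ?r ` W" "s \<in> ?r ` W"
    | "q \<in> ?l ` V" "s \<in> ?l ` V" "p \<in> ?r ` W" "r \<in> ?r ` W"
    by blast
  then show False
  proof cases
    case 1
    then obtain a b c d where *: "p = ?l a" "q = ?l b" "r = ?l c" "s = ?l d" "a \<in> V" "b \<in> V" "c \<in> V" "d \<in> V"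
      unfolding insert_subset image_iff by blast
    have "square V a b c d"
      using sq * l[of "{a,b,c,d}"] l[of "{a,b}"] l[of "{b,c}"] l[of "{c,d}"] l[of "{d,a}"] l[of "{a,c}"] l[of "{b,d}"]
      unfolding square_def by simp
    then show ?thesis using assms by (simp add: no_square_def)
  next
    case 2
    then obtain a b c d where *: "p = ?r a" "q = ?r b" "r = ?r c" "s = ?r d" "a \<in> W" "b \<in> W" "c \<in> W" "d \<in> W"
      unfolding insert_subset image_iff by blast
    have "square W a b c d"
      using sq * r[of "{a,b,c,d}"] r[of "{a,b}"] r[of "{b,c}"] r[of "{c,d}"] r[of "{d,a}"] r[of "{a,c}"] r[of "{b,d}"]
      unfolding square_def by simp
    then show ?thesis using assms by (simp add: no_square_def)
  next
    case 3
    then show ?thesis using mixed[of p r q s] sq unfolding square_def by (auto simp: insert_commute)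
  next
    case 4
    then show ?thesis using mixed[of q s p r] sq unfolding square_def by (auto simp: insert_commute)
  qed
qed

section \<open>Dimension and simple vertices\<close>

lemma affineI:
  assumes "\<And>x y u v. x \<in> S \<Longrightarrow> y \<in> S \<Longrightarrow> u + v = 1 \<Longrightarrow> u *\<^sub>R x + v *\<^sub>R y \<in> S"
  shows "affine S"
  using assms by (simp add: affine_def)

lemma affine_hull_linear_image':
  assumes "linear f"
  shows "affine hull (f ` S) = f ` (affine hull S)"
proof
  have aff: "affine (f ` T)" if "affine T" for T
  proof (rule affineI)
    fix x y and u v :: real assume "x \<in> f ` T" "y \<in> f ` T" and uv: "u + v = 1"
    then obtain a b where ab: "x = f a" "y = f b" "a \<in> T" "b \<in> T" by blast
    have "u *\<^sub>R a + v *\<^sub>R b \<in> T" using mem_affine[OF that ab(3,4) uv] .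
    moreover have "u *\<^sub>R x + v *\<^sub>R y = f (u *\<^sub>R a + v *\<^sub>R b)"
      by (simp add: ab linear_add[OF assms] linear_scale[OF assms])
    ultimately show "u *\<^sub>R x + v *\<^sub>R y \<in> f ` T" by simp
  qed
  show "affine hull (f ` S) \<subseteq> f ` (affine hull S)"
    by (intro hull_minimal aff) (auto intro: hull_inc)
  have "S \<subseteq> f -` (affine hull (f ` S))" by (auto intro: hull_inc)
  moreover have "affine (f -` (affine hull (f ` S)))"
  proof (rule affineI)
    fix x y and u v :: real
    assume "x \<in> f -` (affine hull (f ` S))" "y \<in> f -` (affine hull (f ` S))" "u + v = 1"
    then show "u *\<^sub>R x + v *\<^sub>R y \<in> f -` (affine hull (f ` S))"
      using mem_affine[OF affine_affine_hull, of "f x" "f ` S" "f y" u v]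
      by (simp add: linear_add[OF assms] linear_scale[OF assms])
  qed
  ultimately show "f ` (affine hull S) \<subseteq> affine hull (f ` S)"
    using hull_minimal[of S "f -` (affine hull (f ` S))" affine] by blast
qed

lemma affine_hull_Times:
  fixes S :: "'a::real_vector set" and T :: "'b::real_vector set"
  shows "affine hull (S \<times> T) = (affine hull S) \<times> (affine hull T)"
proof
  have "affine ((affine hull S) \<times> (affine hull T))"
    by (rule affineI) (auto intro: mem_affine[OF affine_affine_hull])
  then show "affine hull (S \<times> T) \<subseteq> (affine hull S) \<times> (affine hull T)"
    by (intro hull_minimal Sigma_mono hull_subset)
  let ?H = "affine hull (S \<times> T)"
  have aff1: "affine {x. (x, y) \<in> ?H}" for y
  proof (intro affineI CollectI)
    fix x x' and u v :: real assume "x \<in> {x. (x, y) \<in> ?H}" "x' \<in> {x. (x, y) \<in> ?H}" "u + v = 1"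
    then show "(u *\<^sub>R x + v *\<^sub>R x', y) \<in> ?H"
      using mem_affine[OF affine_affine_hull, of "(x, y)" "S \<times> T" "(x', y)" u v]
      by (simp flip: scaleR_left_distrib)
  qed
  have aff2: "affine {y. (x, y) \<in> ?H}" for x
  proof (intro affineI CollectI)
    fix y y' and u v :: real assume "y \<in> {y. (x, y) \<in> ?H}" "y' \<in> {y. (x, y) \<in> ?H}" "u + v = 1"
    then show "(x, u *\<^sub>R y + v *\<^sub>R y') \<in> ?H"
      using mem_affine[OF affine_affine_hull, of "(x, y)" "S \<times> T" "(x, y')" u v]
      by (simp flip: scaleR_left_distrib)
  qed
  have "x \<in> {x. (x, y) \<in> ?H}" if "x \<in> affine hull S" "y \<in> T" for x y
    by (rule subsetD[OF hull_minimal[where S = affine, OF _ aff1] that(1)]) (use that(2) in \<open>auto intro: hull_inc\<close>)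
  then have "y \<in> {y. (x, y) \<in> ?H}" if "x \<in> affine hull S" "y \<in> affine hull T" for x y
    by (intro subsetD[OF hull_minimal[where S = affine, OF _ aff2] that(2)]) (use that(1) in auto)
  then show "(affine hull S) \<times> (affine hull T) \<subseteq> ?H" by auto
qed

text \<open>Differences with one base point turn \<open>d + 1\<close> affinely independent points
  into a basis of the direction space with \<open>d\<close> elements.\<close>

lemma has_dimI:
  assumes "independent D" "finite D" "card D = d" "affine hull S = (+) a ` span D"
  shows "has_dim S d"
  unfolding has_dim_def
proof (intro exI conjI)
  let ?B = "(+) a ` D"
  have D: "(\<lambda>x. - a + x) ` ?B = D" by (simp add: image_image)
  have "0 \<notin> D" using assms(1) dependent_zero by blast
  then have notin: "a \<notin> ?B" by auto
  show "affine hull (insert a ?B) = affine hull S"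
    unfolding affine_hull_insert_span_gen D assms(4) ..
  show "\<not> affine_dependent (insert a ?B)"
    using affine_dependent_iff_dependent[OF notin] assms(1) unfolding D by simp
  show "card (insert a ?B) = d + 1"
    using notin assms(2,3) by (simp add: card_image)
qed

lemma has_dimE:
  assumes "has_dim S d"
  obtains a D where "independent D" "finite D" "card D = d" "affine hull S = (+) a ` span D"
proof -
  obtain B where B: "affine hull B = affine hull S" "\<not> affine_dependent B" "card B = d + 1"
    using assms unfolding has_dim_def by blast
  have "finite B" using B(3) by (intro card_ge_0_finite) simp
  obtain a where a: "a \<in> B" using B(3) by fastforce
  let ?D = "(\<lambda>x. - a + x) ` (B - {a})"
  show thesis
  proof (rule that[of ?D a])
    show "independent ?D" using affine_dependent_iff_dependent2[OF a] B(2) by simp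
    show "finite ?D" using \<open>finite B\<close> by simp
    show "card ?D = d" using a B(3) \<open>finite B\<close> by (subst card_image) (auto simp: inj_on_def)
    show "affine hull S = (+) a ` span ?D" using affine_hull_span2[OF a] B(1) by simp
  qed
qed

text \<open>\<open>has_dim\<close> is an existential relation; uniqueness is what lets the
  codimension of a facet be read off from a vertex. The two direction spaces agree, hence so do the
  sizes of their bases.\<close>

lemma has_dim_unique:
  assumes "has_dim S m" "has_dim S n"
  shows "m = n"
proof -
  obtain a D where D: "independent D" "card D = m" "affine hull S = (+) a ` span D"
    using has_dimE[OF assms(1)] by metis
  obtain b E where E: "independent E" "card E = n" "affine hull S = (+) b ` span E"
    using has_dimE[OF assms(2)] by metis
  have eq: "(+) a ` span D = (+) b ` span E" using D(3) E(3) by simp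
  have "b \<in> (+) b ` span E" "a \<in> (+) a ` span D" by (auto simp: image_iff span_zero)
  then obtain c where c: "b = a + c" "c \<in> span D" unfolding eq[symmetric] by auto
  have "span D = span E"
  proof
    show "span D \<subseteq> span E"
    proof
      fix x assume "x \<in> span D"
      then have "a + (c + x) \<in> (+) a ` span D" using c(2) by (intro imageI span_add)
      then show "x \<in> span E" unfolding eq c by (auto simp: add.assoc)
    qed
    show "span E \<subseteq> span D"
    proof
      fix x assume "x \<in> span E"
      then have "b + x \<in> (+) a ` span D" unfolding eq by blast
      then have "c + x \<in> span D" unfolding c by (auto simp: add.assoc)
      then show "x \<in> span D" using c(2) span_diff by fastforce
    qed
  qed
  then have "dim D = dim E" by (metis dim_span)
  then show ?thesis using D E dim_eq_card_independent by metis
qed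

lemma has_dim_linear_image:
  assumes "linear f" "inj f" "has_dim S d"
  shows "has_dim (f ` S) d"
proof -
  obtain a D where D: "independent D" "finite D" "card D = d" "affine hull S = (+) a ` span D"
    using has_dimE[OF assms(3)] .
  show ?thesis
  proof (rule has_dimI)
    show "independent (f ` D)"
      using linear_independent_injective_image[OF assms(1) D(1)] assms(2) by (simp add: inj_on_subset)
    show "finite (f ` D)" "card (f ` D) = d"
      using D assms(2) by (auto simp: card_image inj_on_subset)
    show "affine hull (f ` S) = (+) (f a) ` span (f ` D)"
      unfolding affine_hull_linear_image'[OF assms(1)] D(4) linear_span_image[OF assms(1)]
      by (simp add: image_image linear_add[OF assms(1)])
  qed
qed

lemma has_dim_Times:
  fixes S :: "'a::real_vector set" and T :: "'b::real_vector set"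
  assumes "has_dim S m" "has_dim T n"
  shows "has_dim (S \<times> T) (m + n)"
proof -
  obtain a D where D: "independent D" "finite D" "card D = m" "affine hull S = (+) a ` span D"
    using has_dimE[OF assms(1)] .
  obtain b E where E: "independent E" "finite E" "card E = n" "affine hull T = (+) b ` span E"
    using has_dimE[OF assms(2)] .
  let ?l = "\<lambda>x. (x, 0) :: 'a \<times> 'b" and ?r = "\<lambda>y. (0, y) :: 'a \<times> 'b"
  have lin: "linear ?l" "linear ?r" by (auto intro!: linearI)
  let ?F = "?l ` D \<union> ?r ` E"
  have "0 \<notin> D" "0 \<notin> E" using D(1) E(1) dependent_zero by blast+
  then have disj: "?l ` D \<inter> ?r ` E = {}" by auto
  have inj: "inj_on ?l X" "inj_on ?r Y" for X Y by (auto simp: inj_on_def)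
  show ?thesis
  proof (rule has_dimI)
    show "finite ?F" using D E by simp
    show "card ?F = m + n"
      using D E disj inj by (simp add: card_Un_disjoint card_image)
    show "independent ?F"
    proof (rule independent_if_scalars_zero)
      fix f x assume s: "(\<Sum>x\<in>?F. f x *\<^sub>R x) = 0" and x: "x \<in> ?F"
      have "(\<Sum>x\<in>?F. f x *\<^sub>R x) = (\<Sum>x\<in>D. f (?l x) *\<^sub>R ?l x) + (\<Sum>y\<in>E. f (?r y) *\<^sub>R ?r y)"
        using D(2) E(2) disj inj by (simp add: sum.union_disjoint sum.reindex)
      also have "\<dots> = ((\<Sum>x\<in>D. f (?l x) *\<^sub>R x), (\<Sum>y\<in>E. f (?r y) *\<^sub>R y))"
        by (simp add: sum_Pair)
      finally have "(\<Sum>x\<in>D. f (?l x) *\<^sub>R x) = 0" "(\<Sum>y\<in>E. f (?r y) *\<^sub>R y) = 0"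
        using s by (simp_all add: zero_prod_def)
      then have "\<forall>x\<in>D. f (?l x) = 0" "\<forall>y\<in>E. f (?r y) = 0"
        using D(1,2) E(1,2) by (auto simp: independent_explicit_finite_subsets dependent_finite)
      with x show "f x = 0" by auto
    qed (use D E in simp)
    have "span ?F = span D \<times> span E"
    proof
      have "subspace (span D \<times> span E)"
        unfolding subspace_def by (auto simp: zero_prod_def span_zero intro: span_add span_scale)
      then show "span ?F \<subseteq> span D \<times> span E"
        by (intro span_minimal) (auto intro: span_base span_zero)
      have "?l x + ?r y \<in> span ?F" if "x \<in> span D" "y \<in> span E" for x y
      proof (rule span_add)
        have "?l x \<in> span (?l ` D)" "?r y \<in> span (?r ` E)"
          using that linear_span_image[OF lin(1)] linear_span_image[OF lin(2)] by blast+
        then show "?l x \<in> span ?F" "?r y \<in> span ?F"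
          using span_mono[of "?l ` D" ?F] span_mono[of "?r ` E" ?F] by blast+
      qed
      then show "span D \<times> span E \<subseteq> span ?F" by auto
    qed
    then show "affine hull (S \<times> T) = (+) (a, b) ` span ?F"
      unfolding affine_hull_Times D(4) E(4) by (force simp: image_iff)
  qed
qed

text \<open>An inclusion with symmetric hypotheses, so that it yields equality when applied
  twice.\<close>

lemma affine_hull_join_points_mono:
  fixes B S :: "'a::real_vector set" and C T :: "'b::real_vector set"
  assumes "affine hull B = affine hull S" "affine hull C = affine hull T"
  shows "affine hull (join_points B C) \<subseteq> affine hull (join_points S T)"
proof (rule hull_minimal)
  let ?l = "\<lambda>v. (v, 0, 0) :: 'a \<times> 'b \<times> real" and ?r = "\<lambda>w. (0, w, 0) :: 'a \<times> 'b \<times> real"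
  have lin: "linear ?l" "linear ?r" by (auto intro!: linearI)
  have "?l v \<in> affine hull (join_points S T)" if "v \<in> B" for v
  proof -
    have "v \<in> affine hull S" using that assms(1) hull_inc by metis
    then have "?l v \<in> affine hull (?l ` S)" unfolding affine_hull_linear_image'[OF lin(1)] by blast
    then show ?thesis using hull_mono[of "?l ` S" "join_points S T" affine] by (auto simp: join_points_def)
  qed
  moreover have "(0, w, 1) \<in> affine hull (join_points S T)" if "w \<in> C" for w
  proof -
    have "w \<in> affine hull T" using that assms(2) hull_inc by metis
    then have "?r w \<in> affine hull (?r ` T)" unfolding affine_hull_linear_image'[OF lin(2)] by blast
    then have "(0, 0, 1) + ?r w \<in> affine hull ((+) (0, 0, 1) ` ?r ` T)"
      unfolding affine_hull_translation by blast
    moreover have "(+) (0, 0, 1) ` ?r ` T \<subseteq> join_points S T" by (auto simp: join_points_def)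
    ultimately show ?thesis using hull_mono[of "(+) (0, 0, 1) ` ?r ` T" "join_points S T" affine] by auto
  qed
  ultimately show "join_points B C \<subseteq> affine hull (join_points S T)"
    unfolding join_points_def by blast
qed (rule affine_affine_hull)

text \<open>The join of affine bases is an affine basis of the join; the sizes \<open>m + 1\<close>
  and \<open>n + 1\<close> add up, which is one more than for a product.\<close>

lemma has_dim_join_points:
  assumes "has_dim S m" "has_dim T n"
  shows "has_dim (join_points S T) (m + n + 1)"
proof -
  obtain B where B: "affine hull B = affine hull S" "\<not> affine_dependent B" "card B = m + 1"
    using assms(1) unfolding has_dim_def by blast
  obtain C where C: "affine hull C = affine hull T" "\<not> affine_dependent C" "card C = n + 1"
    using assms(2) unfolding has_dim_def by blast
  have fin: "finite B" "finite C" using B(3) C(3) by (auto intro: card_ge_0_finite)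
  have "\<not> affine_dependent (join_points B C)"
    unfolding affine_dependent_explicit_finite[OF finite_join_points[OF fin]]
  proof
    assume "\<exists>U. sum U (join_points B C) = 0 \<and> (\<exists>v\<in>join_points B C. U v \<noteq> 0) \<and>
        (\<Sum>v\<in>join_points B C. U v *\<^sub>R v) = 0"
    then obtain U where U: "sum U (join_points B C) = 0" "\<exists>v\<in>join_points B C. U v \<noteq> 0"
        "(\<Sum>v\<in>join_points B C. U v *\<^sub>R v) = 0" by blast
    have e: "(\<Sum>v\<in>B. U (v, 0, 0) *\<^sub>R v) = 0" "(\<Sum>w\<in>C. U (0, w, 1) *\<^sub>R w) = 0" "(\<Sum>w\<in>C. U (0, w, 1)) = 0"
      using U(3) by (simp_all add: sum_join_points fin sum_Pair zero_prod_def)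
    moreover have "(\<Sum>v\<in>B. U (v, 0, 0)) = 0" using U(1) e(3) by (simp add: sum_join_points fin)
    ultimately have "\<forall>v\<in>B. U (v, 0, 0) = 0" "\<forall>w\<in>C. U (0, w, 1) = 0"
      using B(2)[unfolded affine_dependent_explicit_finite[OF fin(1)] not_ex, rule_format, of "\<lambda>v. U (v, 0, 0)"]
        C(2)[unfolded affine_dependent_explicit_finite[OF fin(2)] not_ex, rule_format, of "\<lambda>w. U (0, w, 1)"]
      by auto
    with U(2) show False by (auto simp: join_points_def)
  qed
  moreover have "affine hull (join_points B C) = affine hull (join_points S T)"
    using affine_hull_join_points_mono[OF B(1) C(1)]
      affine_hull_join_points_mono[OF B(1)[symmetric] C(1)[symmetric]] by blast
  moreover have "card (join_points B C) = (m + n + 1) + 1"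
    using B(3) C(3) by (simp add: card_join_points fin)
  ultimately show ?thesis unfolding has_dim_def by blast
qed

section \<open>Simple vertices, faces through them, and facet counts\<close>

text \<open>The cone of the polytope at the vertex \<open>v\<close> is simplicial: it is spanned by the directions
  towards the neighbours \<open>N\<close>, and \<open>h\<close> is the dual basis.\<close>

definition vertex_frame :: "'a::real_vector set \<Rightarrow> 'a \<Rightarrow> 'a set \<Rightarrow> ('a \<Rightarrow> 'a \<Rightarrow> real) \<Rightarrow> bool" where
  "vertex_frame V v N h \<longleftrightarrow> finite N \<and> N \<subseteq> V - {v} \<and> (\<forall>w\<in>N. linear (h w)) \<and>
     (\<forall>w\<in>N. \<forall>w'\<in>N. h w (w' - v) = (if w' = w then 1 else 0)) \<and>
     (\<forall>x\<in>V. (\<forall>w\<in>N. 0 \<le> h w (x - v)) \<and> x - v = (\<Sum>w\<in>N. h w (x - v) *\<^sub>R (w - v)))"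

definition simple_vertices :: "nat \<Rightarrow> 'a::real_vector set \<Rightarrow> bool" where
  "simple_vertices d V \<longleftrightarrow> (\<forall>v\<in>V. \<exists>N h. vertex_frame V v N h \<and> card N = d)"

lemma vertex_frameD:
  assumes "vertex_frame V v N h"
  shows "finite N" "N \<subseteq> V" "v \<notin> N" "\<And>w. w \<in> N \<Longrightarrow> linear (h w)"
    "\<And>w w'. w \<in> N \<Longrightarrow> w' \<in> N \<Longrightarrow> h w (w' - v) = (if w' = w then 1 else 0)"
    "\<And>x w. x \<in> V \<Longrightarrow> w \<in> N \<Longrightarrow> 0 \<le> h w (x - v)"
    "\<And>x. x \<in> V \<Longrightarrow> x - v = (\<Sum>w\<in>N. h w (x - v) *\<^sub>R (w - v))"
  using assms unfolding vertex_frame_def by auto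

lemma vertex_frame_Times:
  fixes V :: "'a::real_vector set" and W :: "'b::real_vector set"
  assumes f: "vertex_frame V v N h" and g: "vertex_frame W w M k" and vw: "v \<in> V" "w \<in> W"
  shows "\<exists>K l. vertex_frame (V \<times> W) (v, w) K l \<and> card K = card N + card M"
proof -
  note F = vertex_frameD[OF f] and G = vertex_frameD[OF g]
  have disj: "(\<lambda>n. (n, w)) ` N \<inter> (\<lambda>m. (v, m)) ` M = {}" using F(3) by auto
  have card: "card ((\<lambda>n. (n, w)) ` N \<union> (\<lambda>m. (v, m)) ` M) = card N + card M"
    using F(1) G(1) disj by (simp add: card_Un_disjoint card_image inj_on_def)
  have M: "m \<noteq> w" if "m \<in> M" for m using G(3) that by blast
  have linl: "linear (\<lambda>(a, b :: 'b). h n a)" if "n \<in> N" for n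
    using F(4)[OF that] by (auto intro!: linearI simp: linear_add linear_scale)
  have linr: "linear (\<lambda>(a :: 'a, b). k m b)" if "m \<in> M" for m
    using G(4)[OF that] by (auto intro!: linearI simp: linear_add linear_scale)
  let ?N = "(\<lambda>n. (n, w)) ` N \<union> (\<lambda>m. (v, m)) ` M"
  \<comment> \<open>A neighbour varies in the first factor exactly if its second coordinate is still
    \<open>w\<close>, because \<open>w\<close> is not in \<open>M\<close>.\<close>
  let ?h = "\<lambda>(x, y) (a, b). if y = w then h x a else k y b"
  have sum: "(\<Sum>p\<in>?N. g p) = (\<Sum>n\<in>N. g (n, w)) + (\<Sum>m\<in>M. g (v, m))" for g :: "'a \<times> 'b \<Rightarrow> 'a \<times> 'b"
    using F(1) G(1) disj by (simp add: sum.union_disjoint sum.reindex inj_on_def)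
  have "vertex_frame (V \<times> W) (v, w) ?N ?h"
    unfolding vertex_frame_def
  proof (intro conjI ballI)
    show "finite ?N" using F(1) G(1) by simp
    show "?N \<subseteq> V \<times> W - {(v, w)}" using F(2,3) G(2,3) vw by auto
    show "linear (?h p)" if "p \<in> ?N" for p
      using that linl linr M by (auto simp: case_prod_unfold)
    show "?h p (p' - (v, w)) = (if p' = p then 1 else 0)" if "p \<in> ?N" "p' \<in> ?N" for p p'
      using that F(3) G(3) M linear_0[OF F(4)] linear_0[OF G(4)]
      by (auto simp: F(5) G(5) split: if_splits)
    fix p assume p: "p \<in> V \<times> W"
    show "0 \<le> ?h q (p - (v, w))" if "q \<in> ?N" for q
      using that p F(6) G(6) M by auto
    obtain x y where xy: "p = (x, y)" "x \<in> V" "y \<in> W" using p by auto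
    have "(\<Sum>q\<in>?N. ?h q (p - (v, w)) *\<^sub>R (q - (v, w)))
        = (\<Sum>n\<in>N. (h n (x - v) *\<^sub>R (n - v), 0)) + (\<Sum>m\<in>M. (0, k m (y - w) *\<^sub>R (m - w)))"
      unfolding sum xy using M by (auto intro!: arg_cong2[of _ _ _ _ "(+)"] sum.cong)
    also have "\<dots> = (x - v, y - w)"
      by (simp add: sum_Pair F(7)[OF xy(2), symmetric] G(7)[OF xy(3), symmetric])
    finally show "p - (v, w) = (\<Sum>q\<in>?N. ?h q (p - (v, w)) *\<^sub>R (q - (v, w)))"
      by (simp add: xy)
  qed
  with card show ?thesis by blast
qed

lemma simple_vertices_Times:
  assumes "simple_vertices m V" "simple_vertices n W"
  shows "simple_vertices (m + n) (V \<times> W)"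
  unfolding simple_vertices_def
proof
  fix p assume "p \<in> V \<times> W"
  then obtain v w where p: "p = (v, w)" "v \<in> V" "w \<in> W" by auto
  obtain N h where N: "vertex_frame V v N h" "card N = m"
    using assms(1) p unfolding simple_vertices_def by blast
  obtain M k where M: "vertex_frame W w M k" "card M = n"
    using assms(2) p unfolding simple_vertices_def by blast
  show "\<exists>N h. vertex_frame (V \<times> W) p N h \<and> card N = m + n"
    using vertex_frame_Times[OF N(1) M(1) p(2,3)] unfolding N(2) M(2) p(1) .
qed

lemma vertex_frame_linear_image:
  assumes L: "linear L" "inj L" and fr: "vertex_frame V v N h"
  shows "\<exists>k. vertex_frame (L ` V) (L v) (L ` N) k"
proof -
  \<comment> \<open>A left inverse of \<open>L\<close> is needed to define the dual functionals on
    the whole target space.\<close>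
  obtain g where g: "linear g" "g \<circ> L = id" using linear_injective_left_inverse[OF L] by blast
  then have gL: "g (L x) = x" for x by (metis comp_apply id_apply)
  have gL': "g (L x - L z) = x - z" for x z by (simp add: linear_diff[OF g(1)] gL)
  note F = vertex_frameD[OF fr]
  have inj: "inj_on L X" for X using L(2) inj_on_subset by blast
  have "vertex_frame (L ` V) (L v) (L ` N) (\<lambda>w x. h (g w) (g x))"
    unfolding vertex_frame_def
  proof (intro conjI ballI)
    show "finite (L ` N)" using F(1) by simp
    show "L ` N \<subseteq> L ` V - {L v}" using F(2,3) L(2) by (auto simp: inj_eq)
    show "linear (\<lambda>x. h (g w) (g x))" if w: "w \<in> L ` N" for w
    proof -
      obtain n where "w = L n" "n \<in> N" using w by blast
      then show ?thesis using linear_compose[OF g(1) F(4), of n] by (simp add: gL comp_def)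
    qed
    show "h (g w) (g (w' - L v)) = (if w' = w then 1 else 0)" if "w \<in> L ` N" "w' \<in> L ` N" for w w'
      using that F(5) L(2) by (auto simp: gL gL' inj_eq)
    fix x assume "x \<in> L ` V"
    then obtain z where z: "x = L z" "z \<in> V" by blast
    show "0 \<le> h (g w) (g (x - L v))" if "w \<in> L ` N" for w
      using that F(6) z by (auto simp: gL gL')
    have "x - L v = L (\<Sum>w\<in>N. h w (z - v) *\<^sub>R (w - v))"
      by (simp add: z(1) linear_diff[OF L(1), symmetric] F(7)[OF z(2), symmetric])
    also have "\<dots> = (\<Sum>w\<in>L ` N. h (g w) (g (x - L v)) *\<^sub>R (w - L v))"
      by (simp add: sum.reindex[OF inj] gL gL' z(1) linear_sum[OF L(1)] linear_scale[OF L(1)] linear_diff[OF L(1)])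
    finally show "x - L v = (\<Sum>w\<in>L ` N. h (g w) (g (x - L v)) *\<^sub>R (w - L v))" .
  qed
  then show ?thesis by blast
qed

lemma simple_vertices_linear_image:
  assumes L: "linear L" "inj L" and V: "simple_vertices d V"
  shows "simple_vertices d (L ` V)"
  unfolding simple_vertices_def
proof
  fix y assume "y \<in> L ` V"
  then obtain v where v: "y = L v" "v \<in> V" by blast
  obtain N h where N: "vertex_frame V v N h" "card N = d" using V v unfolding simple_vertices_def by blast
  obtain k where "vertex_frame (L ` V) y (L ` N) k" using vertex_frame_linear_image[OF L N(1)] v(1) by blast
  moreover have "card (L ` N) = d" using N(2) L(2) by (simp add: card_image inj_on_subset)
  ultimately show "\<exists>N h. vertex_frame (L ` V) y N h \<and> card N = d" by blast
qed

text \<open>The sum of the dual functionals is minimal on \<open>V\<close> at \<open>v\<close>; at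
  any other minimum all coefficients vanish, so it equals \<open>v\<close>.\<close>

lemma vertex_frame_facial_singleton:
  assumes fin: "finite V" and v: "v \<in> V" and fr: "vertex_frame V v N h"
  shows "facial V {v}"
proof -
  note F = vertex_frameD[OF fr]
  let ?g = "\<lambda>x. \<Sum>w\<in>N. h w x"
  have lin: "linear ?g" by (intro linear_compose_sum ballI F(4))
  have diff: "?g x - ?g v = ?g (x - v)" for x by (simp add: linear_diff[OF lin])
  have "?g v \<le> ?g x" if "x \<in> V" for x
    using sum_nonneg[of N "\<lambda>w. h w (x - v)"] F(6)[OF that] diff[of x] by simp
  then have "facial V {x \<in> V. ?g x = ?g v}" by (intro facial_supporting fin lin)
  moreover have "x = v" if x: "x \<in> V" "?g x = ?g v" for x
  proof -
    have "\<forall>w\<in>N. h w (x - v) = 0"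
      using diff[of x] x(2) F(1) F(6)[OF x(1)] by (simp add: sum_nonneg_eq_0_iff)
    then show "x = v" using F(7)[OF x(1)] by simp
  qed
  then have "{x \<in> V. ?g x = ?g v} = {v}" using v by blast
  ultimately show ?thesis by simp
qed

lemma simple_vertices_facial_singleton:
  assumes "finite V" "simple_vertices d V" "v \<in> V"
  shows "facial V {v}"
proof -
  obtain N h where "vertex_frame V v N h" using assms(2,3) unfolding simple_vertices_def by blast
  then show ?thesis by (rule vertex_frame_facial_singleton[OF assms(1,3)])
qed

lemma sum_indicator_scaleR:
  fixes f :: "'a::real_vector \<Rightarrow> real"
  assumes "finite S" "N \<subseteq> S"
  shows "(\<Sum>y\<in>S. (if y \<in> N then f y else 0) *\<^sub>R y) = (\<Sum>y\<in>N. f y *\<^sub>R y)"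
    and "(\<Sum>y\<in>S. if y \<in> N then f y else 0) = sum f N"
proof -
  have "S \<inter> N = N" using assms by blast
  then show "(\<Sum>y\<in>S. if y \<in> N then f y else 0) = sum f N"
    using assms by (simp add: sum.If_cases)
  have "(\<Sum>y\<in>S. (if y \<in> N then f y else 0) *\<^sub>R y) = (\<Sum>y\<in>S. if y \<in> N then f y *\<^sub>R y else 0)"
    by (intro sum.cong) auto
  then show "(\<Sum>y\<in>S. (if y \<in> N then f y else 0) *\<^sub>R y) = (\<Sum>y\<in>N. f y *\<^sub>R y)"
    using assms \<open>S \<inter> N = N\<close> by (simp add: sum.If_cases)
qed

text \<open>Both directions read the equation \<open>x + C *\<^sub>R v = v + (\<Sum>w\<in>N. c w *\<^sub>R w)\<close>, where
  \<open>c w = h w (x - v)\<close> and \<open>C\<close> is the sum of the \<open>c w\<close>, as an equation between conic combinations.\<close>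

lemma vertex_frame_mem_facial_iff:
  assumes fin: "finite V" and fr: "vertex_frame V v N h" and A: "facial V A" "v \<in> A" and x: "x \<in> V"
  shows "x \<in> A \<longleftrightarrow> (\<forall>w\<in>N. h w (x - v) \<noteq> 0 \<longrightarrow> w \<in> A)"
proof -
  note F = vertex_frameD[OF fr]
  define c where "c w = h w (x - v)" for w
  define C where "C = sum c N"
  have c: "0 \<le> c w" if "w \<in> N" for w using F(6)[OF x that] by (simp add: c_def)
  then have C: "0 \<le> C" unfolding C_def by (rule sum_nonneg)
  have AV: "A \<subseteq> V" using A(1) by (rule facial_subset)
  have finA: "finite A" using finite_subset[OF AV fin] .
  have v: "v \<in> V" using A(2) AV by blast
  have "x - v = (\<Sum>w\<in>N. c w *\<^sub>R w) - C *\<^sub>R v"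
    using F(7)[OF x] by (simp add: c_def C_def scaleR_diff_right sum_subtractf scaleR_sum_left)
  then have eq: "x + C *\<^sub>R v = v + (\<Sum>w\<in>N. c w *\<^sub>R w)" by (simp add: algebra_simps)
  note conic = A(1)[unfolded facial_iff[OF fin], THEN conjunct2, rule_format]
  \<comment> \<open>Weights written as sums of indicators remain correct when points coincide, as
    for \<open>x = v\<close>.\<close>
  have pt: "(\<Sum>z\<in>S. (if z \<in> {y} then a else 0) *\<^sub>R z) = a *\<^sub>R y"
    "(\<Sum>z\<in>S. if z \<in> {y} then a else 0) = a" if "finite S" "y \<in> S" for S and y :: 'a and a :: real
    using sum_indicator_scaleR[OF that(1), of "{y}" "\<lambda>_. a"] that(2) by auto
  show ?thesis
  proof
    assume xA: "x \<in> A"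
    show "\<forall>w\<in>N. h w (x - v) \<noteq> 0 \<longrightarrow> w \<in> A"
    proof (intro ballI impI)
      fix w assume w: "w \<in> N" "h w (x - v) \<noteq> 0"
      show "w \<in> A"
      proof (rule ccontr)
        assume wA: "w \<notin> A"
        have "(if w \<in> {v} then 1 else 0) + (if w \<in> N then c w else 0) = 0"
        proof (rule conic[where u = "\<lambda>y. (if y \<in> {v} then 1 else 0) + (if y \<in> N then c y else 0)"
              and w = "\<lambda>y. (if y \<in> {x} then 1 else 0) + (if y \<in> {v} then C else 0)"])
          show "(\<Sum>y\<in>V. (if y \<in> {v} then 1 else 0) + (if y \<in> N then c y else 0))
              = (\<Sum>y\<in>A. (if y \<in> {x} then 1 else 0) + (if y \<in> {v} then C else 0))"
            unfolding sum.distrib pt(2)[OF fin v] pt(2)[OF finA xA] pt(2)[OF finA A(2)]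
              sum_indicator_scaleR(2)[OF fin F(2)] C_def ..
          show "(\<Sum>y\<in>V. ((if y \<in> {v} then 1 else 0) + (if y \<in> N then c y else 0)) *\<^sub>R y)
              = (\<Sum>y\<in>A. ((if y \<in> {x} then 1 else 0) + (if y \<in> {v} then C else 0)) *\<^sub>R y)"
            unfolding scaleR_left_distrib sum.distrib pt(1)[OF fin v] pt(1)[OF finA xA] pt(1)[OF finA A(2)]
              sum_indicator_scaleR(1)[OF fin F(2)] using eq by simp
        qed (use c C w F(2) wA in auto)
        then show False using w c[OF w(1)] by (auto simp: c_def split: if_splits)
      qed
    qed
  next
    assume sub: "\<forall>w\<in>N. h w (x - v) \<noteq> 0 \<longrightarrow> w \<in> A"
    let ?M = "N \<inter> A"
    have M: "sum c ?M = C" "(\<Sum>w\<in>?M. c w *\<^sub>R w) = (\<Sum>w\<in>N. c w *\<^sub>R w)"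
      unfolding C_def using F(1) sub by (auto intro!: sum.mono_neutral_left simp: c_def)
    show "x \<in> A"
    proof (rule ccontr)
      assume xA: "x \<notin> A"
      have "(if x \<in> {x} then 1 else 0) + (if x \<in> {v} then C else 0) = 0"
      proof (rule conic[where w = "\<lambda>y. (if y \<in> {v} then 1 else 0) + (if y \<in> ?M then c y else 0)"
            and u = "\<lambda>y. (if y \<in> {x} then 1 else 0) + (if y \<in> {v} then C else 0)"])
        show "(\<Sum>y\<in>V. (if y \<in> {x} then 1 else 0) + (if y \<in> {v} then C else 0))
            = (\<Sum>y\<in>A. (if y \<in> {v} then 1 else 0) + (if y \<in> ?M then c y else 0))"
          unfolding sum.distrib pt(2)[OF fin v] pt(2)[OF fin x] pt(2)[OF finA A(2)]
            sum_indicator_scaleR(2)[OF finA Int_lower2] M ..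
        show "(\<Sum>y\<in>V. ((if y \<in> {x} then 1 else 0) + (if y \<in> {v} then C else 0)) *\<^sub>R y)
            = (\<Sum>y\<in>A. ((if y \<in> {v} then 1 else 0) + (if y \<in> ?M then c y else 0)) *\<^sub>R y)"
          unfolding scaleR_left_distrib sum.distrib pt(1)[OF fin v] pt(1)[OF fin x] pt(1)[OF finA A(2)]
            sum_indicator_scaleR(1)[OF finA Int_lower2] M(2) using eq by simp
      qed (use c C x xA in auto)
      then show False using C by (auto split: if_splits)
    qed
  qed
qed

text \<open>Some coefficient of \<open>b - v\<close> is nonzero. The corresponding neighbour lies in
  the face \<open>{v, b}\<close> and is not \<open>v\<close>.\<close>

lemma vertex_frame_facial_pair:
  assumes "finite V" "vertex_frame V v N h" "facial V {v, b}" "b \<noteq> v"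
  shows "b \<in> N"
proof -
  note F = vertex_frameD[OF assms(2)]
  have b: "b \<in> V" using facial_subset[OF assms(3)] by blast
  have "\<exists>w\<in>N. h w (b - v) \<noteq> 0"
    using F(7)[OF b] assms(4) by (metis (no_types, lifting) right_minus_eq scaleR_eq_0_iff sum.neutral)
  then obtain w where "w \<in> N" "w \<in> {v, b}"
    using vertex_frame_mem_facial_iff[OF assms(1,2,3) insertI1 b] by blast
  then show ?thesis using F(3) by blast
qed

text \<open>Points of \<open>A\<close> have nonzero coefficients only at neighbours in
  \<open>A\<close>, so the directions to these span the face from \<open>v\<close>; the dual
  functionals make them independent.\<close>

lemma has_dim_vertex_frame:
  assumes fin: "finite V" and fr: "vertex_frame V v N h" and A: "facial V A" "v \<in> A"
  shows "has_dim (convex hull A) (card (N \<inter> A))"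
proof -
  note F = vertex_frameD[OF fr]
  let ?D = "(\<lambda>w. w - v) ` (N \<inter> A)"
  have AV: "A \<subseteq> V" using A(1) by (rule facial_subset)
  have inj: "inj_on (\<lambda>w. w - v) (N \<inter> A)" by (simp add: inj_on_def)
  show ?thesis
  proof (rule has_dimI)
    show "independent ?D"
    proof (rule independent_if_scalars_zero)
      fix f y assume s: "(\<Sum>y\<in>?D. f y *\<^sub>R y) = 0" and "y \<in> ?D"
      then obtain w where w: "w \<in> N" "w \<in> A" "y = w - v" by blast
      have "0 = h w (\<Sum>u\<in>N \<inter> A. f (u - v) *\<^sub>R (u - v))"
        using s by (simp add: sum.reindex[OF inj] linear_0[OF F(4)[OF w(1)]])
      also have "\<dots> = (\<Sum>u\<in>N \<inter> A. f (u - v) * h w (u - v))"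
        by (simp add: linear_sum[OF F(4)[OF w(1)]] linear_scale[OF F(4)[OF w(1)]])
      also have "\<dots> = (\<Sum>u\<in>N \<inter> A. if u = w then f (u - v) else 0)"
        using w F(5) by (intro sum.cong) auto
      also have "\<dots> = f y" using F(1) w by simp
      finally show "f y = 0" by simp
    qed (use F(1) in simp)
    show "finite ?D" "card ?D = card (N \<inter> A)" using F(1) inj by (simp_all add: card_image)
    have "affine hull A = (+) v ` span ?D"
    proof
      have "x \<in> affine hull (insert v (N \<inter> A))" if x: "x \<in> A" for x
      proof -
        have xV: "x \<in> V" using x AV by blast
        note F(7)[OF xV]
        also have "(\<Sum>w\<in>N. h w (x - v) *\<^sub>R (w - v)) = (\<Sum>w\<in>N \<inter> A. h w (x - v) *\<^sub>R (w - v))"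
        proof (rule sum.mono_neutral_right)
          have "h w (x - v) = 0" if "w \<in> N - A" for w
            using vertex_frame_mem_facial_iff[OF fin fr A xV] x that by blast
          then show "\<forall>w\<in>N - N \<inter> A. h w (x - v) *\<^sub>R (w - v) = 0" by simp
        qed (use F(1) in auto)
        also have "\<dots> \<in> span ?D" by (intro span_sum span_scale span_base) auto
        finally have "v + (x - v) \<in> (+) v ` span ?D" by blast
        then show ?thesis by (simp add: affine_hull_insert_span_gen)
      qed
      then have "affine hull A \<subseteq> affine hull (insert v (N \<inter> A))"
        by (intro hull_minimal subsetI affine_affine_hull)
      then show "affine hull A \<subseteq> (+) v ` span ?D" by (simp add: affine_hull_insert_span_gen)
      have "insert v (N \<inter> A) \<subseteq> A" using A(2) by blast
      then have "affine hull (insert v (N \<inter> A)) \<subseteq> affine hull A" by (rule hull_mono)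
      then show "(+) v ` span ?D \<subseteq> affine hull A" by (simp add: affine_hull_insert_span_gen)
    qed
    then show "affine hull (convex hull A) = (+) v ` span ?D" by simp
  qed
qed

lemma facial_self: "facial V V"
  unfolding facial_def
  by (intro exI[of _ "convex hull V"] conjI face_of_refl convex_convex_hull)
    (simp add: hull_subset Int_absorb2)

text \<open>The functional \<open>h w\<close> supports \<open>V\<close> at \<open>v\<close>. It
  vanishes on the directions to all neighbours but \<open>w\<close>.\<close>

lemma vertex_frame_facet:
  assumes fin: "finite V" and v: "v \<in> V" and fr: "vertex_frame V v N h" and w: "w \<in> N"
  defines "A \<equiv> {x \<in> V. h w (x - v) = 0}"
  shows "facial V A" "v \<in> A" "N \<inter> A = N - {w}"
proof -
  note F = vertex_frameD[OF fr]
  have diff: "h w (x - v) = h w x - h w v" for x by (rule linear_diff[OF F(4)[OF w]])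
  have "facial V {x \<in> V. h w x = h w v}"
    using F(6)[OF _ w] by (intro facial_supporting fin F(4)[OF w]) (simp add: diff)
  then show "facial V A" by (simp add: A_def diff)
  show "v \<in> A" using v linear_0[OF F(4)[OF w]] by (simp add: A_def)
  show "N \<inter> A = N - {w}" using F(2) F(5)[OF w] by (auto simp: A_def)
qed

text \<open>A facet through \<open>v\<close> misses exactly one neighbour and is determined by it;
  conversely each neighbour is missed by the zero set of its dual functional.\<close>

lemma card_facets_vertex_frame:
  assumes fin: "finite V" and v: "v \<in> V" and fr: "vertex_frame V v N h"
  shows "card {F. is_facet F (convex hull V) \<and> v \<in> F} = card N"
proof -
  note F = vertex_frameD[OF fr]
  define A where "A w = {x \<in> V. h w (x - v) = 0}" for w
  note A = vertex_frame_facet[OF fin v fr, folded A_def]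
  have dimP: "has_dim (convex hull V) (card N)"
    using has_dim_vertex_frame[OF fin fr facial_self v] F(2) by (simp add: Int_absorb2)
  have inj: "inj_on (\<lambda>w. convex hull (A w)) N"
  proof (rule inj_onI)
    fix w w' assume w: "w \<in> N" "w' \<in> N" and eq: "convex hull (A w) = convex hull (A w')"
    have "A w = A w'" using facial_convex_hull_face(2)[OF fin A(1)] w eq by metis
    then have "N - {w} = N - {w'}" using A(3) w by metis
    then show "w = w'" using w by blast
  qed
  have "{F. is_facet F (convex hull V) \<and> v \<in> F} = (\<lambda>w. convex hull (A w)) ` N"
  proof (intro equalityI subsetI)
    fix G assume "G \<in> {F. is_facet F (convex hull V) \<and> v \<in> F}"
    then obtain n where G: "G face_of convex hull V" "has_dim G n" "has_dim (convex hull V) (n + 1)" "v \<in> G"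
      unfolding is_facet_def by blast
    have N: "card N = n + 1" using has_dim_unique[OF dimP G(3)] .
    let ?B = "V \<inter> G"
    have B: "facial V ?B" "v \<in> ?B" using G v unfolding facial_def by blast+
    have GB: "G = convex hull ?B" by (rule face_eq_convex_hull[OF fin G(1)])
    have "card (N \<inter> ?B) = n"
      using has_dim_vertex_frame[OF fin fr B] G(2) GB has_dim_unique by metis
    \<comment> \<open>The dimension of a face through \<open>v\<close> is its number of neighbours
      of \<open>v\<close>, so codimension one leaves out one neighbour.\<close>
    then have "card (N - ?B) = 1" using N F(1) by (simp add: card_Diff_subset_Int)
    then obtain w where w: "N - ?B = {w}" by (auto simp: card_1_singleton_iff)
    have "x \<in> ?B \<longleftrightarrow> h w (x - v) = 0" if "x \<in> V" for x
    proof -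
      have "w \<in> N" "w \<notin> ?B" "\<And>u. u \<in> N \<Longrightarrow> u \<noteq> w \<Longrightarrow> u \<in> ?B" using w by blast+
      then show ?thesis using vertex_frame_mem_facial_iff[OF fin fr B that] by metis
    qed
    then have "?B = A w" unfolding A_def by blast
    with GB have "G = convex hull (A w)" by simp
    moreover have "w \<in> N" using w by blast
    ultimately show "G \<in> (\<lambda>w. convex hull (A w)) ` N" by (rule image_eqI)
  next
    fix G assume "G \<in> (\<lambda>w. convex hull (A w)) ` N"
    then obtain w where w: "w \<in> N" "G = convex hull (A w)" by blast
    have "has_dim G (card N - 1)"
      using has_dim_vertex_frame[OF fin fr A(1,2)[OF w(1)]] A(3)[OF w(1)] w F(1) by simp
    moreover have "card N = (card N - 1) + 1" using w(1) F(1) by (metis Suc_pred' add.commute card_gt_0_iff empty_iff plus_1_eq_Suc)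
    then have "has_dim (convex hull V) ((card N - 1) + 1)" using dimP by simp
    ultimately show "G \<in> {F. is_facet F (convex hull V) \<and> v \<in> F}"
      using facial_convex_hull_face(1)[OF fin A(1)[OF w(1)]] hull_inc[OF A(2)[OF w(1)], of convex] w(2)
      unfolding is_facet_def by blast
  qed
  then show ?thesis using inj by (simp add: card_image)
qed

lemma is_simple_polytope_simple_vertices:
  assumes fin: "finite V" and "V \<noteq> {}" and V: "simple_vertices d V"
  shows "is_simple_polytope d (convex hull V)"
proof -
  have fr: "\<exists>N h. vertex_frame V v N h \<and> card N = d" if "v \<in> V" for v
    using V that unfolding simple_vertices_def by blast
  obtain v where v: "v \<in> V" using \<open>V \<noteq> {}\<close> by blast
  obtain N h where N: "vertex_frame V v N h" "card N = d" using fr[OF v] by blast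
  have "has_dim (convex hull V) d"
    using has_dim_vertex_frame[OF fin N(1) facial_self v] vertex_frameD(2)[OF N(1)] N(2)
    by (simp add: Int_absorb2)
  moreover have "polytope (convex hull V)" using fin unfolding polytope_def by blast
  moreover have "card {F. is_facet F (convex hull V) \<and> u \<in> F} = d"
    if "u extreme_point_of (convex hull V)" for u
  proof -
    have "u \<in> V" using that extreme_point_of_convex_hull by blast
    then show ?thesis using fr card_facets_vertex_frame[OF fin] by metis
  qed
  ultimately show ?thesis unfolding is_simple_polytope_def is_polytope_def by blast
qed

text \<open>Duality makes \<open>w\<close> injective on \<open>J\<close>, so functionals indexed by
  \<open>J\<close> can be reindexed by the neighbours.\<close>

lemma vertex_frame_indexed:
  fixes V :: "'a::real_vector set" and w :: "'i \<Rightarrow> 'a" and g :: "'i \<Rightarrow> 'a \<Rightarrow> real"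
  assumes "finite J" and wV: "\<And>j. j \<in> J \<Longrightarrow> w j \<in> V" and lin: "\<And>j. j \<in> J \<Longrightarrow> linear (g j)"
    and dual: "\<And>i j. i \<in> J \<Longrightarrow> j \<in> J \<Longrightarrow> g i (w j - v) = (if i = j then 1 else 0)"
    and nonneg: "\<And>x j. x \<in> V \<Longrightarrow> j \<in> J \<Longrightarrow> 0 \<le> g j (x - v)"
    and expand: "\<And>x. x \<in> V \<Longrightarrow> x - v = (\<Sum>j\<in>J. g j (x - v) *\<^sub>R (w j - v))"
  shows "\<exists>h. vertex_frame V v (w ` J) h" "card (w ` J) = card J"
proof -
  have inj: "inj_on w J"
  proof (rule inj_onI)
    fix i j assume "i \<in> J" "j \<in> J" "w i = w j"
    with dual[of i i] dual[of i j] show "i = j" by (auto split: if_splits)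
  qed
  then show "card (w ` J) = card J" by (rule card_image)
  let ?h = "\<lambda>u. g (inv_into J w u)"
  have h: "?h (w i) = g i" if "i \<in> J" for i using that inv_into_f_f[OF inj] by simp
  have "vertex_frame V v (w ` J) ?h"
    unfolding vertex_frame_def
  proof (intro conjI ballI)
    show "finite (w ` J)" using assms(1) by simp
    have "w i \<noteq> v" if "i \<in> J" for i using dual[OF that that] linear_0[OF lin[OF that]] by auto
    then show "w ` J \<subseteq> V - {v}" using wV by auto
    show "linear (?h u)" if "u \<in> w ` J" for u using that lin h by auto
    show "?h u (u' - v) = (if u' = u then 1 else 0)" if "u \<in> w ` J" "u' \<in> w ` J" for u u'
    proof -
      obtain i j where ij: "i \<in> J" "j \<in> J" "u = w i" "u' = w j"
        using \<open>u \<in> w ` J\<close> \<open>u' \<in> w ` J\<close> by blast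
      then have "u' = u \<longleftrightarrow> i = j" using inj by (auto simp: inj_on_eq_iff)
      then show ?thesis using dual[OF ij(1,2)] h[OF ij(1)] ij(3,4) by simp
    qed
    fix x assume x: "x \<in> V"
    show "0 \<le> ?h u (x - v)" if "u \<in> w ` J" for u using that nonneg[OF x] h by auto
    show "x - v = (\<Sum>u\<in>w ` J. ?h u (x - v) *\<^sub>R (u - v))"
      unfolding sum.reindex[OF inj] using expand[OF x] h by simp
  qed
  then show "\<exists>h. vertex_frame V v (w ` J) h" by blast
qed

text \<open>Reduces a frame to inner products: \<open>n i\<close> is an outer normal of a facet at
  \<open>v\<close>, and \<open>w i\<close> is the neighbour off this facet. Pairing with the normals
  shows that the edge directions are independent; there are \<open>DIM('a)\<close> of them, so they
  span. The dual functionals are the normals divided by \<open>- c\<close>.\<close>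

lemma vertex_frame_of_normals:
  fixes V :: "'a::euclidean_space set" and n w :: "nat \<Rightarrow> 'a"
  assumes c: "c > 0" and nw: "\<And>i j. i < DIM('a) \<Longrightarrow> j < DIM('a) \<Longrightarrow> n i \<bullet> (w j - v) = (if i = j then - c else 0)"
    and le: "\<And>i x. i < DIM('a) \<Longrightarrow> x \<in> V \<Longrightarrow> n i \<bullet> x \<le> n i \<bullet> v"
    and wV: "\<And>i. i < DIM('a) \<Longrightarrow> w i \<in> V"
  shows "\<exists>h. vertex_frame V v (w ` {..<DIM('a)}) h" "card (w ` {..<DIM('a)}) = DIM('a)"
proof -
  let ?I = "{..<DIM('a)}"
  let ?D = "(\<lambda>i. w i - v) ` ?I"
  have inj: "inj_on (\<lambda>i. w i - v) ?I"
  proof (rule inj_onI)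
    fix i j assume "i \<in> ?I" "j \<in> ?I" "w i - v = w j - v"
    with c nw[of i i] nw[of i j] show "i = j" by (auto split: if_splits)
  qed
  have coeff: "n i \<bullet> (\<Sum>j\<in>?I. f j *\<^sub>R (w j - v)) = - c * f i" if "i < DIM('a)" for f i
  proof -
    have "n i \<bullet> (\<Sum>j\<in>?I. f j *\<^sub>R (w j - v)) = (\<Sum>j\<in>?I. if j = i then - c * f j else 0)"
      unfolding inner_sum_right using that nw by (intro sum.cong) auto
    then show ?thesis using that by simp
  qed
  have "independent ?D"
  proof (rule independent_if_scalars_zero)
    fix f x assume "(\<Sum>x\<in>?D. f x *\<^sub>R x) = 0" and x: "x \<in> ?D"
    then have "(\<Sum>j\<in>?I. f (w j - v) *\<^sub>R (w j - v)) = 0" by (simp add: sum.reindex[OF inj])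
    with x c coeff[of _ "\<lambda>j. f (w j - v)"] show "f x = 0" by auto
  qed simp
  moreover have "card ?D = DIM('a)" using inj by (simp add: card_image)
  ultimately have span: "span ?D = UNIV"
    using card_ge_dim_independent[of ?D UNIV] by auto
  have "x - v = (\<Sum>j\<in>?I. (- (n j \<bullet> (x - v)) / c) *\<^sub>R (w j - v))" for x
  proof -
    have "x - v \<in> span ?D" using span by simp
    then obtain f where f: "x - v = (\<Sum>y\<in>?D. f y *\<^sub>R y)"
      unfolding span_finite[OF finite_imageI[OF finite_lessThan]] by auto
    then have f': "x - v = (\<Sum>j\<in>?I. f (w j - v) *\<^sub>R (w j - v))" by (simp add: sum.reindex[OF inj])
    have "- (n i \<bullet> (x - v)) / c = f (w i - v)" if "i < DIM('a)" for i
      using coeff[OF that, of "\<lambda>j. f (w j - v)"] c by (simp add: f')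
    then show ?thesis by (subst f') (auto intro!: sum.cong)
  qed
  moreover have "linear (\<lambda>x. - (n j \<bullet> x) / c)" for j
    by (auto intro!: linearI simp: inner_add_right add_divide_distrib diff_divide_distrib)
  moreover have "0 \<le> - (n j \<bullet> (x - v)) / c" if "x \<in> V" "j < DIM('a)" for x j
    using le[OF that(2,1)] c by (simp add: inner_diff_right)
  ultimately show "\<exists>h. vertex_frame V v (w ` ?I) h" "card (w ` ?I) = DIM('a)"
    using vertex_frame_indexed[of ?I w V "\<lambda>j x. - (n j \<bullet> x) / c" v] wV nw c by auto
qed

section \<open>Edges and angles at a vertex\<close>

lemma extreme_between:
  assumes fin: "finite V" and y: "facial V {y}" and ab: "a \<in> V" "b \<in> V"
    and eq: "y - a = t *\<^sub>R (b - a)" and t: "0 < t" "t < 1"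
  shows "a = b"
proof (rule ccontr)
  assume "a \<noteq> b"
  have "y = (1 - t) *\<^sub>R a + t *\<^sub>R b" using eq by (simp add: algebra_simps)
  then have "y \<in> open_segment a b" using \<open>a \<noteq> b\<close> t by (auto simp: in_segment)
  moreover have "y extreme_point_of (convex hull V)" using y facial_singleton_extreme[OF fin] by blast
  ultimately show False using ab hull_inc unfolding extreme_point_of_def by metis
qed

text \<open>The sum of the dual functionals of the other neighbours is supporting, and it is minimal
  only on the ray from \<open>v\<close> through \<open>w\<close>.\<close>

lemma vertex_frame_edge:
  assumes fin: "finite V" and v: "v \<in> V" and fr: "vertex_frame V v N h" and w: "w \<in> N"
    and ext: "\<And>x. x \<in> V \<Longrightarrow> facial V {x}"
  shows "facial V {v, w}"
proof -
  note F = vertex_frameD[OF fr]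
  let ?g = "\<lambda>x. \<Sum>u\<in>N - {w}. h u x"
  have lin: "linear ?g" by (intro linear_compose_sum ballI F(4)) simp
  have diff: "?g x - ?g v = ?g (x - v)" for x by (simp add: linear_diff[OF lin])
  have wV: "w \<in> V" using w F(2) by blast
  have "?g v \<le> ?g x" if "x \<in> V" for x
    using sum_nonneg[of "N - {w}" "\<lambda>u. h u (x - v)"] F(6)[OF that] diff[of x] by simp
  then have "facial V {x \<in> V. ?g x = ?g v}" by (intro facial_supporting fin lin)
  moreover have "{x \<in> V. ?g x = ?g v} = {v, w}"
  proof (intro equalityI subsetI)
    fix x assume "x \<in> {x \<in> V. ?g x = ?g v}"
    then have x: "x \<in> V" "?g x = ?g v" by simp_all
    then have "(\<Sum>u\<in>N - {w}. h u (x - v)) = 0" using diff[of x] by simp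
    then have zero: "\<forall>u\<in>N - {w}. h u (x - v) = 0"
      by (subst (asm) sum_nonneg_eq_0_iff) (use F(1) F(6)[OF x(1)] in auto)
    define t where "t = h w (x - v)"
    have "(\<Sum>u\<in>N - {w}. h u (x - v) *\<^sub>R (u - v)) = 0" using zero by (intro sum.neutral) simp
    then have eq: "x - v = t *\<^sub>R (w - v)"
      using F(7)[OF x(1)] F(1) w by (simp add: sum.remove t_def)
    have t0: "0 \<le> t" using F(6)[OF x(1) w] by (simp add: t_def)
    have "w \<noteq> v" using w F(3) by blast
    \<comment> \<open>On this ray, \<open>x\<close> inside the segment contradicts its extremality,
      and \<open>x\<close> beyond \<open>w\<close> that of \<open>w\<close>.\<close>
    consider "t = 0" | "t = 1" | "0 < t" "t < 1" | "1 < t" using t0 by linarith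
    then show "x \<in> {v, w}"
    proof cases
      case 3
      then show ?thesis using extreme_between[OF fin ext[OF x(1)] v wV eq] \<open>w \<noteq> v\<close> by blast
    next
      case 4
      then have "w - v = (1 / t) *\<^sub>R (x - v)" using eq by simp
      from extreme_between[OF fin ext[OF wV] v x(1) this] 4 have "v = x" by simp
      then show ?thesis by simp
    qed (use eq in auto)
  next
    fix x assume "x \<in> {v, w}"
    moreover have "?g (w - v) = 0" using F(5) w by (intro sum.neutral) auto
    ultimately show "x \<in> {x \<in> V. ?g x = ?g v}" using v wV diff[of w] by auto
  qed
  ultimately show ?thesis by simp
qed

text \<open>The sum of the four products is \<open>b z z\<close> for \<open>z = p - q + r - s\<close>.\<close>

lemma not_all_angles_obtuse:
  fixes b :: "'a::real_vector \<Rightarrow> 'a \<Rightarrow> real"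
  assumes b: "bilinear b" and psd: "\<And>x. 0 \<le> b x x" and sym: "\<And>x y. b x y = b y x"
  shows "0 \<le> b (q - p) (s - p) + b (r - q) (p - q) + b (s - r) (q - r) + b (p - s) (r - s)"
  using psd[of "p - q + r - s"] sym[of q p] sym[of r p] sym[of s p] sym[of r q] sym[of s q] sym[of s r]
  by (simp add: bilinear_ladd[OF b] bilinear_radd[OF b] bilinear_lsub[OF b] bilinear_rsub[OF b])

text \<open>At each corner of a square the two sides lead to points of \<open>N\<close>, and the
  diagonal between them is not facial; so all four angles would be obtuse. A semidefinite form
  \<open>b\<close> suffices, which covers spaces of sequences.\<close>

lemma no_square_obtuse:
  fixes V :: "'a::real_vector set" and b :: "'a \<Rightarrow> 'a \<Rightarrow> real"
  assumes fin: "finite V" and b: "bilinear b" and psd: "\<And>x. 0 \<le> b x x" and sym: "\<And>x y. b x y = b y x"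
    and frames: "\<And>v. v \<in> V \<Longrightarrow> \<exists>N h. vertex_frame V v N h \<and>
      (\<forall>w\<in>N. \<forall>w'\<in>N. w \<noteq> w' \<longrightarrow> b (w - v) (w' - v) < 0 \<or> facial V {w, w'})"
  shows "no_square V"
  unfolding no_square_def
proof (intro allI notI)
  fix p q r s assume sq: "square V p q r s"
  have obtuse: "b (y - x) (z - x) < 0"
    if "facial V {x, y}" "facial V {x, z}" "\<not> facial V {y, z}" "x \<noteq> y" "x \<noteq> z" "y \<noteq> z" for x y z
  proof -
    have "x \<in> V" using facial_subset[OF that(1)] by blast
    then obtain N h where N: "vertex_frame V x N h"
      "\<forall>w\<in>N. \<forall>w'\<in>N. w \<noteq> w' \<longrightarrow> b (w - x) (w' - x) < 0 \<or> facial V {w, w'}"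
      using frames[OF \<open>x \<in> V\<close>] by blast
    have "y \<in> N" "z \<in> N"
      using vertex_frame_facial_pair[OF fin N(1) that(1)] vertex_frame_facial_pair[OF fin N(1) that(2)]
        that(4,5) by simp_all
    then show ?thesis using N(2) that(3,6) by blast
  qed
  have "b (q - p) (s - p) < 0" "b (r - q) (p - q) < 0" "b (s - r) (q - r) < 0" "b (p - s) (r - s) < 0"
    using sq obtuse[of p q s] obtuse[of q r p] obtuse[of r s q] obtuse[of s p r]
    by (auto simp: square_def insert_commute)
  then show False using not_all_angles_obtuse[of b q p s r, OF b psd sym] by linarith
qed

text \<open>Three vertices of a simplex would span a triangle with only obtuse angles, but the
  products at its corners \<open>x\<close> and \<open>y\<close> add up to
  \<open>b (x - y) (x - y)\<close>.\<close>

lemma simplicial_bound_obtuse: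
  fixes V :: "'a::real_vector set" and b :: "'a \<Rightarrow> 'a \<Rightarrow> real"
  assumes fin: "finite V" and b: "bilinear b" and psd: "\<And>x. 0 \<le> b x x"
    and frames: "\<And>v. v \<in> V \<Longrightarrow> \<exists>N h. vertex_frame V v N h \<and>
      (\<forall>w\<in>N. \<forall>w'\<in>N. w \<noteq> w' \<longrightarrow> b (w - v) (w' - v) < 0)"
  shows "simplicial_bound V 2"
  unfolding simplicial_bound_def
proof (intro allI impI)
  fix A assume A: "facial V A \<and> (\<forall>B\<subseteq>A. facial V B)"
  show "card A \<le> 2"
  proof (rule ccontr)
    assume "\<not> card A \<le> 2"
    then obtain B where B: "B \<subseteq> A" "card B = 3"
      using obtain_subset_with_card_n[of 3 A] by auto
    then obtain x y z where xyz: "B = {x, y, z}" "x \<noteq> y" "y \<noteq> z" "x \<noteq> z"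
      unfolding card_3_iff by blast
    have obtuse: "b (v - u) (w - u) < 0" if "{u, v, w} \<subseteq> A" "u \<noteq> v" "u \<noteq> w" "v \<noteq> w" for u v w
    proof -
      have fac: "facial V {u, v}" "facial V {u, w}" using A that by auto
      then have "u \<in> V" using facial_subset by blast
      then obtain N h where N: "vertex_frame V u N h"
        "\<forall>w\<in>N. \<forall>w'\<in>N. w \<noteq> w' \<longrightarrow> b (w - u) (w' - u) < 0"
        using frames[OF \<open>u \<in> V\<close>] by blast
      have "v \<in> N" "w \<in> N"
        using vertex_frame_facial_pair[OF fin N(1) fac(1)] vertex_frame_facial_pair[OF fin N(1) fac(2)]
          that(2,3) by simp_all
      then show ?thesis using N(2) that(4) by blast
    qed
    have "b (y - x) (z - x) < 0" "b (x - y) (z - y) < 0"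
      using obtuse[of x y z] obtuse[of y x z] B xyz by auto
    then show False
      using psd[of "x - y"] unfolding bilinear_lsub[OF b] bilinear_rsub[OF b] by linarith
  qed
qed

section \<open>The 120-cell\<close>

type_synonym quad = "real \<times> real \<times> real \<times> real"

text \<open>A 3-cycle and a double transposition generate the even permutations of four coordinates;
  together with one sign change they generate all sign changes too.\<close>

definition rot :: "quad \<Rightarrow> quad" where "rot = (\<lambda>(a, b, c, d). (b, c, a, d))"
definition swp :: "quad \<Rightarrow> quad" where "swp = (\<lambda>(a, b, c, d). (b, a, d, c))"
definition neg :: "quad \<Rightarrow> quad" where "neg = (\<lambda>(a, b, c, d). (- a, b, c, d))"

lemma quad_maps [simp]:
  "rot (a, b, c, d) = (b, c, a, d)" "swp (a, b, c, d) = (b, a, d, c)" "neg (a, b, c, d) = (- a, b, c, d)"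
  by (simp_all add: rot_def swp_def neg_def)

fun even_perms :: "quad \<Rightarrow> quad set" where
  "even_perms (a, b, c, d) = {(a, b, c, d), (a, c, d, b), (a, d, b, c), (b, a, d, c), (b, c, a, d), (b, d, c, a), (c, a, b, d), (c, b, d, a), (c, d, a, b), (d, a, c, b), (d, b, a, c), (d, c, b, a)}"

text \<open>Orbits of representatives with nonnegative coordinates: signs are removed by absolute
  values, so membership becomes a finite comparison.\<close>

definition signed_perms :: "quad set \<Rightarrow> quad set" where
  "signed_perms B = {(a, b, c, d) | a b c d. \<exists>p\<in>B. (\<bar>a\<bar>, \<bar>b\<bar>, \<bar>c\<bar>, \<bar>d\<bar>) \<in> even_perms p}"

lemma mem_signed_perms: "(a, b, c, d) \<in> signed_perms B \<longleftrightarrow> (\<exists>p\<in>B. (\<bar>a\<bar>, \<bar>b\<bar>, \<bar>c\<bar>, \<bar>d\<bar>) \<in> even_perms p)"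
  by (simp add: signed_perms_def)

lemma even_perms_closed:
  assumes "(a, b, c, d) \<in> even_perms p"
  shows "(b, c, a, d) \<in> even_perms p" "(b, a, d, c) \<in> even_perms p"
proof -
  obtain p1 p2 p3 p4 where p: "p = (p1, p2, p3, p4)" using prod_cases4 by blast
  show "(b, c, a, d) \<in> even_perms p" "(b, a, d, c) \<in> even_perms p"
    using assms unfolding p even_perms.simps insert_iff prod.inject empty_iff by argo+
qed

lemma signed_perms_closed:
  assumes "x \<in> signed_perms B"
  shows "rot x \<in> signed_perms B" "swp x \<in> signed_perms B" "neg x \<in> signed_perms B"
proof -
  obtain a b c d where x: "x = (a, b, c, d)" using prod_cases4 by blast
  obtain p where p: "p \<in> B" "(\<bar>a\<bar>, \<bar>b\<bar>, \<bar>c\<bar>, \<bar>d\<bar>) \<in> even_perms p"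
    using assms unfolding x mem_signed_perms by blast
  show "rot x \<in> signed_perms B" "swp x \<in> signed_perms B" "neg x \<in> signed_perms B"
    using p(2) even_perms_closed[OF p(2)] unfolding x quad_maps mem_signed_perms abs_minus
    by (blast intro: p(1))+
qed

text \<open>Reduces the 600 vertices of the 120-cell to seven representatives and three
  isometries.\<close>

lemma signed_perms_induct [consumes 1, case_names base rot swp neg]:
  assumes x: "x \<in> signed_perms B" and base: "\<And>p. p \<in> B \<Longrightarrow> P p"
    and rot: "\<And>x. P x \<Longrightarrow> P (rot x)" and swp: "\<And>x. P x \<Longrightarrow> P (swp x)" and neg: "\<And>x. P x \<Longrightarrow> P (neg x)"
  shows "P x"
proof -
  have rot': "P (b, c, a, d)" and swp': "P (b, a, d, c)" and neg': "P (- a, b, c, d)"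
    if "P (a, b, c, d)" for a b c d
    using rot[OF that] swp[OF that] neg[OF that] by simp_all
  have perm: "P q" if "q \<in> even_perms p" "P p" for p q
  proof -
    obtain a b c d where p: "p = (a, b, c, d)" using prod_cases4 by blast
    \<comment> \<open>The twelve even permutations as words in the two generators: three rotations,
      their swaps, and two further rotations of each swap.\<close>
    have 1: "P (a, b, c, d)" using that(2) p by simp
    note 2 = rot'[OF 1] and 3 = rot'[OF rot'[OF 1]] and 4 = swp'[OF 1]
    note 5 = swp'[OF 2] and 6 = swp'[OF 3]
    note 7 = rot'[OF 4] rot'[OF 5] rot'[OF 6]
    note 8 = rot'[OF 7(1)] rot'[OF 7(2)] rot'[OF 7(3)]
    show ?thesis using that(1) 1 2 3 4 5 6 7 8 unfolding p by auto
  qed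
  have neg2: "P (a, - b, c, d)" if "P (a, b, c, d)" for a b c d
    using rot'[OF rot'[OF neg'[OF rot'[OF that]]]] .
  have neg3: "P (a, b, - c, d)" if "P (a, b, c, d)" for a b c d
    using rot'[OF neg'[OF rot'[OF rot'[OF that]]]] .
  have neg4: "P (a, b, c, - d)" if "P (a, b, c, d)" for a b c d
    using swp'[OF neg3[OF swp'[OF that]]] .
  obtain a b c d where q: "x = (a, b, c, d)" using prod_cases4 by blast
  obtain p where p: "p \<in> B" "(\<bar>a\<bar>, \<bar>b\<bar>, \<bar>c\<bar>, \<bar>d\<bar>) \<in> even_perms p"
    using x unfolding q mem_signed_perms by blast
  have 1: "P (\<bar>a\<bar>, \<bar>b\<bar>, \<bar>c\<bar>, \<bar>d\<bar>)" using perm[OF p(2) base[OF p(1)]] .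
  have 2: "P (a, \<bar>b\<bar>, \<bar>c\<bar>, \<bar>d\<bar>)" using neg'[OF 1] 1 by (cases "0 \<le> a") auto
  have 3: "P (a, b, \<bar>c\<bar>, \<bar>d\<bar>)" using neg2[OF 2] 2 by (cases "0 \<le> b") auto
  have 4: "P (a, b, c, \<bar>d\<bar>)" using neg3[OF 3] 3 by (cases "0 \<le> c") auto
  show "P x" using neg4[OF 4] 4 unfolding q by (cases "0 \<le> d") auto
qed

lemma finite_signed_perms:
  assumes "finite B"
  shows "finite (signed_perms B)"
proof -
  have "finite (even_perms p)" for p by (cases p) simp
  then have "finite (\<Union>p\<in>B. even_perms p)" (is "finite ?E") using assms by blast
  then have "finite ((\<lambda>((a, b, c, d), s, t, u, v). (s * a, t * b, u * c, v * d :: real)) `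
      (?E \<times> {1, -1} \<times> {1, -1} \<times> {1, -1} \<times> {1, -1}))" (is "finite ?F") by simp
  moreover have "signed_perms B \<subseteq> ?F"
  proof
    fix x assume x: "x \<in> signed_perms B"
    obtain a b c d where q: "x = (a, b, c, d)" using prod_cases4 by blast
    have E: "(\<bar>a\<bar>, \<bar>b\<bar>, \<bar>c\<bar>, \<bar>d\<bar>) \<in> ?E" using x unfolding q mem_signed_perms by blast
    have "\<exists>s\<in>{1, -1}. s * \<bar>y\<bar> = y" for y :: real by (cases "0 \<le> y") auto
    then obtain s t u v where "s \<in> {1, -1}" "t \<in> {1, -1}" "u \<in> {1, -1}" "v \<in> {1, -1}"
      and eqs: "s * \<bar>a\<bar> = a" "t * \<bar>b\<bar> = b" "u * \<bar>c\<bar> = c" "v * \<bar>d\<bar> = d" by metis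
    with E have "((\<bar>a\<bar>, \<bar>b\<bar>, \<bar>c\<bar>, \<bar>d\<bar>), s, t, u, v) \<in> ?E \<times> {1, -1} \<times> {1, -1} \<times> {1, -1} \<times> {1, -1}"
      by (intro SigmaI)
    with eqs show "x \<in> ?F"
      unfolding q by (intro image_eqI[of _ _ "((\<bar>a\<bar>, \<bar>b\<bar>, \<bar>c\<bar>, \<bar>d\<bar>), s, t, u, v)"]) (simp, assumption)
  qed
  ultimately show ?thesis by (rule rev_finite_subset)
qed

section \<open>The golden ratio; vertices, facets and angles of the 120-cell\<close>

definition phi :: real where "phi = (1 + sqrt 5) / 2"

lemma phi_square: "phi * phi = phi + 1"
  by (simp add: phi_def field_simps)

lemma phi_square': "phi * (phi * x) = phi * x + x"
  by (simp add: phi_square distrib_right flip: mult.assoc)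

text \<open>Ratios of consecutive Fibonacci numbers. The lower bound is exactly the negativity of
  \<open>16 - 10 * phi\<close>, the inner product of two edges at a vertex.\<close>

lemma phi_bounds: "8 / 5 < phi" "phi < 5 / 3"
proof -
  have "11 / 5 < sqrt 5" by (rule real_less_rsqrt) (simp add: power2_eq_square)
  then show "8 / 5 < phi" by (simp add: phi_def)
  have "sqrt 5 < 7 / 3" by (rule real_less_lsqrt) (simp_all add: power2_eq_square)
  then show "phi < 5 / 3" by (simp add: phi_def)
qed

text \<open>The vertices of the 120-cell of squared circumradius 8, with all coordinates in \<open>\<int>[phi]\<close>.\<close>

definition cell120 :: "quad set" where
  "cell120 = signed_perms {(0, 0, 2, 2), (2 * phi - 1, 1, 1, 1), (2 - phi, phi, phi, phi), (phi + 1, phi - 1, phi - 1, phi - 1), (2 - phi, 0, 1, phi + 1), (phi - 1, 0, phi, 2 * phi - 1), (1, phi - 1, phi, 2)}"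

text \<open>Twice the unit icosians. They are the normals of the facets of the 120-cell, all of which lie
  at level \<open>2 * phi + 2\<close>.\<close>

definition cell600 :: "quad set" where
  "cell600 = signed_perms {(2, 0, 0, 0), (1, 1, 1, 1), (phi, 1, phi - 1, 0)}"

text \<open>A symmetry of \<open>x\<close> is moved over to \<open>n\<close>, which is why
  \<open>n\<close> stays arbitrary in the induction. What remains is a finite table for the
  representatives.\<close>

lemma cell600_cell120_le:
  assumes "x \<in> cell120" "n \<in> cell600"
  shows "n \<bullet> x \<le> 2 * phi + 2"
  using assms unfolding cell120_def
proof (induction arbitrary: n rule: signed_perms_induct)
  case (base p)
  obtain a b c d where n: "n = (a, b, c, d)" using prod_cases4 by blast
  obtain p1 p2 p3 p4 where p: "p = (p1, p2, p3, p4)" using prod_cases4 by blast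
  have "0 \<le> p1" "0 \<le> p2" "0 \<le> p3" "0 \<le> p4"
    using base(1) phi_bounds unfolding p by auto
  \<comment> \<open>The representative has nonnegative coordinates, so the signs of \<open>n\<close>
    can only decrease the product.\<close>
  then have "n \<bullet> p \<le> (\<bar>a\<bar>, \<bar>b\<bar>, \<bar>c\<bar>, \<bar>d\<bar>) \<bullet> p"
    unfolding n p by (auto intro!: add_mono mult_right_mono)
  also have "\<dots> \<le> 2 * phi + 2"
  proof -
    have "(\<bar>a\<bar>, \<bar>b\<bar>, \<bar>c\<bar>, \<bar>d\<bar>) \<in> (\<Union>q\<in>{(2, 0, 0, 0), (1, 1, 1, 1), (phi, 1, phi - 1, 0)}. even_perms q)"
      using base(2) unfolding n cell600_def mem_signed_perms by blast
    moreover have "\<forall>m\<in>(\<Union>q\<in>{(2, 0, 0, 0), (1, 1, 1, 1), (phi, 1, phi - 1, 0)}. even_perms q). m \<bullet> p \<le> 2 * phi + 2"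
      using base(1) phi_bounds by (elim insertE emptyE; simp add: algebra_simps phi_square phi_square')
    ultimately show ?thesis by blast
  qed
  finally show ?case .
next
  case (rot x)
  obtain a b c d where n: "n = (a, b, c, d)" using prod_cases4 by blast
  \<comment> \<open>The inverse of \<open>rot\<close>, obtained as \<open>rot\<close> applied twice;
    \<open>swp\<close> and \<open>neg\<close> are their own inverses.\<close>
  have "(c, a, b, d) \<in> cell600"
    using signed_perms_closed(1)[OF signed_perms_closed(1)] rot.prems unfolding cell600_def n by fastforce
  from rot.IH[OF this] show ?case unfolding n by (cases x) (simp add: algebra_simps)
next
  case (swp x)
  obtain a b c d where n: "n = (a, b, c, d)" using prod_cases4 by blast
  have "(b, a, d, c) \<in> cell600"
    using signed_perms_closed(2) swp.prems unfolding cell600_def n by fastforce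
  from swp.IH[OF this] show ?case unfolding n by (cases x) (simp add: algebra_simps)
next
  case (neg x)
  obtain a b c d where n: "n = (a, b, c, d)" using prod_cases4 by blast
  have "(- a, b, c, d) \<in> cell600"
    using signed_perms_closed(3) neg.prems unfolding cell600_def n by fastforce
  from neg.IH[OF this] show ?case unfolding n by (cases x) (simp add: algebra_simps)
qed

definition obtuse_frame :: "'a::real_inner set \<Rightarrow> nat \<Rightarrow> 'a \<Rightarrow> bool" where
  "obtuse_frame V m v \<longleftrightarrow> (\<exists>N h. vertex_frame V v N h \<and> card N = m \<and>
     (\<forall>w\<in>N. \<forall>w'\<in>N. w \<noteq> w' \<longrightarrow> (w - v) \<bullet> (w' - v) < 0))"

lemma obtuse_frame_isometry:
  assumes L: "linear L" "inj L" "\<And>x y. L x \<bullet> L y = x \<bullet> y" "L ` V = V" and v: "obtuse_frame V m v"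
  shows "obtuse_frame V m (L v)"
proof -
  obtain N h where N: "vertex_frame V v N h" "card N = m"
      "\<forall>w\<in>N. \<forall>w'\<in>N. w \<noteq> w' \<longrightarrow> (w - v) \<bullet> (w' - v) < 0"
    using v unfolding obtuse_frame_def by blast
  obtain k where "vertex_frame V (L v) (L ` N) k"
    using vertex_frame_linear_image[OF L(1,2) N(1)] unfolding L(4) by blast
  moreover have "card (L ` N) = m" using N(2) L(2) by (simp add: card_image inj_on_subset)
  moreover have "\<forall>w\<in>L ` N. \<forall>w'\<in>L ` N. w \<noteq> w' \<longrightarrow> (w - L v) \<bullet> (w' - L v) < 0"
    using N(3) by (auto simp: L(3) linear_diff[OF L(1), symmetric])
  ultimately show ?thesis unfolding obtuse_frame_def by blast
qed

text \<open>\<open>ns\<close> lists the normals of the four facets at \<open>v\<close>, and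
  \<open>ws ! i\<close> is the neighbour off the facet of \<open>ns ! i\<close>, which lies
  \<open>4 - 2 * phi\<close> below its level. The squared edge length is
  \<open>20 - 12 * phi\<close>; times the cosine \<open>(1 - phi) / 2\<close> of the pentagon angle
  it is \<open>16 - 10 * phi\<close>.\<close>

lemma cell120_frameI:
  assumes v: "\<forall>i<4. (ns ! i) \<bullet> v = 2 * phi + 2" and n: "\<forall>i<4. ns ! i \<in> cell600" and w: "\<forall>i<4. ws ! i \<in> cell120"
    and nw: "\<forall>i<4. \<forall>j<4. i \<noteq> j \<longrightarrow> (ns ! i) \<bullet> (ws ! j - v) = 0" "\<forall>i<4. (ns ! i) \<bullet> (ws ! i - v) = 2 * phi - 4"
    and ww: "\<forall>i<4. \<forall>j<4. i \<noteq> j \<longrightarrow> (ws ! i - v) \<bullet> (ws ! j - v) = 16 - 10 * phi"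
  shows "obtuse_frame cell120 4 v"
proof -
  have D: "DIM(quad) = 4" by simp
  have nw': "(ns ! i) \<bullet> (ws ! j - v) = (if i = j then - (4 - 2 * phi) else 0)" if "i < 4" "j < 4" for i j
    using nw that by simp
  have le: "(ns ! i) \<bullet> x \<le> (ns ! i) \<bullet> v" if "i < 4" "x \<in> cell120" for i x
    using cell600_cell120_le[OF that(2), of "ns ! i"] n v that(1) by simp
  note frame = vertex_frame_of_normals[where c = "4 - 2 * phi" and n = "(!) ns" and w = "(!) ws"
      and V = cell120 and v = v, unfolded D]
  have "\<exists>h. vertex_frame cell120 v ((!) ws ` {..<4}) h"
    by (rule frame(1)) (use phi_bounds w in \<open>simp_all add: nw' le\<close>)
  moreover have "card ((!) ws ` {..<4}) = 4"
    by (rule frame(2)) (use phi_bounds w in \<open>simp_all add: nw' le\<close>)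
  moreover have "(x - v) \<bullet> (y - v) < 0" if xy: "x \<in> (!) ws ` {..<4}" "y \<in> (!) ws ` {..<4}" "x \<noteq> y" for x y
  proof -
    obtain i j where ij: "x = ws ! i" "y = ws ! j" "i < 4" "j < 4" using xy by auto
    with xy(3) have "(x - v) \<bullet> (y - v) = 16 - 10 * phi" using ww by metis
    then show ?thesis using phi_bounds by simp
  qed
  ultimately show ?thesis unfolding obtuse_frame_def by blast
qed

lemma cell120_obtuse_frame:
  assumes "v \<in> cell120"
  shows "obtuse_frame cell120 4 v"
  using assms unfolding cell120_def
proof (induction rule: signed_perms_induct)
  case (base p)
  \<comment> \<open>Membership in an orbit is decided by absolute values, so those of the occurring
    coordinates have to be evaluated.\<close>
  have abs: "\<bar>phi\<bar> = phi" "\<bar>phi - 1\<bar> = phi - 1" "\<bar>2 - phi\<bar> = 2 - phi" "\<bar>1 + phi\<bar> = 1 + phi"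
    "\<bar>phi * 2 - 1\<bar> = phi * 2 - 1" "\<bar>1 - phi\<bar> = phi - 1" "\<bar>phi - 2\<bar> = 2 - phi"
    using phi_bounds by auto
  note cell120_simps = numeral_eq_Suc All_less_Suc cell120_def cell600_def mem_signed_perms abs
    algebra_simps phi_square phi_square'
  \<comment> \<open>For each representative, the normals are elements of \<open>cell600\<close>
    whose inner product with it is the maximal \<open>2 * phi + 2\<close>, and the neighbours are
    vertices at edge distance, ordered to match. All products reduce to linear expressions in
    \<open>phi\<close>.\<close>
  from base show ?case
    unfolding cell120_def[symmetric]
    apply (elim insertE emptyE)
    subgoal
      by (rule cell120_frameI[where ns = "[(phi - 1, 0, phi, 1), (0, phi - 1, 1, phi), (0, - (phi - 1), 1, phi), (- (phi - 1), 0, phi, 1)]"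
          and ws = "[(- (phi - 1), 0, phi, 2 * phi - 1), (0, - (phi - 1), 2 * phi - 1, phi), (0, phi - 1, 2 * phi - 1, phi), (phi - 1, 0, phi, 2 * phi - 1)]"])
        (simp_all add: cell120_simps)
    subgoal
      by (rule cell120_frameI[where ns = "[(phi, phi - 1, 0, 1), (phi, 0, 1, phi - 1), (phi, 1, phi - 1, 0), (1, 1, 1, 1)]"
          and ws = "[(2, 1, phi, phi - 1), (2, phi, phi - 1, 1), (2, phi - 1, 1, phi), (phi + 1, phi - 1, phi - 1, phi - 1)]"])
        (simp_all add: cell120_simps)
    subgoal
      by (rule cell120_frameI[where ns = "[(0, phi - 1, 1, phi), (0, phi, phi - 1, 1), (0, 1, phi, phi - 1), (1, 1, 1, 1)]"
          and ws = "[(phi - 1, 2, phi, 1), (phi - 1, 1, 2, phi), (phi - 1, phi, 1, 2), (- (2 - phi), phi, phi, phi)]"])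
        (simp_all add: cell120_simps)
    subgoal
      by (rule cell120_frameI[where ns = "[(phi, phi - 1, 0, 1), (phi, 0, 1, phi - 1), (phi, 1, phi - 1, 0), (2, 0, 0, 0)]"
          and ws = "[(phi + 1, 2 - phi, 1, 0), (phi + 1, 1, 0, 2 - phi), (phi + 1, 0, 2 - phi, 1), (2 * phi - 1, 1, 1, 1)]"])
        (simp_all add: cell120_simps)
    subgoal
      by (rule cell120_frameI[where ns = "[(0, phi - 1, 1, phi), (0, 0, 0, 2), (0, - (phi - 1), 1, phi), (1, 0, phi - 1, phi)]"
          and ws = "[(phi - 1, - (phi - 1), phi - 1, phi + 1), (phi - 1, 0, phi, 2 * phi - 1), (phi - 1, phi - 1, phi - 1, phi + 1), (- (2 - phi), 0, 1, phi + 1)]"])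
        (simp_all add: cell120_simps)
    subgoal
      by (rule cell120_frameI[where ns = "[(phi - 1, 0, phi, 1), (0, phi - 1, 1, phi), (0, - (phi - 1), 1, phi), (1, 0, phi - 1, phi)]"
          and ws = "[(2 - phi, 0, 1, phi + 1), (1, - (phi - 1), phi, 2), (1, phi - 1, phi, 2), (0, 0, 2, 2)]"])
        (simp_all add: cell120_simps)
    subgoal
      by (rule cell120_frameI[where ns = "[(phi - 1, 0, phi, 1), (0, phi - 1, 1, phi), (1, 0, phi - 1, phi), (1, 1, 1, 1)]"
          and ws = "[(1, 1, 1, 2 * phi - 1), (phi, 2 - phi, phi, phi), (phi - 1, 1, 2, phi), (phi - 1, 0, phi, 2 * phi - 1)]"])
        (simp_all add: cell120_simps)
    done
next
  case (rot x)
  have L: "linear rot" "inj rot" "\<And>x y. rot x \<bullet> rot y = x \<bullet> y" "\<And>x. rot (rot (rot x)) = x"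
    by (auto intro!: linearI injI)
  have "rot ` cell120 = cell120"
    using signed_perms_closed(1) L(4) unfolding cell120_def by (metis (no_types, lifting) image_eqI image_subsetI subsetI subset_antisym)
  from obtuse_frame_isometry[OF L(1-3) this] rot show ?case unfolding cell120_def .
next
  case (swp x)
  have L: "linear swp" "inj swp" "\<And>x y. swp x \<bullet> swp y = x \<bullet> y" "\<And>x. swp (swp x) = x"
    by (auto intro!: linearI injI)
  have "swp ` cell120 = cell120"
    using signed_perms_closed(2) L(4) unfolding cell120_def by (metis (no_types, lifting) image_eqI image_subsetI subsetI subset_antisym)
  from obtuse_frame_isometry[OF L(1-3) this] swp show ?case unfolding cell120_def .
next
  case (neg x)
  have L: "linear neg" "inj neg" "\<And>x y. neg x \<bullet> neg y = x \<bullet> y" "\<And>x. neg (neg x) = x"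
    by (auto intro!: linearI injI)
  have "neg ` cell120 = cell120"
    using signed_perms_closed(3) L(4) unfolding cell120_def by (metis (no_types, lifting) image_eqI image_subsetI subsetI subset_antisym)
  from obtuse_frame_isometry[OF L(1-3) this] neg show ?case unfolding cell120_def .
qed

lemma cell120_properties:
  "finite cell120" "cell120 \<noteq> {}" "simple_vertices 4 cell120" "no_square cell120" "simplicial_bound cell120 2"
proof -
  show fin: "finite cell120" unfolding cell120_def by (intro finite_signed_perms) simp
  have "(0, 0, 2, 2) \<in> cell120" unfolding cell120_def mem_signed_perms by simp
  then show "cell120 \<noteq> {}" by blast
  have bil: "bilinear ((\<bullet>) :: quad \<Rightarrow> _)"
    by (simp add: bilinear_conv_bounded_bilinear bounded_bilinear_inner)
  show "simple_vertices 4 cell120"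
    using cell120_obtuse_frame unfolding simple_vertices_def obtuse_frame_def by blast
  show "no_square cell120"
    by (rule no_square_obtuse[OF fin bil])
      (use cell120_obtuse_frame in \<open>auto simp: inner_commute obtuse_frame_def, blast\<close>)
  show "simplicial_bound cell120 2"
    by (rule simplicial_bound_obtuse[OF fin bil])
      (use cell120_obtuse_frame in \<open>auto simp: obtuse_frame_def, blast\<close>)
qed

section \<open>The middle section of a cube\<close>

text \<open>Vertices of the section of the cube \<open>[0, 1] ^ (2 * n + 1)\<close> by the hyperplane on which the coordinate
  sum is \<open>n + 1 / 2\<close>. The faces of this simple polytope arise by fixing coordinates at 0 or 1; its
  2-faces are triangles and hexagons.\<close>

abbreviation lk :: "(nat \<Rightarrow>\<^sub>0 real) \<Rightarrow> nat \<Rightarrow> real" where "lk \<equiv> Poly_Mapping.lookup"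

text \<open>The level is not an integer, so the hyperplane avoids the cube vertices and meets a cube
  edge, if at all, in its midpoint; \<open>i\<close> is the direction of this edge.\<close>

definition half_at :: "nat \<Rightarrow> nat \<Rightarrow> (nat \<Rightarrow>\<^sub>0 real) \<Rightarrow> bool" where
  "half_at n i x \<longleftrightarrow> i < 2 * n + 1 \<and> lk x i = 1 / 2 \<and> (\<forall>j<2 * n + 1. j \<noteq> i \<longrightarrow> lk x j = 0 \<or> lk x j = 1) \<and>
     (\<forall>j\<ge>2 * n + 1. lk x j = 0) \<and> (\<Sum>j<2 * n + 1. lk x j) = n + 1 / 2"

definition midsection :: "nat \<Rightarrow> (nat \<Rightarrow>\<^sub>0 real) set" where
  "midsection n = {x. \<exists>i. half_at n i x}"

text \<open>For \<open>lk x i = 1 / 2\<close> this exchanges the coordinates \<open>i\<close> and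
  \<open>j\<close>. It is written as a displacement because the edge direction enters the
  frame.\<close>

definition slide :: "(nat \<Rightarrow>\<^sub>0 real) \<Rightarrow> nat \<Rightarrow> nat \<Rightarrow> (nat \<Rightarrow>\<^sub>0 real)" where
  "slide x i j = x + ((1 - 2 * lk x j) / 2) *\<^sub>R (Poly_Mapping.single j 1 - Poly_Mapping.single i 1)"

lemma lookup_slide:
  "lk (slide x i j) l = lk x l + (1 - 2 * lk x j) / 2 * ((if l = j then 1 else 0) - (if l = i then 1 else 0))"
  by (simp add: slide_def lookup_add lookup_minus lookup_single when_def)

lemma half_at_slide:
  assumes x: "half_at n i x" and j: "j < 2 * n + 1" "j \<noteq> i"
  shows "half_at n j (slide x i j)"
proof -
  have i: "i < 2 * n + 1" using x by (simp add: half_at_def)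
  have "(\<Sum>l<2 * n + 1. lk (slide x i j) l) = (\<Sum>l<2 * n + 1. lk x l) + (1 - 2 * lk x j) / 2 *
      ((\<Sum>l<2 * n + 1. if l = j then 1 else 0) - (\<Sum>l<2 * n + 1. if l = i then 1 else 0))"
    by (simp only: lookup_slide sum.distrib sum_distrib_left[symmetric] sum_subtractf)
  also have "\<dots> = (\<Sum>l<2 * n + 1. lk x l)" using i j(1) by simp
  finally have sum: "(\<Sum>l<2 * n + 1. lk (slide x i j) l) = (\<Sum>l<2 * n + 1. lk x l)" .
  have "lk x j = 0 \<or> lk x j = 1" using x j by (simp add: half_at_def)
  then show ?thesis
    using x i j unfolding half_at_def sum by (auto simp: lookup_slide)
qed

lemma half_at_unique:
  assumes "half_at n i x" "half_at n j x"
  shows "i = j"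
proof (rule ccontr)
  assume "i \<noteq> j"
  then have "lk x j = 0 \<or> lk x j = 1" using assms unfolding half_at_def by metis
  moreover have "lk x j = 1 / 2" using assms(2) by (simp add: half_at_def)
  ultimately show False by auto
qed

lemma finite_midsection: "finite (midsection n)"
proof -
  let ?F = "\<lambda>(i, T). cube_vertex T + Poly_Mapping.single i (1 / 2)"
  have "midsection n \<subseteq> ?F ` ({..<2 * n + 1} \<times> Pow {..<2 * n + 1})"
  proof
    fix x assume "x \<in> midsection n"
    then obtain i where i: "half_at n i x" by (auto simp: midsection_def)
    let ?T = "{j. j < 2 * n + 1 \<and> lk x j = 1}"
    have "x = ?F (i, ?T)"
    proof (rule poly_mapping_eqI)
      fix l show "lk x l = lk (?F (i, ?T)) l"
        using i by (cases "l < 2 * n + 1")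
          (auto simp: half_at_def lookup_add lookup_cube_vertex lookup_single when_def)
    qed
    moreover have "(i, ?T) \<in> {..<2 * n + 1} \<times> Pow {..<2 * n + 1}" using i by (auto simp: half_at_def)
    ultimately show "x \<in> ?F ` ({..<2 * n + 1} \<times> Pow {..<2 * n + 1})" by (rule image_eqI)
  qed
  then show ?thesis by (rule finite_subset) simp
qed

lemma midsection_nonempty: "midsection n \<noteq> {}"
proof -
  define x where "x = cube_vertex {..<n} + Poly_Mapping.single n (1 / 2)"
  have lk: "lk x j = (if j < n then 1 else if j = n then 1 / 2 else 0)" for j
    by (auto simp: x_def lookup_add lookup_cube_vertex lookup_single when_def)
  have "(\<Sum>j<2 * n + 1. lk x j) = (\<Sum>j<Suc n. lk x j)"
    by (rule sum.mono_neutral_right) (auto simp: lk)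
  also have "\<dots> = n + 1 / 2" by (simp add: lk)
  finally have "half_at n n x" by (auto simp: half_at_def lk)
  then show ?thesis by (auto simp: midsection_def)
qed

lemma card_half_at:
  assumes x: "half_at n i x"
  shows "card {j\<in>{..<2 * n + 1} - {i}. lk x j = 1} = n" "card {j\<in>{..<2 * n + 1} - {i}. lk x j = 0} = n"
proof -
  let ?J = "{..<2 * n + 1} - {i}"
  have i: "i \<in> {..<2 * n + 1}" using x by (simp add: half_at_def)
  have "real n + 1 / 2 = lk x i + (\<Sum>j\<in>?J. lk x j)"
    using x sum.remove[OF finite_lessThan i, of "lk x"] by (simp add: half_at_def)
  then have "real n = (\<Sum>j\<in>?J. lk x j)" using x by (simp add: half_at_def)
  also have "\<dots> = (\<Sum>j\<in>?J. if lk x j = 1 then 1 else 0)"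
    using x by (intro sum.cong) (auto simp: half_at_def)
  also have "\<dots> = card {j\<in>?J. lk x j = 1}" by (simp add: sum.If_cases Int_def)
  finally show one: "card {j\<in>?J. lk x j = 1} = n" by simp
  have "{j\<in>?J. lk x j = 0} = ?J - {j\<in>?J. lk x j = 1}" using x by (auto simp: half_at_def)
  moreover have "card ?J = 2 * n" using i by simp
  ultimately show "card {j\<in>?J. lk x j = 0} = n"
    using one card_Diff_subset[of "{j\<in>?J. lk x j = 1}" ?J] by auto
qed

text \<open>The neighbours of \<open>v\<close> arise by exchanging the half with another coordinate
  \<open>j\<close>. The dual functional is coordinate \<open>j\<close> with the factor
  \<open>2 * s j\<close>, where the sign \<open>s j\<close> points into the cube.\<close>

lemma midsection_frame:
  assumes v: "half_at n i v"
  shows "\<exists>h. vertex_frame (midsection n) v (slide v i ` ({..<2 * n + 1} - {i})) h"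
    and "card (slide v i ` ({..<2 * n + 1} - {i})) = 2 * n"
proof -
  let ?J = "{..<2 * n + 1} - {i}"
  define s where "s j = 1 - 2 * lk v j" for j
  have i: "i < 2 * n + 1" using v by (simp add: half_at_def)
  have s: "s j * s j = 1" if "j \<in> ?J" for j
    using v that by (auto simp: half_at_def s_def)
  have slide: "slide v i j - v = (s j / 2) *\<^sub>R (Poly_Mapping.single j 1 - Poly_Mapping.single i 1)" for j
    by (simp add: slide_def s_def)
  have mem: "slide v i j \<in> midsection n" if "j \<in> ?J" for j
    using half_at_slide[OF v] that by (auto simp: midsection_def)
  have lin: "linear (\<lambda>x. 2 * s j * lk x j)" for j
    by (auto intro!: linearI simp: lookup_add algebra_simps)
  have dual: "2 * s a * lk (slide v i b - v) a = (if a = b then 1 else 0)" if "a \<in> ?J" "b \<in> ?J" for a b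
    using that s[of b] by (auto simp: slide lookup_minus lookup_single when_def)
  have nonneg: "0 \<le> 2 * s j * lk (x - v) j" if x: "x \<in> midsection n" and j: "j \<in> ?J" for x j
  proof -
    obtain l where "half_at n l x" using x by (auto simp: midsection_def)
    then have "0 \<le> lk x j" "lk x j \<le> 1"
      using j by (cases "j = l"; force simp: half_at_def)+
    moreover have "lk v j = 0 \<or> lk v j = 1" using v j by (simp add: half_at_def)
    ultimately show ?thesis by (auto simp: s_def lookup_minus)
  qed
  have expand: "x - v = (\<Sum>j\<in>?J. (2 * s j * lk (x - v) j) *\<^sub>R (slide v i j - v))" if x: "x \<in> midsection n" for x
  proof (rule poly_mapping_eqI)
    fix l
    obtain m where m: "half_at n m x" using x by (auto simp: midsection_def)
    have "(\<Sum>j<2 * n + 1. lk (x - v) j) = 0"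
      using m v by (simp add: half_at_def lookup_minus sum_subtractf)
    \<comment> \<open>The functionals do not see coordinate \<open>i\<close>; it is recovered from
      the constant coordinate sum.\<close>
    then have neg: "(\<Sum>j\<in>?J. lk (x - v) j) = - lk (x - v) i"
      using sum.remove[of "{..<2 * n + 1}" i "lk (x - v)"] i by simp
    have "lk (\<Sum>j\<in>?J. (2 * s j * lk (x - v) j) *\<^sub>R (slide v i j - v)) l
        = (\<Sum>j\<in>?J. (s j * s j) * lk (x - v) j * ((if j = l then 1 else 0) - (if i = l then 1 else 0)))"
      unfolding slide by (auto simp: lookup_sum lookup_minus lookup_single when_def intro!: sum.cong)
    also have "\<dots> = (\<Sum>j\<in>?J. lk (x - v) j * ((if j = l then 1 else 0) - (if i = l then 1 else 0)))"
      using s by (intro sum.cong) auto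
    also have "\<dots> = lk (x - v) l"
    proof (cases "l = i")
      case True
      then have "(\<Sum>j\<in>?J. lk (x - v) j * ((if j = l then 1 else 0) - (if i = l then 1 else 0)))
          = (\<Sum>j\<in>?J. - lk (x - v) j)" by (intro sum.cong) auto
      then show ?thesis using True neg by (simp add: sum_negf)
    next
      case False
      then have "(\<Sum>j\<in>?J. lk (x - v) j * ((if j = l then 1 else 0) - (if i = l then 1 else 0)))
          = (\<Sum>j\<in>?J. if j = l then lk (x - v) j else 0)" by (intro sum.cong) auto
      also have "\<dots> = (if l < 2 * n + 1 then lk (x - v) l else 0)" using False by simp
      also have "\<dots> = lk (x - v) l" using m v by (simp add: half_at_def lookup_minus)
      finally show ?thesis .
    qed
    finally show "lk (x - v) l = lk (\<Sum>j\<in>?J. (2 * s j * lk (x - v) j) *\<^sub>R (slide v i j - v)) l" by simp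
  qed
  note frame = vertex_frame_indexed[of ?J "slide v i" "midsection n" "\<lambda>j x. 2 * s j * lk x j" v,
      OF _ mem lin dual nonneg expand]
  show "\<exists>h. vertex_frame (midsection n) v (slide v i ` ?J) h" by (rule frame(1)) auto
  have "card (slide v i ` ?J) = card ?J" by (rule frame(2)) auto
  then show "card (slide v i ` ?J) = 2 * n" using i by simp
qed

lemma simple_vertices_midsection: "simple_vertices (2 * n) (midsection n)"
  unfolding simple_vertices_def
proof
  fix v assume "v \<in> midsection n"
  then obtain i where "half_at n i v" by (auto simp: midsection_def)
  then show "\<exists>N h. vertex_frame (midsection n) v N h \<and> card N = 2 * n" using midsection_frame by blast
qed

lemmas facial_midsection_singleton =
  simple_vertices_facial_singleton[OF finite_midsection simple_vertices_midsection]

lemma facial_midsection_pair: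
  assumes "half_at n i v" "facial (midsection n) {v, w}" "w \<noteq> v"
  obtains j where "j < 2 * n + 1" "j \<noteq> i" "w = slide v i j"
proof -
  obtain h where "vertex_frame (midsection n) v (slide v i ` ({..<2 * n + 1} - {i})) h"
    using midsection_frame[OF assms(1)] by blast
  then have "w \<in> slide v i ` ({..<2 * n + 1} - {i})"
    using vertex_frame_facial_pair[OF finite_midsection] assms(2,3) by blast
  then show ?thesis using that by blast
qed

lemma slide_slide:
  assumes "lk v j = lk v k" "i \<noteq> j" "k \<noteq> i" "j \<noteq> k"
  shows "slide (slide v i j) j k = slide v i k"
  using assms by (intro poly_mapping_eqI) (simp add: lookup_slide)

text \<open>If \<open>v\<close> has equal entries at \<open>j\<close> and \<open>k\<close>, moving
  the half on from \<open>j\<close> to \<open>k\<close> restores entry \<open>j\<close>, so the two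
  neighbours are adjacent and form a triangle with \<open>v\<close>.\<close>

lemma facial_slides:
  assumes v: "half_at n i v" and jk: "j < 2 * n + 1" "k < 2 * n + 1" "j \<noteq> i" "k \<noteq> i" "j \<noteq> k"
    and eq: "lk v j = lk v k"
  shows "facial (midsection n) {slide v i j, slide v i k}"
proof -
  let ?w = "slide v i j"
  have w: "half_at n j ?w" using half_at_slide[OF v jk(1,3)] .
  obtain h where h: "vertex_frame (midsection n) ?w (slide ?w j ` ({..<2 * n + 1} - {j})) h"
    using midsection_frame[OF w] by blast
  have "slide v i k \<in> slide ?w j ` ({..<2 * n + 1} - {j})"
    using slide_slide[OF eq] jk by (metis DiffI image_eqI lessThan_iff singletonD)
  then show ?thesis
    using vertex_frame_edge[OF finite_midsection _ h _ facial_midsection_singleton] w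
    by (auto simp: midsection_def)
qed

text \<open>An edge between the two would have to move the half from \<open>j\<close> to
  \<open>k\<close>, but this leaves \<open>lk v j\<close> at position \<open>i\<close>, where
  \<open>lk v k\<close> is required.\<close>

lemma not_facial_slides:
  assumes v: "half_at n i v" and jk: "j < 2 * n + 1" "k < 2 * n + 1" "j \<noteq> i" "k \<noteq> i" "j \<noteq> k"
    and ne: "lk v j \<noteq> lk v k"
  shows "\<not> facial (midsection n) {slide v i j, slide v i k}"
proof
  assume fac: "facial (midsection n) {slide v i j, slide v i k}"
  have 01: "lk v j = 0 \<or> lk v j = 1" "lk v k = 0 \<or> lk v k = 1" using v jk by (auto simp: half_at_def)
  have w: "half_at n j (slide v i j)" using half_at_slide[OF v jk(1,3)] .
  have "slide v i k \<noteq> slide v i j"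
    using half_at_unique[OF half_at_slide[OF v jk(2,4)]] w jk(5) by metis
  then obtain l where l: "l < 2 * n + 1" "l \<noteq> j" "slide v i k = slide (slide v i j) j l"
    using facial_midsection_pair[OF w fac] by blast
  then have "l = k"
    using half_at_unique[OF half_at_slide[OF v jk(2,4)]] half_at_slide[OF w l(1,2)] by metis
  then have "lk (slide v i k) i = lk (slide (slide v i j) j k) i" using l by simp
  then show False
    using ne 01 jk by (auto simp: lookup_slide split: if_splits)
qed

definition dot :: "nat \<Rightarrow> (nat \<Rightarrow>\<^sub>0 real) \<Rightarrow> (nat \<Rightarrow>\<^sub>0 real) \<Rightarrow> real" where
  "dot m x y = (\<Sum>i<m. lk x i * lk y i)"

text \<open>The two displacements overlap only in coordinate \<open>i\<close>. For different entries
  at \<open>j\<close> and \<open>k\<close> the value is \<open>- 1 / 4\<close>.\<close>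

lemma dot_slides:
  assumes "i < m" "j < m" "k < m" "j \<noteq> i" "k \<noteq> i" "j \<noteq> k"
  shows "dot m (slide v i j - v) (slide v i k - v) = (1 - 2 * lk v j) * (1 - 2 * lk v k) / 4"
proof -
  have "dot m (slide v i j - v) (slide v i k - v)
      = (\<Sum>l<m. if l = i then (1 - 2 * lk v j) * (1 - 2 * lk v k) / 4 else 0)"
    unfolding dot_def using assms by (intro sum.cong) (auto simp: lookup_minus lookup_slide field_simps)
  then show ?thesis using assms(1) by simp
qed

lemma no_square_midsection: "no_square (midsection n)"
proof (rule no_square_obtuse[OF finite_midsection])
  show "bilinear (dot (2 * n + 1))"
    unfolding bilinear_def dot_def
    by (auto intro!: linearI simp: lookup_add algebra_simps sum.distrib sum_distrib_left)
  show "0 \<le> dot (2 * n + 1) x x" for x unfolding dot_def by (intro sum_nonneg) simp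
  show "dot (2 * n + 1) x y = dot (2 * n + 1) y x" for x y unfolding dot_def by (simp add: mult.commute)
  fix v assume "v \<in> midsection n"
  then obtain i where v: "half_at n i v" by (auto simp: midsection_def)
  obtain h where h: "vertex_frame (midsection n) v (slide v i ` ({..<2 * n + 1} - {i})) h"
    using midsection_frame[OF v] by blast
  have i: "i < 2 * n + 1" using v by (simp add: half_at_def)
  have "dot (2 * n + 1) (slide v i j - v) (slide v i k - v) < 0 \<or> facial (midsection n) {slide v i j, slide v i k}"
    if jk: "j < 2 * n + 1" "j \<noteq> i" "k < 2 * n + 1" "k \<noteq> i" "j \<noteq> k" for j k
  proof (cases "lk v j = lk v k")
    case True
    then show ?thesis using facial_slides[OF v] jk by blast
  next
    case False
    moreover have "lk v j = 0 \<or> lk v j = 1" "lk v k = 0 \<or> lk v k = 1" using v jk by (auto simp: half_at_def)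
    ultimately show ?thesis using dot_slides[OF i jk(1,3,2,4,5), of v] by auto
  qed
  then show "\<exists>N h. vertex_frame (midsection n) v N h \<and> (\<forall>w\<in>N. \<forall>w'\<in>N. w \<noteq> w' \<longrightarrow>
      dot (2 * n + 1) (w - v) (w' - v) < 0 \<or> facial (midsection n) {w, w'})"
    using h by (intro exI[of _ "slide v i ` ({..<2 * n + 1} - {i})"] exI[of _ h] conjI) auto
qed

text \<open>All other vertices of a simplex through \<open>v\<close> are neighbours of
  \<open>v\<close> and adjacent to each other, so they use positions at which \<open>v\<close> has
  the same entry. There are only \<open>n\<close> zeros and \<open>n\<close> ones.\<close>

lemma simplicial_bound_midsection: "simplicial_bound (midsection n) (n + 1)"
  unfolding simplicial_bound_def
proof (intro allI impI)
  fix A assume A: "facial (midsection n) A \<and> (\<forall>B\<subseteq>A. facial (midsection n) B)"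
  show "card A \<le> n + 1"
  proof (cases "A = {}")
    case False
    then obtain v where vA: "v \<in> A" by blast
    then obtain i where v: "half_at n i v" using A facial_subset by (fastforce simp: midsection_def)
    define J where "J = {j\<in>{..<2 * n + 1} - {i}. slide v i j \<in> A}"
    have "A \<subseteq> insert v (slide v i ` J)"
    proof
      fix w assume w: "w \<in> A"
      show "w \<in> insert v (slide v i ` J)"
      proof (cases "w = v")
        case False
        have "facial (midsection n) {v, w}" using A vA w by simp
        from facial_midsection_pair[OF v this False] show ?thesis using w by (auto simp: J_def)
      qed simp
    qed
    then have "card A \<le> card (insert v (slide v i ` J))" by (intro card_mono) (simp_all add: J_def)
    also have "\<dots> \<le> Suc (card (slide v i ` J))" by (rule card_insert_le_m1) simp_all
    also have "\<dots> \<le> Suc (card J)" by (simp add: card_image_le J_def)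
    also have "card J \<le> n"
    proof -
      have same: "lk v j = lk v k" if jk: "j \<in> J" "k \<in> J" for j k
      proof (rule ccontr)
        assume ne: "lk v j \<noteq> lk v k"
        then have "\<not> facial (midsection n) {slide v i j, slide v i k}"
          using jk by (intro not_facial_slides[OF v]) (auto simp: J_def)
        then show False using A jk by (auto simp: J_def)
      qed
      have 01: "lk v j = 0 \<or> lk v j = 1" if "j \<in> J" for j using v that by (auto simp: half_at_def J_def)
      have subI: "J \<subseteq> {j\<in>{..<2 * n + 1} - {i}. lk v j = c}" if "\<And>j. j \<in> J \<Longrightarrow> lk v j = c" for c
        using that by (auto simp: J_def)
      have "\<exists>c. (c = 0 \<or> c = 1) \<and> (\<forall>j\<in>J. lk v j = c)"
      proof (cases "J = {}")
        case False
        then obtain k where "k \<in> J" by blast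
        have "\<forall>j\<in>J. lk v j = lk v k" by (intro ballI same \<open>k \<in> J\<close>)
        then show ?thesis using 01[OF \<open>k \<in> J\<close>] by blast
      qed auto
      then obtain c where c: "c = 0 \<or> c = 1" "\<And>j. j \<in> J \<Longrightarrow> lk v j = c" by blast
      have "card J \<le> card {j\<in>{..<2 * n + 1} - {i}. lk v j = c}"
        by (rule card_mono[OF _ subI[OF c(2)]]) simp_all
      also have "\<dots> = n" using c(1) card_half_at[OF v] by metis
      finally show ?thesis .
    qed
    finally show ?thesis by simp
  qed simp
qed

section \<open>Assembling the polytopes\<close>

lemma square_linear_image:
  assumes "linear L" "inj L"
  shows "square (L ` V) (L a) (L b) (L c) (L d) \<longleftrightarrow> square V a b c d"
proof -
  note f = facial_linear_image[OF assms, of V]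
  show ?thesis
    using f[of "{a, b, c, d}"] f[of "{a, b}"] f[of "{b, c}"] f[of "{c, d}"] f[of "{d, a}"] f[of "{a, c}"] f[of "{b, d}"]
      assms(2) unfolding square_def by (simp add: inj_eq)
qed

lemma square_subset: "square V a b c d \<Longrightarrow> {a, b, c, d} \<subseteq> V"
  using facial_subset[of V "{a, b, c, d}"] by (simp add: square_def)

lemma no_square_linear_image:
  assumes "linear L" "inj L" "no_square V"
  shows "no_square (L ` V)"
  unfolding no_square_def
proof (intro allI notI)
  fix a b c d assume sq: "square (L ` V) a b c d"
  obtain a' b' c' d' where "a = L a'" "b = L b'" "c = L c'" "d = L d'"
    using square_subset[OF sq] unfolding insert_subset image_iff by blast
  then have "square V a' b' c' d'" using sq square_linear_image[OF assms(1,2)] by blast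
  with assms(3) show False unfolding no_square_def by blast
qed

lemma cube_free_linear_image:
  assumes L: "linear L" "inj L" and V: "cube_free V k"
  shows "cube_free (L ` V) k"
  unfolding cube_free_def
proof (intro allI impI notI)
  fix I :: "nat set" and q assume I: "finite I \<and> card I = k" and q: "cubical (L ` V) I q"
  have "cubical V I (inv L \<circ> q)"
    unfolding cubical_def comp_def
  proof (intro allI impI)
    fix S i j assume "S \<subseteq> I" "i \<in> I - S" "j \<in> I - S" "i \<noteq> j"
    then have sq: "square (L ` V) (q S) (q (insert i S)) (q (insert i (insert j S))) (q (insert j S))"
      using q unfolding cubical_def by blast
    have "L (inv L x) = x" if "x \<in> {q S, q (insert i S), q (insert i (insert j S)), q (insert j S)}" for x
      using square_subset[OF sq] that f_inv_into_f[of x L UNIV] by blast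
    then show "square V (inv L (q S)) (inv L (q (insert i S))) (inv L (q (insert i (insert j S)))) (inv L (q (insert j S)))"
      using sq by (subst square_linear_image[OF L, symmetric]) simp
  qed
  with V I show False unfolding cube_free_def by blast
qed

lemma simplicial_bound_linear_image:
  assumes L: "linear L" "inj L" and V: "simplicial_bound V s"
  shows "simplicial_bound (L ` V) s"
  unfolding simplicial_bound_def
proof (intro allI impI)
  fix A assume A: "facial (L ` V) A \<and> (\<forall>B\<subseteq>A. facial (L ` V) B)"
  then obtain B where B: "A = L ` B" using facial_subset[of "L ` V" A] by (metis subset_imageE)
  have "facial V C" if "C \<subseteq> B" for C
    using A that facial_linear_image[OF L, of V C] unfolding B by blast
  then have "card B \<le> s" using V unfolding simplicial_bound_def by blast
  then show "card A \<le> s" using B L(2) by (simp add: card_image inj_on_subset)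
qed

text \<open>Even and odd positions embed a product of two sequence spaces into one, so that all
  powers and joins have the type in which the thresholds are defined.\<close>

definition interleave :: "(nat \<Rightarrow>\<^sub>0 real) \<times> (nat \<Rightarrow>\<^sub>0 real) \<Rightarrow> (nat \<Rightarrow>\<^sub>0 real)" where
  "interleave = (\<lambda>(x, y). Abs_poly_mapping (\<lambda>i. if even i then lk x (i div 2) else lk y (i div 2)))"

lemma lookup_interleave:
  "lk (interleave (x, y)) i = (if even i then lk x (i div 2) else lk y (i div 2))"
proof -
  have "finite ((\<lambda>j. 2 * j) ` {j. lk x j \<noteq> 0} \<union> (\<lambda>j. 2 * j + 1) ` {j. lk y j \<noteq> 0})" by simp
  moreover have "{i. (if even i then lk x (i div 2) else lk y (i div 2)) \<noteq> 0}
      \<subseteq> (\<lambda>j. 2 * j) ` {j. lk x j \<noteq> 0} \<union> (\<lambda>j. 2 * j + 1) ` {j. lk y j \<noteq> 0}"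
  proof
    fix i assume "i \<in> {i. (if even i then lk x (i div 2) else lk y (i div 2)) \<noteq> 0}"
    moreover have "i = 2 * (i div 2)" if "even i" using that by simp
    moreover have "i = 2 * (i div 2) + 1" if "odd i" using that by simp
    ultimately show "i \<in> (\<lambda>j. 2 * j) ` {j. lk x j \<noteq> 0} \<union> (\<lambda>j. 2 * j + 1) ` {j. lk y j \<noteq> 0}"
      by (cases "even i") (auto simp only: mem_Collect_eq if_True if_False)
  qed
  ultimately have "finite {i. (if even i then lk x (i div 2) else lk y (i div 2)) \<noteq> 0}"
    by (rule rev_finite_subset)
  then show ?thesis by (simp add: interleave_def)
qed

lemma linear_interleave: "linear interleave"
  by (rule linearI) (auto simp: lookup_interleave lookup_add intro!: poly_mapping_eqI)

lemma inj_interleave: "inj interleave"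
proof (rule injI)
  fix p q :: "(nat \<Rightarrow>\<^sub>0 real) \<times> (nat \<Rightarrow>\<^sub>0 real)" assume eq: "interleave p = interleave q"
  obtain x y x' y' where pq: "p = (x, y)" "q = (x', y')" by (metis prod.exhaust)
  have "lk x i = lk x' i" for i
    using arg_cong[OF eq, of "\<lambda>z. lk z (2 * i)"] by (simp add: pq lookup_interleave)
  moreover have "lk y i = lk y' i" for i
    using arg_cong[OF eq, of "\<lambda>z. lk z (2 * i + 1)"] by (simp add: pq lookup_interleave)
  ultimately show "p = q" unfolding pq by (auto intro!: poly_mapping_eqI)
qed

definition embeds :: "('a::real_vector \<Rightarrow> (nat \<Rightarrow>\<^sub>0 real)) \<Rightarrow> bool" where
  "embeds L \<longleftrightarrow> linear L \<and> inj L"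

lemma embeds_Pair:
  assumes "embeds f" "embeds g"
  shows "embeds (\<lambda>(a, b). interleave (f a, g b))"
proof -
  note lin = linear_add linear_scale
  have f: "linear f" "inj f" and g: "linear g" "inj g" using assms by (auto simp: embeds_def)
  have "linear (\<lambda>p. interleave (f (fst p), g (snd p)))"
    by (rule linearI) (simp_all add: lin[OF f(1)] lin[OF g(1)] flip: lin[OF linear_interleave])
  moreover have "inj (\<lambda>p. interleave (f (fst p), g (snd p)))"
    by (rule injI)
      (simp add: inj_eq[OF inj_interleave] inj_eq[OF f(2)] inj_eq[OF g(2)] prod_eq_iff)
  ultimately show ?thesis by (simp add: embeds_def case_prod_unfold)
qed

lemma embeds_real: "embeds (Poly_Mapping.single 0 :: real \<Rightarrow> _)"
  unfolding embeds_def
proof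
  show "linear (Poly_Mapping.single 0 :: real \<Rightarrow> nat \<Rightarrow>\<^sub>0 real)"
    by (rule linearI) (auto intro!: poly_mapping_eqI simp: lookup_single lookup_add when_def)
  show "inj (Poly_Mapping.single 0 :: real \<Rightarrow> nat \<Rightarrow>\<^sub>0 real)"
    by (rule injI) (metis lookup_single_eq)
qed

lemma embeds_id: "embeds (\<lambda>x. x)"
  by (simp add: embeds_def linear_ident)

lemmas embeds_quad = embeds_Pair[OF embeds_real embeds_Pair[OF embeds_real embeds_Pair[OF embeds_real embeds_real]]]

definition square_free_system :: "nat \<Rightarrow> 'a::real_vector set \<Rightarrow> bool" where
  "square_free_system s V \<longleftrightarrow> finite V \<and> V \<noteq> {} \<and> (\<forall>v\<in>V. facial V {v}) \<and> simplicial_bound V s \<and> no_square V"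

lemma facial_singleton_linear_image:
  assumes "linear L" "inj L" "\<forall>v\<in>V. facial V {v}"
  shows "\<forall>y\<in>L ` V. facial (L ` V) {y}"
proof
  fix y assume "y \<in> L ` V"
  then obtain v where "y = L v" "v \<in> V" by blast
  then show "facial (L ` V) {y}" using facial_linear_image[OF assms(1,2), of V "{v}"] assms(3) by simp
qed

lemma square_free_system_image:
  assumes "embeds L" "square_free_system s V"
  shows "square_free_system s (L ` V)"
proof -
  have L: "linear L" "inj L" using assms(1) by (simp_all add: embeds_def)
  have V: "finite V" "V \<noteq> {}" "\<forall>v\<in>V. facial V {v}" "simplicial_bound V s" "no_square V"
    using assms(2) unfolding square_free_system_def by blast+
  show ?thesis
    unfolding square_free_system_def
    using V(1,2) facial_singleton_linear_image[OF L V(3)] simplicial_bound_linear_image[OF L V(4)]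
      no_square_linear_image[OF L V(5)] by simp
qed

lemma square_free_system_simple:
  assumes "finite V" "V \<noteq> {}" "simple_vertices d V" "no_square V" "simplicial_bound V s"
  shows "square_free_system s V"
  using assms simple_vertices_facial_singleton[OF assms(1,3)] by (simp add: square_free_system_def)

lemma has_dim_simple_vertices:
  assumes "finite V" "V \<noteq> {}" "simple_vertices d V"
  shows "has_dim V d"
proof -
  have "has_dim (convex hull V) d"
    using is_simple_polytope_simple_vertices[OF assms] unfolding is_simple_polytope_def is_polytope_def by blast
  then show ?thesis by (simp add: has_dim_def)
qed

section \<open>Powers of a building block\<close>

definition prod_points :: "(nat \<Rightarrow>\<^sub>0 real) set \<Rightarrow> (nat \<Rightarrow>\<^sub>0 real) set \<Rightarrow> (nat \<Rightarrow>\<^sub>0 real) set" where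
  "prod_points V W = interleave ` (V \<times> W)"

text \<open>\<open>R\<close> stands for any property that is additive over products;
  \<open>has_dim\<close> gives the general bound and \<open>simple_vertices\<close> the simple one.
  There are \<open>Suc r\<close> factors, and for a single factor the excluded cube is a square,
  which accounts for \<open>Suc (Suc r)\<close>.\<close>

lemma powers_exist:
  fixes Q :: "(nat \<Rightarrow>\<^sub>0 real) set"
  assumes Q: "square_free_system s Q" "R d Q" and s: "s \<ge> 1"
    and R: "\<And>m n V W. R m V \<Longrightarrow> R n W \<Longrightarrow> R (m + n) (prod_points V W)"
  shows "\<exists>P :: (nat \<Rightarrow>\<^sub>0 real) set. finite P \<and> P \<noteq> {} \<and> (\<forall>v\<in>P. facial P {v}) \<and> simplicial_bound P s \<and>
    cube_free P (Suc (Suc r)) \<and> R (d * Suc r) P"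
proof (induction r)
  case 0
  have "cube_free Q (Suc (Suc 0))"
    using Q(1) no_square_cube_free[of Q] unfolding square_free_system_def by simp
  then show ?case using Q unfolding square_free_system_def by auto
next
  case (Suc r)
  then obtain P :: "(nat \<Rightarrow>\<^sub>0 real) set" where P: "finite P" "P \<noteq> {}" "\<forall>v\<in>P. facial P {v}" "simplicial_bound P s"
      "cube_free P (Suc (Suc r))" "R (d * Suc r) P" by blast
  have Q': "finite Q" "Q \<noteq> {}" "\<forall>v\<in>Q. facial Q {v}" "simplicial_bound Q s" "no_square Q"
    using Q(1) unfolding square_free_system_def by blast+
  let ?P = "prod_points P Q"
  note L = linear_interleave inj_interleave
  have "\<forall>p\<in>P \<times> Q. facial (P \<times> Q) {p}"
  proof
    fix p assume "p \<in> P \<times> Q"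
    then have "facial P {fst p}" "facial Q {snd p}" using P(3) Q'(3) by auto
    moreover have "{p} = {fst p} \<times> {snd p}" by simp
    ultimately show "facial (P \<times> Q) {p}" unfolding facial_Times_iff by metis
  qed
  then have "\<forall>v\<in>?P. facial ?P {v}"
    unfolding prod_points_def by (rule facial_singleton_linear_image[OF L])
  moreover have "simplicial_bound ?P s"
    unfolding prod_points_def using P Q' s
    by (intro simplicial_bound_linear_image[OF L] simplicial_bound_Times) auto
  moreover have "cube_free ?P (Suc (Suc (Suc r)))"
    unfolding prod_points_def using P Q'
    by (intro cube_free_linear_image[OF L] cube_free_Times) auto
  moreover have "R (d * Suc (Suc r)) ?P"
    using R[OF P(6) Q(2)] by (simp add: algebra_simps)
  moreover have "finite ?P" "?P \<noteq> {}" using P Q' unfolding prod_points_def by auto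
  ultimately show ?case by blast
qed

lemma has_dim_prod_points:
  "has_dim V m \<Longrightarrow> has_dim W n \<Longrightarrow> has_dim (prod_points V W) (m + n)"
  unfolding prod_points_def
  by (intro has_dim_linear_image[OF linear_interleave inj_interleave] has_dim_Times)

lemma simple_vertices_prod_points:
  "simple_vertices m V \<Longrightarrow> simple_vertices n W \<Longrightarrow> simple_vertices (m + n) (prod_points V W)"
  unfolding prod_points_def
  by (intro simple_vertices_linear_image[OF linear_interleave inj_interleave] simple_vertices_Times)

section \<open>Building blocks for each \<open>l\<close>, and the two bounds\<close>

lemma square_free_system_cell120: "square_free_system 2 cell120"
  using cell120_properties by (rule square_free_system_simple)

lemma has_dim_cell120: "has_dim cell120 4"
  using cell120_properties(1-3) by (rule has_dim_simple_vertices)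

lemma square_free_system_join:
  fixes V :: "(nat \<Rightarrow>\<^sub>0 real) set"
  assumes V: "square_free_system s V" "has_dim V d"
  shows "\<exists>W :: (nat \<Rightarrow>\<^sub>0 real) set. square_free_system (s + 2) W \<and> has_dim W (d + 5)"
proof -
  obtain L :: "(nat \<Rightarrow>\<^sub>0 real) \<times> quad \<times> real \<Rightarrow> (nat \<Rightarrow>\<^sub>0 real)" where L: "embeds L"
    using embeds_Pair[OF embeds_id embeds_Pair[OF embeds_quad embeds_real]] by blast
  let ?J = "join_points V cell120"
  have c: "finite cell120" "\<And>v. v \<in> cell120 \<Longrightarrow> facial cell120 {v}" "simplicial_bound cell120 2" "no_square cell120"
    using square_free_system_cell120 unfolding square_free_system_def by blast+
  have v: "finite V" "V \<noteq> {}" "\<And>v. v \<in> V \<Longrightarrow> facial V {v}" "simplicial_bound V s" "no_square V"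
    using V(1) unfolding square_free_system_def by blast+
  have "square_free_system (s + 2) ?J"
    unfolding square_free_system_def
  proof (intro conjI ballI)
    show "finite ?J" by (rule finite_join_points[OF v(1) c(1)])
    show "?J \<noteq> {}" using v(2) by (simp add: join_points_def)
    show "facial ?J {x}" if "x \<in> ?J" for x
      by (rule facial_join_points_singleton[OF v(1) c(1) v(3) c(2) that])
    show "simplicial_bound ?J (s + 2)" by (rule simplicial_bound_join_points[OF v(1) c(1) v(4) c(3)])
    show "no_square ?J" by (rule no_square_join_points[OF v(1) c(1) v(3) c(2) v(5) c(4)])
  qed
  then have "square_free_system (s + 2) (L ` ?J)" by (rule square_free_system_image[OF L])
  moreover have "has_dim (L ` ?J) (d + 4 + 1)"
    using L unfolding embeds_def by (intro has_dim_linear_image has_dim_join_points V(2) has_dim_cell120) auto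
  moreover have "d + 4 + 1 = d + 5" by simp
  ultimately show ?thesis by metis
qed

text \<open>Each joining adds 1 to the sum of the dimensions, and there is one joining less than
  there are parts; hence 5 for each 120-cell, 1 for the extra point, and the final
  \<open>- 1\<close>.\<close>

lemma square_free_systems_exist:
  assumes "l \<ge> 1"
  shows "\<exists>V :: (nat \<Rightarrow>\<^sub>0 real) set. square_free_system l V \<and> has_dim V (5 * (l div 2) + l mod 2 - 1)"
  using assms
proof (induction l rule: less_induct)
  case (less l)
  consider "l = 1" | "l = 2" | "l \<ge> 3" using less.prems by linarith
  then show ?case
  proof cases
    case 1
    \<comment> \<open>The extra point for odd \<open>l\<close>, on which the 120-cells are
      joined.\<close>
    let ?V = "{0} :: (nat \<Rightarrow>\<^sub>0 real) set"
    have "no_square ?V"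
      unfolding no_square_def using square_subset[of ?V] by (fastforce simp: square_def)
    moreover have "simplicial_bound ?V 1"
      unfolding simplicial_bound_def using facial_subset[of ?V] card_mono[of ?V] by fastforce
    ultimately have "square_free_system 1 ?V" by (simp add: square_free_system_def facial_self)
    moreover have "has_dim ?V 0"
      unfolding has_dim_def by (intro exI[of _ ?V]) simp
    ultimately show ?thesis using 1 by auto
  next
    case 2
    obtain L :: "quad \<Rightarrow> (nat \<Rightarrow>\<^sub>0 real)" where L: "embeds L" using embeds_quad by blast
    have "square_free_system 2 (L ` cell120)" by (rule square_free_system_image[OF L square_free_system_cell120])
    moreover have "has_dim (L ` cell120) 4"
      using L has_dim_cell120 unfolding embeds_def by (intro has_dim_linear_image) auto
    ultimately show ?thesis using 2 by auto
  next
    case 3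
    then have "l - 2 < l" "1 \<le> l - 2" by simp_all
    from less.IH[OF this] obtain V :: "(nat \<Rightarrow>\<^sub>0 real) set" where
        V: "square_free_system (l - 2) V" "has_dim V (5 * ((l - 2) div 2) + (l - 2) mod 2 - 1)"
      by blast
    define m where "m = l - 2"
    have m: "l = m + 2" "m \<ge> 1" using 3 by (simp_all add: m_def)
    \<comment> \<open>Ensures that the truncated subtraction of 1 commutes with adding 5.\<close>
    have "1 \<le> 5 * (m div 2) + m mod 2" using mult_div_mod_eq[of 2 m] m(2) by linarith
    then have "5 * (m div 2) + m mod 2 - 1 + 5 = 5 * (l div 2) + l mod 2 - 1" by (simp add: m(1))
    then show ?thesis using square_free_system_join[OF V] m(1) by simp
  qed
qed

lemma simple_square_free_systems_exist:
  assumes "l \<ge> 2"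
  shows "\<exists>V :: (nat \<Rightarrow>\<^sub>0 real) set. square_free_system l V \<and> simple_vertices (max 4 (2 * (l - 1))) V"
proof (cases "l = 2")
  \<comment> \<open>The section \<open>midsection 1\<close> is a hexagon of dimension 2, whereas the
    120-cell has the required dimension 4.\<close>
  case True
  obtain L :: "quad \<Rightarrow> (nat \<Rightarrow>\<^sub>0 real)" where L: "embeds L" using embeds_quad by blast
  have "square_free_system 2 (L ` cell120)" by (rule square_free_system_image[OF L square_free_system_cell120])
  moreover have "simple_vertices 4 (L ` cell120)"
    using L cell120_properties(3) unfolding embeds_def by (intro simple_vertices_linear_image) auto
  ultimately show ?thesis using True by auto
next
  case False
  have "square_free_system (l - 1 + 1) (midsection (l - 1))"
    by (rule square_free_system_simple[OF finite_midsection midsection_nonempty simple_vertices_midsection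
          no_square_midsection simplicial_bound_midsection])
  moreover have "max 4 (2 * (l - 1)) = 2 * (l - 1)" using False assms by simp
  ultimately show ?thesis using simple_vertices_midsection[of "l - 1"] assms by auto
qed

text \<open>A counterexample in dimension \<open>D\<close> refutes every candidate
  \<open>n \<le> D\<close>, so the infimum is at least \<open>D + 1\<close>, also when it is
  infinite.\<close>

lemma threshold_ge:
  assumes "\<And>n :: nat. P n \<Longrightarrow> D < n"
  shows "enat (D + 1) \<le> Inf {enat n |n. P n}"
  using assms by (intro Inf_greatest) (auto simp: Suc_le_eq)

theorem theoremB:
  fixes l k :: nat
  assumes "l \<ge> 2" and "k \<ge> 2"
  shows "f_threshold l k \<ge> enat ((5 * (l div 2) + l mod 2 - 1) * (k - 1) + 1)
       \<and> fs_threshold l k \<ge> enat (max 4 (2 * (l - 1)) * (k - 1) + 1)"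
proof
  \<comment> \<open>The power has \<open>k - 1 = Suc r\<close> factors.\<close>
  obtain r where r: "k = Suc (Suc r)" using assms(2) by (metis add_2_eq_Suc le_Suc_ex)
  have l: "l \<ge> 1" using assms(1) by simp
  let ?d = "5 * (l div 2) + l mod 2 - 1" and ?e = "max 4 (2 * (l - 1))"
  obtain Q :: "(nat \<Rightarrow>\<^sub>0 real) set" where Q: "square_free_system l Q" "has_dim Q ?d"
    using square_free_systems_exist[OF l] by blast
  obtain P :: "(nat \<Rightarrow>\<^sub>0 real) set" where P: "finite P" "P \<noteq> {}" "\<forall>v\<in>P. facial P {v}" "simplicial_bound P l"
      "cube_free P k" "has_dim P (?d * (k - 1))"
    using powers_exist[of l Q "\<lambda>d V. has_dim V d" ?d r, OF Q l has_dim_prod_points] by (auto simp: r)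
  have "is_polytope (?d * (k - 1)) (convex hull P)"
    using P(1,6) unfolding is_polytope_def polytope_def has_dim_def by auto
  moreover have "\<not> has_simplex_face l (convex hull P)" "\<not> has_cube_face k (convex hull P)"
    using no_simplex_face[OF P(1) _ P(4)] no_cube_face[OF P(1) _ P(5)] P(3) by blast+
  ultimately show "f_threshold l k \<ge> enat (?d * (k - 1) + 1)"
    unfolding f_threshold_def by (intro threshold_ge) (metis not_less)
  obtain Q' :: "(nat \<Rightarrow>\<^sub>0 real) set" where Q': "square_free_system l Q'" "simple_vertices ?e Q'"
    using simple_square_free_systems_exist[OF assms(1)] by blast
  obtain S :: "(nat \<Rightarrow>\<^sub>0 real) set" where S: "finite S" "S \<noteq> {}" "\<forall>v\<in>S. facial S {v}" "simplicial_bound S l"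
      "cube_free S k" "simple_vertices (?e * (k - 1)) S"
    using powers_exist[of l Q' simple_vertices ?e r, OF Q' l simple_vertices_prod_points] by (auto simp: r)
  have "is_simple_polytope (?e * (k - 1)) (convex hull S)"
    by (rule is_simple_polytope_simple_vertices[OF S(1,2,6)])
  moreover have "\<not> has_simplex_face l (convex hull S)" "\<not> has_cube_face k (convex hull S)"
    using no_simplex_face[OF S(1) _ S(4)] no_cube_face[OF S(1) _ S(5)] S(3) by blast+
  ultimately show "fs_threshold l k \<ge> enat (?e * (k - 1) + 1)"
    unfolding fs_threshold_def by (intro threshold_ge) (metis not_less)
qed

end
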